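(* Let $\mathcal{C},\mathcal{D}$ be finite tensor categories such that there exist a quasi-fiber functor $F_{\mathcal{D}}:\mathcal{D}\to\mathrm{Vec}$ and an essentially surjective quasi-tensor functor $G:\mathcal{C}\to\mathcal{D}$. Let $U=\mathrm{End}(F_{\mathcal{D}}\circ G)$ and $C=\mathrm{End}(F_{\mathcal{D}})$ be the associated quasi-bialgebras. Then there is an inclusion $C\subset U$ preserving the coproduct, the counit and the algebra structure.
   Context: Work over $\mathbb{C}$. A quasi-tensor functor between tensor categories is an exact faithful linear functor $G$ with $G(\mathbf 1)=\mathbf 1$ together with a natural isomorphism $G(X)\otimes G(Y)\cong G(X\otimes Y)$, with no compatibility with associators required. A quasi-fiber functor is a quasi-tensor functor to the category $\mathrm{Vec}$ of finite-dimensional vector spaces. For a quasi-fiber functor $F$ on a finite tensor category, $\mathrm{End}(F)$ is the algebra of natural endomorphisms of $F$, with its reconstructed quasi-bialgebra structure (the coproduct of $a\in\mathrm{End}(F)$ is given by the action of $a$ on $F(X\otimes Y)\cong F(X)\otimes F(Y)$, the counit by its action on $F(\mathbf 1)=\mathbb{C}$). The inclusion is not asserted to preserve coassociators. *)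

theory Defs
  imports Complex_Main "HOL-Algebra.Module"
begin

section \<open>Complex vector spaces\<close>

text \<open>
  A complex vector space with carrier in the type \<open>'v\<close> is a record of type
  \<open>(complex, 'v) module\<close> satisfying the locale \<open>module complex_ring\<close>.  The fields \<open>mult\<close> and
  \<open>one\<close> of that record play no role for vector spaces; they carry the multiplication and the
  unit when the vector space is an algebra.
\<close>

definition complex_ring :: "complex ring" where
  "complex_ring = \<lparr>carrier = UNIV, mult = (*), one = 1, zero = 0, add = (+)\<rparr>"

definition complex_line :: "(complex, complex) module" where
  "complex_line = \<lparr>carrier = UNIV, mult = (*), one = 1, zero = 0, add = (+), smult = (*)\<rparr>"

definition finite_dimensional :: "(complex, 'v) module \<Rightarrow> bool" where
  "finite_dimensional V \<longleftrightarrow>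
     (\<exists>S. finite S \<and> S \<subseteq> carrier V \<and>
        (\<forall>v\<in>carrier V. \<exists>c. v = (\<Oplus>\<^bsub>V\<^esub>s\<in>S. c s \<odot>\<^bsub>V\<^esub> s)))"

definition lin_maps :: "(complex, 'v) module \<Rightarrow> (complex, 'w) module \<Rightarrow> ('v \<Rightarrow> 'w) set" where
  "lin_maps V W =
     {f \<in> carrier V \<rightarrow>\<^sub>E carrier W.
        (\<forall>x\<in>carrier V. \<forall>y\<in>carrier V. f (x \<oplus>\<^bsub>V\<^esub> y) = f x \<oplus>\<^bsub>W\<^esub> f y) \<and>
        (\<forall>c. \<forall>x\<in>carrier V. f (c \<odot>\<^bsub>V\<^esub> x) = c \<odot>\<^bsub>W\<^esub> f x)}"

definition lin_isos :: "(complex, 'v) module \<Rightarrow> (complex, 'w) module \<Rightarrow> ('v \<Rightarrow> 'w) set" where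
  "lin_isos V W = {f \<in> lin_maps V W. bij_betw f (carrier V) (carrier W)}"

definition lin_space ::
    "(complex, 'v) module \<Rightarrow> (complex, 'w) module \<Rightarrow> (complex, 'v \<Rightarrow> 'w) module" where
  "lin_space V W =
     \<lparr>carrier = lin_maps V W, mult = undefined, one = undefined,
      zero = (\<lambda>x\<in>carrier V. \<zero>\<^bsub>W\<^esub>),
      add = (\<lambda>f g. \<lambda>x\<in>carrier V. f x \<oplus>\<^bsub>W\<^esub> g x),
      smult = (\<lambda>c f. \<lambda>x\<in>carrier V. c \<odot>\<^bsub>W\<^esub> f x)\<rparr>"

definition algebra_homs :: "(complex, 'a) module \<Rightarrow> (complex, 'b) module \<Rightarrow> ('a \<Rightarrow> 'b) set" where
  "algebra_homs A B = ring_hom A B \<inter> lin_maps A B"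


subsection \<open>Tensor products\<close>

definition bilinear_forms ::
    "(complex, 'v) module \<Rightarrow> (complex, 'w) module \<Rightarrow> ('v \<Rightarrow> 'w \<Rightarrow> complex) set" where
  "bilinear_forms V W =
     {\<beta>. (\<forall>w\<in>carrier W. (\<lambda>v\<in>carrier V. \<beta> v w) \<in> lin_maps V complex_line) \<and>
         (\<forall>v\<in>carrier V. (\<lambda>w\<in>carrier W. \<beta> v w) \<in> lin_maps W complex_line)}"

text \<open>
  Over a field, bilinear forms separate the elements of the algebraic tensor product
  \<open>V \<otimes> W\<close>.  So \<open>V \<otimes> W\<close> is realised as the space of those functionals on the bilinear forms
  on \<open>V \<times> W\<close> that are finite sums of the evaluations \<open>v \<otimes> w : \<beta> \<mapsto> \<beta>(v, w)\<close>.
  Functionals are extended by \<open>0\<close> to functions that are not bilinear.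
\<close>

definition pure_tensor ::
    "(complex, 'v) module \<Rightarrow> (complex, 'w) module \<Rightarrow> 'v \<Rightarrow> 'w \<Rightarrow> ('v \<Rightarrow> 'w \<Rightarrow> complex) \<Rightarrow> complex" where
  "pure_tensor V W v w = (\<lambda>\<beta>. if \<beta> \<in> bilinear_forms V W then \<beta> v w else 0)"

definition tensor_space ::
    "(complex, 'v) module \<Rightarrow> (complex, 'w) module
       \<Rightarrow> (complex, ('v \<Rightarrow> 'w \<Rightarrow> complex) \<Rightarrow> complex) module" where
  "tensor_space V W =
     \<lparr>carrier = {\<lambda>\<beta>. \<Sum>i<n. pure_tensor V W (v i) (w i) \<beta> |(n::nat) v w.
                   (\<forall>i<n. v i \<in> carrier V) \<and> (\<forall>i<n. w i \<in> carrier W)},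
      mult = undefined, one = undefined,
      zero = (\<lambda>\<beta>. 0),
      add = (\<lambda>s t \<beta>. s \<beta> + t \<beta>),
      smult = (\<lambda>c t \<beta>. c * t \<beta>)\<rparr>"

text \<open>The linear map out of \<open>V \<otimes> W\<close> induced by a bilinear map \<open>B\<close>.\<close>

definition tensor_lift ::
    "(complex, 'v) module \<Rightarrow> (complex, 'w) module \<Rightarrow> (complex, 'u) module
       \<Rightarrow> ('v \<Rightarrow> 'w \<Rightarrow> 'u) \<Rightarrow> (('v \<Rightarrow> 'w \<Rightarrow> complex) \<Rightarrow> complex) \<Rightarrow> 'u" where
  "tensor_lift V W U B =
     (THE L. L \<in> lin_maps (tensor_space V W) U \<and>
             (\<forall>v\<in>carrier V. \<forall>w\<in>carrier W. L (pure_tensor V W v w) = B v w))"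

definition tensor_map ::
    "(complex, 'v) module \<Rightarrow> (complex, 'w) module \<Rightarrow> (complex, 'x) module \<Rightarrow> (complex, 'y) module
       \<Rightarrow> ('v \<Rightarrow> 'x) \<Rightarrow> ('w \<Rightarrow> 'y)
       \<Rightarrow> (('v \<Rightarrow> 'w \<Rightarrow> complex) \<Rightarrow> complex) \<Rightarrow> (('x \<Rightarrow> 'y \<Rightarrow> complex) \<Rightarrow> complex)" where
  "tensor_map V W X Y f g =
     tensor_lift V W (tensor_space X Y) (\<lambda>v w. pure_tensor X Y (f v) (g w))"


section \<open>Linear and abelian categories\<close>

record ('o, 'm) lcat =
  Obj :: "'o set"
  Arr :: "'m set"
  Dom :: "'m \<Rightarrow> 'o"
  Cod :: "'m \<Rightarrow> 'o"
  Id :: "'o \<Rightarrow> 'm"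
  Comp :: "'m \<Rightarrow> 'm \<Rightarrow> 'm" (infixr \<open>\<cdot>\<index>\<close> 70)
  ZeroA :: "'o \<Rightarrow> 'o \<Rightarrow> 'm"
  AddA :: "'m \<Rightarrow> 'm \<Rightarrow> 'm"
  ScaleA :: "complex \<Rightarrow> 'm \<Rightarrow> 'm"

definition Hom :: "('o, 'm, 'x) lcat_scheme \<Rightarrow> 'o \<Rightarrow> 'o \<Rightarrow> 'm set" where
  "Hom C X Y = {f \<in> Arr C. Dom C f = X \<and> Cod C f = Y}"

definition hom_space :: "('o, 'm, 'x) lcat_scheme \<Rightarrow> 'o \<Rightarrow> 'o \<Rightarrow> (complex, 'm) module" where
  "hom_space C X Y =
     \<lparr>carrier = Hom C X Y, mult = undefined, one = undefined,
      zero = ZeroA C X Y, add = AddA C, smult = ScaleA C\<rparr>"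

locale linear_category =
  fixes C :: "('o, 'm, 'x) lcat_scheme" (structure)
  assumes dom_obj: "f \<in> Arr C \<Longrightarrow> Dom C f \<in> Obj C"
    and cod_obj: "f \<in> Arr C \<Longrightarrow> Cod C f \<in> Obj C"
    and id_hom: "X \<in> Obj C \<Longrightarrow> Id C X \<in> Hom C X X"
    and comp_hom: "\<lbrakk>f \<in> Hom C X Y; g \<in> Hom C Y Z\<rbrakk> \<Longrightarrow> g \<cdot> f \<in> Hom C X Z"
    and comp_id_right: "f \<in> Hom C X Y \<Longrightarrow> f \<cdot> Id C X = f"
    and comp_id_left: "f \<in> Hom C X Y \<Longrightarrow> Id C Y \<cdot> f = f"
    and comp_assoc: "\<lbrakk>f \<in> Hom C W X; g \<in> Hom C X Y; h \<in> Hom C Y Z\<rbrakk>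
                     \<Longrightarrow> (h \<cdot> g) \<cdot> f = h \<cdot> (g \<cdot> f)"
    and hom_module: "\<lbrakk>X \<in> Obj C; Y \<in> Obj C\<rbrakk> \<Longrightarrow> module complex_ring (hom_space C X Y)"
    and comp_add_right: "\<lbrakk>f \<in> Hom C X Y; f' \<in> Hom C X Y; g \<in> Hom C Y Z\<rbrakk>
                         \<Longrightarrow> g \<cdot> AddA C f f' = AddA C (g \<cdot> f) (g \<cdot> f')"
    and comp_add_left: "\<lbrakk>f \<in> Hom C X Y; g \<in> Hom C Y Z; g' \<in> Hom C Y Z\<rbrakk>
                        \<Longrightarrow> AddA C g g' \<cdot> f = AddA C (g \<cdot> f) (g' \<cdot> f)"
    and comp_scale_right: "\<lbrakk>f \<in> Hom C X Y; g \<in> Hom C Y Z\<rbrakk>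
                           \<Longrightarrow> g \<cdot> ScaleA C c f = ScaleA C c (g \<cdot> f)"
    and comp_scale_left: "\<lbrakk>f \<in> Hom C X Y; g \<in> Hom C Y Z\<rbrakk>
                          \<Longrightarrow> ScaleA C c g \<cdot> f = ScaleA C c (g \<cdot> f)"

definition inverse_arrows :: "('o, 'm, 'x) lcat_scheme \<Rightarrow> 'm \<Rightarrow> 'm \<Rightarrow> bool" where
  "inverse_arrows C f g \<longleftrightarrow>
     f \<in> Arr C \<and> g \<in> Hom C (Cod C f) (Dom C f) \<and>
     g \<cdot>\<^bsub>C\<^esub> f = Id C (Dom C f) \<and> f \<cdot>\<^bsub>C\<^esub> g = Id C (Cod C f)"

definition is_iso_arr :: "('o, 'm, 'x) lcat_scheme \<Rightarrow> 'm \<Rightarrow> bool" where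
  "is_iso_arr C f \<longleftrightarrow> (\<exists>g. inverse_arrows C f g)"

definition inv_arr :: "('o, 'm, 'x) lcat_scheme \<Rightarrow> 'm \<Rightarrow> 'm" where
  "inv_arr C f = (THE g. inverse_arrows C f g)"

definition isomorphic :: "('o, 'm, 'x) lcat_scheme \<Rightarrow> 'o \<Rightarrow> 'o \<Rightarrow> bool" where
  "isomorphic C X Y \<longleftrightarrow> (\<exists>f\<in>Hom C X Y. is_iso_arr C f)"

definition is_mono :: "('o, 'm, 'x) lcat_scheme \<Rightarrow> 'm \<Rightarrow> bool" where
  "is_mono C m \<longleftrightarrow> m \<in> Arr C \<and>
     (\<forall>X. \<forall>f\<in>Hom C X (Dom C m). \<forall>g\<in>Hom C X (Dom C m). m \<cdot>\<^bsub>C\<^esub> f = m \<cdot>\<^bsub>C\<^esub> g \<longrightarrow> f = g)"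

definition is_epi :: "('o, 'm, 'x) lcat_scheme \<Rightarrow> 'm \<Rightarrow> bool" where
  "is_epi C e \<longleftrightarrow> e \<in> Arr C \<and>
     (\<forall>X. \<forall>f\<in>Hom C (Cod C e) X. \<forall>g\<in>Hom C (Cod C e) X. f \<cdot>\<^bsub>C\<^esub> e = g \<cdot>\<^bsub>C\<^esub> e \<longrightarrow> f = g)"

definition is_zero_obj :: "('o, 'm, 'x) lcat_scheme \<Rightarrow> 'o \<Rightarrow> bool" where
  "is_zero_obj C Z \<longleftrightarrow> Z \<in> Obj C \<and>
     (\<forall>X\<in>Obj C. (\<exists>!f. f \<in> Hom C X Z) \<and> (\<exists>!f. f \<in> Hom C Z X))"

definition is_kernel :: "('o, 'm, 'x) lcat_scheme \<Rightarrow> 'm \<Rightarrow> 'm \<Rightarrow> bool" where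
  "is_kernel C k f \<longleftrightarrow>
     f \<in> Arr C \<and> k \<in> Arr C \<and> Cod C k = Dom C f \<and>
     f \<cdot>\<^bsub>C\<^esub> k = ZeroA C (Dom C k) (Cod C f) \<and>
     (\<forall>X. \<forall>h\<in>Hom C X (Dom C f). f \<cdot>\<^bsub>C\<^esub> h = ZeroA C X (Cod C f)
        \<longrightarrow> (\<exists>!u. u \<in> Hom C X (Dom C k) \<and> k \<cdot>\<^bsub>C\<^esub> u = h))"

definition is_cokernel :: "('o, 'm, 'x) lcat_scheme \<Rightarrow> 'm \<Rightarrow> 'm \<Rightarrow> bool" where
  "is_cokernel C q f \<longleftrightarrow>
     f \<in> Arr C \<and> q \<in> Arr C \<and> Dom C q = Cod C f \<and>
     q \<cdot>\<^bsub>C\<^esub> f = ZeroA C (Dom C f) (Cod C q) \<and>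
     (\<forall>X. \<forall>h\<in>Hom C (Cod C f) X. h \<cdot>\<^bsub>C\<^esub> f = ZeroA C (Dom C f) X
        \<longrightarrow> (\<exists>!u. u \<in> Hom C (Cod C q) X \<and> u \<cdot>\<^bsub>C\<^esub> q = h))"

definition short_exact :: "('o, 'm, 'x) lcat_scheme \<Rightarrow> 'm \<Rightarrow> 'm \<Rightarrow> bool" where
  "short_exact C f g \<longleftrightarrow> is_kernel C f g \<and> is_cokernel C g f"

definition is_biproduct ::
    "('o, 'm, 'x) lcat_scheme \<Rightarrow> 'o \<Rightarrow> 'o \<Rightarrow> 'o \<Rightarrow> 'm \<Rightarrow> 'm \<Rightarrow> 'm \<Rightarrow> 'm \<Rightarrow> bool" where
  "is_biproduct C X Y P i\<^sub>1 i\<^sub>2 p\<^sub>1 p\<^sub>2 \<longleftrightarrow>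
     P \<in> Obj C \<and> i\<^sub>1 \<in> Hom C X P \<and> i\<^sub>2 \<in> Hom C Y P \<and> p\<^sub>1 \<in> Hom C P X \<and> p\<^sub>2 \<in> Hom C P Y \<and>
     p\<^sub>1 \<cdot>\<^bsub>C\<^esub> i\<^sub>1 = Id C X \<and> p\<^sub>2 \<cdot>\<^bsub>C\<^esub> i\<^sub>2 = Id C Y \<and>
     p\<^sub>1 \<cdot>\<^bsub>C\<^esub> i\<^sub>2 = ZeroA C Y X \<and> p\<^sub>2 \<cdot>\<^bsub>C\<^esub> i\<^sub>1 = ZeroA C X Y \<and>
     AddA C (i\<^sub>1 \<cdot>\<^bsub>C\<^esub> p\<^sub>1) (i\<^sub>2 \<cdot>\<^bsub>C\<^esub> p\<^sub>2) = Id C P"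

locale abelian_category = linear_category +
  assumes zero_obj: "\<exists>Z. is_zero_obj C Z"
    and biproducts: "\<lbrakk>X \<in> Obj C; Y \<in> Obj C\<rbrakk> \<Longrightarrow> \<exists>P i\<^sub>1 i\<^sub>2 p\<^sub>1 p\<^sub>2. is_biproduct C X Y P i\<^sub>1 i\<^sub>2 p\<^sub>1 p\<^sub>2"
    and kernels: "f \<in> Arr C \<Longrightarrow> \<exists>k. is_kernel C k f"
    and cokernels: "f \<in> Arr C \<Longrightarrow> \<exists>q. is_cokernel C q f"
    and mono_normal: "is_mono C m \<Longrightarrow> \<exists>f. is_kernel C m f"
    and epi_normal: "is_epi C e \<Longrightarrow> \<exists>f. is_cokernel C e f"

definition simple_obj :: "('o, 'm, 'x) lcat_scheme \<Rightarrow> 'o \<Rightarrow> bool" where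
  "simple_obj C X \<longleftrightarrow> X \<in> Obj C \<and> \<not> is_zero_obj C X \<and>
     (\<forall>m. is_mono C m \<and> Cod C m = X \<longrightarrow> is_zero_obj C (Dom C m) \<or> is_iso_arr C m)"

inductive finite_length :: "('o, 'm, 'x) lcat_scheme \<Rightarrow> 'o \<Rightarrow> bool" for C where
  zero: "is_zero_obj C X \<Longrightarrow> finite_length C X"
| extend: "\<lbrakk>short_exact C f g; finite_length C (Dom C f); simple_obj C (Cod C g)\<rbrakk>
           \<Longrightarrow> finite_length C (Cod C f)"

definition projective_obj :: "('o, 'm, 'x) lcat_scheme \<Rightarrow> 'o \<Rightarrow> bool" where
  "projective_obj C P \<longleftrightarrow> P \<in> Obj C \<and>
     (\<forall>e. is_epi C e \<longrightarrow> (\<forall>f\<in>Hom C P (Cod C e). \<exists>g\<in>Hom C P (Dom C e). e \<cdot>\<^bsub>C\<^esub> g = f))"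

locale finite_abelian_category = abelian_category +
  assumes hom_finite: "\<lbrakk>X \<in> Obj C; Y \<in> Obj C\<rbrakk> \<Longrightarrow> finite_dimensional (hom_space C X Y)"
    and obj_finite_length: "X \<in> Obj C \<Longrightarrow> finite_length C X"
    and enough_projectives: "X \<in> Obj C \<Longrightarrow> \<exists>e. is_epi C e \<and> projective_obj C (Dom C e) \<and> Cod C e = X"
    and finitely_many_simples:
      "\<exists>S. finite S \<and> (\<forall>X. simple_obj C X \<longrightarrow> (\<exists>Y\<in>S. isomorphic C X Y))"


section \<open>Finite tensor categories\<close>

record ('o, 'm) tcat = "('o, 'm) lcat" +
  TensO :: "'o \<Rightarrow> 'o \<Rightarrow> 'o" (infixr \<open>\<boxdot>\<index>\<close> 75)
  TensA :: "'m \<Rightarrow> 'm \<Rightarrow> 'm" (infixr \<open>\<boxtimes>\<index>\<close> 75)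
  UnitO :: "'o"
  Assoc :: "'o \<Rightarrow> 'o \<Rightarrow> 'o \<Rightarrow> 'm"
  LUnit :: "'o \<Rightarrow> 'm"
  RUnit :: "'o \<Rightarrow> 'm"

locale monoidal_linear_category = linear_category C
  for C :: "('o, 'm, 'x) tcat_scheme" (structure) +
  assumes unit_obj: "UnitO C \<in> Obj C"
    and tens_obj: "\<lbrakk>X \<in> Obj C; Y \<in> Obj C\<rbrakk> \<Longrightarrow> X \<boxdot> Y \<in> Obj C"
    and tens_hom: "\<lbrakk>f \<in> Hom C X X'; g \<in> Hom C Y Y'\<rbrakk> \<Longrightarrow> f \<boxtimes> g \<in> Hom C (X \<boxdot> Y) (X' \<boxdot> Y')"
    and tens_id: "\<lbrakk>X \<in> Obj C; Y \<in> Obj C\<rbrakk> \<Longrightarrow> Id C X \<boxtimes> Id C Y = Id C (X \<boxdot> Y)"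
    and tens_comp:
      "\<lbrakk>f \<in> Hom C X X'; f' \<in> Hom C X' X''; g \<in> Hom C Y Y'; g' \<in> Hom C Y' Y''\<rbrakk>
       \<Longrightarrow> (f' \<cdot> f) \<boxtimes> (g' \<cdot> g) = (f' \<boxtimes> g') \<cdot> (f \<boxtimes> g)"
    and tens_add_left: "\<lbrakk>f \<in> Hom C X X'; f' \<in> Hom C X X'; g \<in> Hom C Y Y'\<rbrakk>
                        \<Longrightarrow> AddA C f f' \<boxtimes> g = AddA C (f \<boxtimes> g) (f' \<boxtimes> g)"
    and tens_add_right: "\<lbrakk>f \<in> Hom C X X'; g \<in> Hom C Y Y'; g' \<in> Hom C Y Y'\<rbrakk>
                         \<Longrightarrow> f \<boxtimes> AddA C g g' = AddA C (f \<boxtimes> g) (f \<boxtimes> g')"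
    and tens_scale_left: "\<lbrakk>f \<in> Arr C; g \<in> Arr C\<rbrakk> \<Longrightarrow> ScaleA C c f \<boxtimes> g = ScaleA C c (f \<boxtimes> g)"
    and tens_scale_right: "\<lbrakk>f \<in> Arr C; g \<in> Arr C\<rbrakk> \<Longrightarrow> f \<boxtimes> ScaleA C c g = ScaleA C c (f \<boxtimes> g)"
    and assoc_hom: "\<lbrakk>X \<in> Obj C; Y \<in> Obj C; Z \<in> Obj C\<rbrakk>
                    \<Longrightarrow> Assoc C X Y Z \<in> Hom C ((X \<boxdot> Y) \<boxdot> Z) (X \<boxdot> (Y \<boxdot> Z))"
    and assoc_iso: "\<lbrakk>X \<in> Obj C; Y \<in> Obj C; Z \<in> Obj C\<rbrakk> \<Longrightarrow> is_iso_arr C (Assoc C X Y Z)"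
    and assoc_natural:
      "\<lbrakk>f \<in> Hom C X X'; g \<in> Hom C Y Y'; h \<in> Hom C Z Z'\<rbrakk>
       \<Longrightarrow> Assoc C X' Y' Z' \<cdot> ((f \<boxtimes> g) \<boxtimes> h) = (f \<boxtimes> (g \<boxtimes> h)) \<cdot> Assoc C X Y Z"
    and lunit_hom: "X \<in> Obj C \<Longrightarrow> LUnit C X \<in> Hom C (UnitO C \<boxdot> X) X"
    and lunit_iso: "X \<in> Obj C \<Longrightarrow> is_iso_arr C (LUnit C X)"
    and lunit_natural: "f \<in> Hom C X Y \<Longrightarrow> LUnit C Y \<cdot> (Id C (UnitO C) \<boxtimes> f) = f \<cdot> LUnit C X"
    and runit_hom: "X \<in> Obj C \<Longrightarrow> RUnit C X \<in> Hom C (X \<boxdot> UnitO C) X"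
    and runit_iso: "X \<in> Obj C \<Longrightarrow> is_iso_arr C (RUnit C X)"
    and runit_natural: "f \<in> Hom C X Y \<Longrightarrow> RUnit C Y \<cdot> (f \<boxtimes> Id C (UnitO C)) = f \<cdot> RUnit C X"
    and pentagon:
      "\<lbrakk>W \<in> Obj C; X \<in> Obj C; Y \<in> Obj C; Z \<in> Obj C\<rbrakk>
       \<Longrightarrow> Assoc C W X (Y \<boxdot> Z) \<cdot> Assoc C (W \<boxdot> X) Y Z =
           (Id C W \<boxtimes> Assoc C X Y Z) \<cdot> Assoc C W (X \<boxdot> Y) Z \<cdot> (Assoc C W X Y \<boxtimes> Id C Z)"
    and triangle:
      "\<lbrakk>X \<in> Obj C; Y \<in> Obj C\<rbrakk>
       \<Longrightarrow> (Id C X \<boxtimes> LUnit C Y) \<cdot> Assoc C X (UnitO C) Y = RUnit C X \<boxtimes> Id C Y"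

text \<open>
  \<open>is_left_dual C X X' ev coev\<close>: the object \<open>X'\<close> is a left dual of \<open>X\<close>, equivalently \<open>X\<close> is
  a right dual of \<open>X'\<close>.  The last two conjuncts are the zigzag identities, with the unit
  constraints moved to the right-hand side.
\<close>

definition is_left_dual :: "('o, 'm, 'x) tcat_scheme \<Rightarrow> 'o \<Rightarrow> 'o \<Rightarrow> 'm \<Rightarrow> 'm \<Rightarrow> bool" where
  "is_left_dual C X X' ev coev \<longleftrightarrow>
     X \<in> Obj C \<and> X' \<in> Obj C \<and>
     ev \<in> Hom C (X' \<boxdot>\<^bsub>C\<^esub> X) (UnitO C) \<and> coev \<in> Hom C (UnitO C) (X \<boxdot>\<^bsub>C\<^esub> X') \<and>
     RUnit C X \<cdot>\<^bsub>C\<^esub> (Id C X \<boxtimes>\<^bsub>C\<^esub> ev) \<cdot>\<^bsub>C\<^esub> Assoc C X X' X \<cdot>\<^bsub>C\<^esub> (coev \<boxtimes>\<^bsub>C\<^esub> Id C X)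
       = LUnit C X \<and>
     LUnit C X' \<cdot>\<^bsub>C\<^esub> (ev \<boxtimes>\<^bsub>C\<^esub> Id C X') \<cdot>\<^bsub>C\<^esub> inv_arr C (Assoc C X' X X') \<cdot>\<^bsub>C\<^esub> (Id C X' \<boxtimes>\<^bsub>C\<^esub> coev)
       = RUnit C X'"

locale finite_tensor_category =
  finite_abelian_category C + monoidal_linear_category C
  for C :: "('o, 'm, 'x) tcat_scheme" (structure) +
  assumes left_duals: "X \<in> Obj C \<Longrightarrow> \<exists>X' ev coev. is_left_dual C X X' ev coev"
    and right_duals: "X \<in> Obj C \<Longrightarrow> \<exists>X' ev coev. is_left_dual C X' X ev coev"
    and unit_nonzero: "\<not> is_zero_obj C (UnitO C)"
    and unit_endos: "f \<in> Hom C (UnitO C) (UnitO C) \<Longrightarrow> \<exists>c. f = ScaleA C c (Id C (UnitO C))"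


section \<open>Functors\<close>

record ('o1, 'm1, 'o2, 'm2) fnctr =
  FObj :: "'o1 \<Rightarrow> 'o2"
  FArr :: "'m1 \<Rightarrow> 'm2"

locale linear_functor =
  fixes C :: "('o1, 'm1, 'x) lcat_scheme"
    and D :: "('o2, 'm2, 'y) lcat_scheme"
    and F :: "('o1, 'm1, 'o2, 'm2, 'z) fnctr_scheme"
  assumes F_obj: "X \<in> Obj C \<Longrightarrow> FObj F X \<in> Obj D"
    and F_hom: "f \<in> Hom C X Y \<Longrightarrow> FArr F f \<in> Hom D (FObj F X) (FObj F Y)"
    and F_id: "X \<in> Obj C \<Longrightarrow> FArr F (Id C X) = Id D (FObj F X)"
    and F_comp: "\<lbrakk>f \<in> Hom C X Y; g \<in> Hom C Y Z\<rbrakk>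
                 \<Longrightarrow> FArr F (g \<cdot>\<^bsub>C\<^esub> f) = FArr F g \<cdot>\<^bsub>D\<^esub> FArr F f"
    and F_add: "\<lbrakk>f \<in> Hom C X Y; g \<in> Hom C X Y\<rbrakk>
                \<Longrightarrow> FArr F (AddA C f g) = AddA D (FArr F f) (FArr F g)"
    and F_scale: "f \<in> Arr C \<Longrightarrow> FArr F (ScaleA C c f) = ScaleA D c (FArr F f)"

locale exact_faithful_functor = linear_functor C D F
  for C :: "('o1, 'm1, 'x) lcat_scheme"
    and D :: "('o2, 'm2, 'y) lcat_scheme"
    and F :: "('o1, 'm1, 'o2, 'm2, 'z) fnctr_scheme" +
  assumes F_exact: "short_exact C f g \<Longrightarrow> short_exact D (FArr F f) (FArr F g)"
    and F_faithful: "\<lbrakk>f \<in> Hom C X Y; g \<in> Hom C X Y; FArr F f = FArr F g\<rbrakk> \<Longrightarrow> f = g"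

definition essentially_surjective ::
    "('o1, 'm1, 'x) lcat_scheme \<Rightarrow> ('o2, 'm2, 'y) lcat_scheme
       \<Rightarrow> ('o1, 'm1, 'o2, 'm2, 'z) fnctr_scheme \<Rightarrow> bool" where
  "essentially_surjective C D F \<longleftrightarrow> (\<forall>Y\<in>Obj D. \<exists>X\<in>Obj C. isomorphic D (FObj F X) Y)"

text \<open>The algebra of natural endomorphisms of a functor, with composition as product.\<close>

definition End_alg ::
    "('o1, 'm1, 'x) lcat_scheme \<Rightarrow> ('o2, 'm2, 'y) lcat_scheme
       \<Rightarrow> ('o1, 'm1, 'o2, 'm2, 'z) fnctr_scheme \<Rightarrow> (complex, 'o1 \<Rightarrow> 'm2) module" where
  "End_alg C D F =
     \<lparr>carrier = {a \<in> (\<Pi>\<^sub>E X\<in>Obj C. Hom D (FObj F X) (FObj F X)).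
                   \<forall>f\<in>Arr C. a (Cod C f) \<cdot>\<^bsub>D\<^esub> FArr F f = FArr F f \<cdot>\<^bsub>D\<^esub> a (Dom C f)},
      mult = (\<lambda>a b. \<lambda>X\<in>Obj C. a X \<cdot>\<^bsub>D\<^esub> b X),
      one = (\<lambda>X\<in>Obj C. Id D (FObj F X)),
      zero = (\<lambda>X\<in>Obj C. ZeroA D (FObj F X) (FObj F X)),
      add = (\<lambda>a b. \<lambda>X\<in>Obj C. AddA D (a X) (b X)),
      smult = (\<lambda>c a. \<lambda>X\<in>Obj C. ScaleA D c (a X))\<rparr>"


section \<open>Quasi-tensor functors\<close>

record ('o1, 'm1, 'o2, 'm2) qtensor = "('o1, 'm1, 'o2, 'm2) fnctr" +
  QTens :: "'o1 \<Rightarrow> 'o1 \<Rightarrow> 'm2"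

locale quasi_tensor_functor = exact_faithful_functor C D G
  for C :: "('o1, 'm1, 'x) tcat_scheme"
    and D :: "('o2, 'm2, 'y) tcat_scheme"
    and G :: "('o1, 'm1, 'o2, 'm2, 'z) qtensor_scheme" +
  assumes G_unit: "FObj G (UnitO C) = UnitO D"
    and G_tens_hom: "\<lbrakk>X \<in> Obj C; Y \<in> Obj C\<rbrakk>
                     \<Longrightarrow> QTens G X Y \<in> Hom D (FObj G X \<boxdot>\<^bsub>D\<^esub> FObj G Y) (FObj G (X \<boxdot>\<^bsub>C\<^esub> Y))"
    and G_tens_iso: "\<lbrakk>X \<in> Obj C; Y \<in> Obj C\<rbrakk> \<Longrightarrow> is_iso_arr D (QTens G X Y)"
    and G_tens_natural:
      "\<lbrakk>f \<in> Hom C X X'; g \<in> Hom C Y Y'\<rbrakk>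
       \<Longrightarrow> QTens G X' Y' \<cdot>\<^bsub>D\<^esub> (FArr G f \<boxtimes>\<^bsub>D\<^esub> FArr G g) = FArr G (f \<boxtimes>\<^bsub>C\<^esub> g) \<cdot>\<^bsub>D\<^esub> QTens G X Y"


subsection \<open>The category of vector spaces and quasi-fiber functors\<close>

type_synonym 'v vobj = "(complex, 'v) module"
type_synonym 'v varr = "'v vobj \<times> ('v \<Rightarrow> 'v) \<times> 'v vobj"

abbreviation vmap :: "'v varr \<Rightarrow> 'v \<Rightarrow> 'v" where
  "vmap f \<equiv> fst (snd f)"

text \<open>
  \<open>Vec\<close> is the category of all finite-dimensional complex vector spaces with carrier in the
  type \<open>'v\<close>; an arrow is a linear map together with its source and target.
\<close>

definition Vec :: "('v vobj, 'v varr) lcat" where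
  "Vec =
     \<lparr>Obj = {V. module complex_ring V \<and> finite_dimensional V},
      Arr = {(V, f, W) | V f W.
               module complex_ring V \<and> finite_dimensional V \<and>
               module complex_ring W \<and> finite_dimensional W \<and> f \<in> lin_maps V W},
      Dom = (\<lambda>(V, f, W). V),
      Cod = (\<lambda>(V, f, W). W),
      Id = (\<lambda>V. (V, \<lambda>x\<in>carrier V. x, V)),
      Comp = (\<lambda>(V', g, W) (V, f, W'). (V, compose (carrier V) g f, W)),
      ZeroA = (\<lambda>V W. (V, \<zero>\<^bsub>lin_space V W\<^esub>, W)),
      AddA = (\<lambda>(V, f, W) (V', g, W'). (V, f \<oplus>\<^bsub>lin_space V W\<^esub> g, W)),
      ScaleA = (\<lambda>c (V, f, W). (V, c \<odot>\<^bsub>lin_space V W\<^esub> f, W))\<rparr>"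

text \<open>
  A quasi-fiber functor is a quasi-tensor functor to the category of vector spaces.  It has its
  own record because the elements of \<open>F X \<otimes> F Y\<close> are not of type \<open>'v\<close>, so the isomorphisms
  \<open>F X \<otimes> F Y \<cong> F (X \<otimes> Y)\<close> are linear maps between carriers in different types.  For the same
  reason the identification \<open>\<complex> = F \<one>\<close> is a linear isomorphism \<open>FibUnit\<close>.
\<close>

record ('o, 'm, 'v) fiber = "('o, 'm, 'v vobj, 'v varr) fnctr" +
  FibTens :: "'o \<Rightarrow> 'o \<Rightarrow> (('v \<Rightarrow> 'v \<Rightarrow> complex) \<Rightarrow> complex) \<Rightarrow> 'v"
  FibUnit :: "complex \<Rightarrow> 'v"

locale quasi_fiber_functor = exact_faithful_functor C Vec F
  for C :: "('o, 'm, 'x) tcat_scheme"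
    and F :: "('o, 'm, 'v) fiber" +
  assumes F_unit: "FibUnit F \<in> lin_isos complex_line (FObj F (UnitO C))"
    and F_tens_iso:
      "\<lbrakk>X \<in> Obj C; Y \<in> Obj C\<rbrakk>
       \<Longrightarrow> FibTens F X Y \<in> lin_isos (tensor_space (FObj F X) (FObj F Y)) (FObj F (X \<boxdot>\<^bsub>C\<^esub> Y))"
    and F_tens_natural:
      "\<lbrakk>f \<in> Hom C X X'; g \<in> Hom C Y Y'; z \<in> carrier (tensor_space (FObj F X) (FObj F Y))\<rbrakk>
       \<Longrightarrow> FibTens F X' Y'
              (tensor_map (FObj F X) (FObj F Y) (FObj F X') (FObj F Y')
                 (vmap (FArr F f)) (vmap (FArr F g)) z)
           = vmap (FArr F (f \<boxtimes>\<^bsub>C\<^esub> g)) (FibTens F X Y z)"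

definition fiber_comp ::
    "('o2, 'm2, 'v) fiber \<Rightarrow> ('o1, 'm1, 'o2, 'm2) qtensor \<Rightarrow> ('o1, 'm1, 'v) fiber" where
  "fiber_comp F G =
     \<lparr>FObj = FObj F \<circ> FObj G,
      FArr = FArr F \<circ> FArr G,
      FibTens = (\<lambda>X Y. compose (carrier (tensor_space (FObj F (FObj G X)) (FObj F (FObj G Y))))
                         (vmap (FArr F (QTens G X Y))) (FibTens F (FObj G X) (FObj G Y))),
      FibUnit = FibUnit F\<rparr>"


section \<open>The coproduct and the counit on the endomorphisms of a quasi-fiber functor\<close>

definition EndF :: "('o, 'm, 'x) tcat_scheme \<Rightarrow> ('o, 'm, 'v) fiber \<Rightarrow> (complex, 'o \<Rightarrow> 'v varr) module" where
  "EndF C F = End_alg C Vec F"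

text \<open>
  The action of \<open>t = \<Sum> b\<^sub>i \<otimes> c\<^sub>i \<in> EndF \<otimes> EndF\<close> on \<open>F X \<otimes> F Y\<close>, that is
  \<open>\<Sum> (b\<^sub>i)\<^sub>X \<otimes> (c\<^sub>i)\<^sub>Y\<close>.
\<close>

definition tensor_action ::
    "('o, 'm, 'x) tcat_scheme \<Rightarrow> ('o, 'm, 'v) fiber \<Rightarrow> 'o \<Rightarrow> 'o
       \<Rightarrow> ((('o \<Rightarrow> 'v varr) \<Rightarrow> ('o \<Rightarrow> 'v varr) \<Rightarrow> complex) \<Rightarrow> complex)
       \<Rightarrow> (('v \<Rightarrow> 'v \<Rightarrow> complex) \<Rightarrow> complex) \<Rightarrow> (('v \<Rightarrow> 'v \<Rightarrow> complex) \<Rightarrow> complex)" where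
  "tensor_action C F X Y =
     tensor_lift (EndF C F) (EndF C F)
       (lin_space (tensor_space (FObj F X) (FObj F Y)) (tensor_space (FObj F X) (FObj F Y)))
       (\<lambda>b c. tensor_map (FObj F X) (FObj F Y) (FObj F X) (FObj F Y) (vmap (b X)) (vmap (c Y)))"

text \<open>
  \<open>coproduct C F a\<close> is the element \<open>t \<in> EndF \<otimes> EndF\<close> that acts on every \<open>F X \<otimes> F Y\<close> as \<open>a\<close>
  acts on \<open>F (X \<otimes> Y)\<close>; \<open>counit C F a\<close> is the scalar by which \<open>a\<close> acts on \<open>F \<one> = \<complex>\<close>.
\<close>

definition coproduct ::
    "('o, 'm, 'x) tcat_scheme \<Rightarrow> ('o, 'm, 'v) fiber \<Rightarrow> ('o \<Rightarrow> 'v varr)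
       \<Rightarrow> (('o \<Rightarrow> 'v varr) \<Rightarrow> ('o \<Rightarrow> 'v varr) \<Rightarrow> complex) \<Rightarrow> complex" where
  "coproduct C F a =
     (THE t. t \<in> carrier (tensor_space (EndF C F) (EndF C F)) \<and>
        (\<forall>X\<in>Obj C. \<forall>Y\<in>Obj C. \<forall>z\<in>carrier (tensor_space (FObj F X) (FObj F Y)).
           FibTens F X Y (tensor_action C F X Y t z) = vmap (a (X \<boxdot>\<^bsub>C\<^esub> Y)) (FibTens F X Y z)))"

definition counit :: "('o, 'm, 'x) tcat_scheme \<Rightarrow> ('o, 'm, 'v) fiber \<Rightarrow> ('o \<Rightarrow> 'v varr) \<Rightarrow> complex" where
  "counit C F a = (THE c. vmap (a (UnitO C)) (FibUnit F 1) = FibUnit F c)"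

end

theory Submission
  imports Defs
begin

text \<open>
  The inclusion is restriction along \<open>G\<close>, \<open>(\<iota> a)\<^sub>X = a\<^bsub>G X\<^esub>\<close>; it is injective because every object
  of \<open>\<D>\<close> is isomorphic to some \<open>G X\<close>.  The substance lies in the coproduct: \<open>\<Delta> a\<close> has to exist as
  an element of \<open>End F \<otimes> End F\<close> and has to be determined by its action on all \<open>F X \<otimes> F Y\<close>.

  Both rest on \<open>End F\<close> being finite-dimensional.  Every object is built by extensions from simple
  ones, each a quotient of one of finitely many projectives \<open>P\<close>, and \<open>F\<close> is exact, so a natural
  endomorphism vanishing at these \<open>P\<close> vanishes.  Transport the action of \<open>a\<close> on \<open>F (X \<otimes> Y)\<close> to
  \<open>F X \<otimes> F Y\<close>.  Freezing one tensor factor by a vector and a functional leaves a natural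
  endomorphism of the other, and expanding these in a basis of \<open>End F\<close> writes the transported action
  as a finite sum \<open>\<Sum> u\<^sub>k \<otimes> d\<^sub>k\<close> with \<open>u\<^sub>k\<close> and \<open>d\<^sub>k\<close> natural.
\<close>

section \<open>Vector spaces and their functionals\<close>

text \<open>Everything is read through scalars. A tensor is by construction a functional on bilinear
  forms, so equalities of vectors, of tensors and of natural endomorphisms, and even the module
  axioms, are reduced to equalities of complex numbers under a separating family. The obstacle is
  that \<open>coproduct\<close> is a definite description: nothing can be said about it before a
  solution is known to exist and to be unique. Existence has one delicate point. Among the
  functionals on End F, the matrix coefficients \<open>a \<mapsto> \<xi> (a\<^sub>X x)\<close> are
  the ones visibly matched by a natural endomorphism on the other tensor factor. Coordinates on End
  F are therefore extracted from a finite family of matrix coefficients, by an elimination that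
  keeps track of which functionals it combines. Uniqueness is proved for every fiber functor on a
  finite tensor category, in particular for the composite of F and G. Hence it is enough that the
  restricted coproduct solves the defining equation for the composite, and this is naturality of
  \<open>a\<close> at the arrows \<open>QTens G X Y\<close>.\<close>

lemma complex_ring_simps [simp]:
  "carrier complex_ring = UNIV" "mult complex_ring = (*)" "one complex_ring = 1"
  "zero complex_ring = 0" "add complex_ring = (+)"
  by (simp_all add: complex_ring_def)

lemma complex_line_simps [simp]:
  "carrier complex_line = UNIV" "zero complex_line = 0" "add complex_line = (+)"
  "smult complex_line = (*)"
  by (simp_all add: complex_line_def)

lemma cring_complex_ring: "cring complex_ring"
proof (rule cringI)
  show "abelian_group complex_ring"
    by (rule abelian_groupI) (auto simp: algebra_simps, metis add.right_inverse add.commute)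
  show "comm_monoid complex_ring"
    by (rule comm_monoidI) (auto simp: algebra_simps)
qed (simp add: algebra_simps)

abbreviation vspace :: "(complex, 'v) module \<Rightarrow> bool" where
  "vspace V \<equiv> module complex_ring V"

lemma vspaceD:
  assumes "vspace V"
  shows "\<zero>\<^bsub>V\<^esub> \<in> carrier V"
    and "\<And>u v. \<lbrakk>u \<in> carrier V; v \<in> carrier V\<rbrakk> \<Longrightarrow> u \<oplus>\<^bsub>V\<^esub> v \<in> carrier V"
    and "\<And>c v. v \<in> carrier V \<Longrightarrow> c \<odot>\<^bsub>V\<^esub> v \<in> carrier V"
    and "\<And>v. v \<in> carrier V \<Longrightarrow> 0 \<odot>\<^bsub>V\<^esub> v = \<zero>\<^bsub>V\<^esub>"
    and "\<And>v. v \<in> carrier V \<Longrightarrow> 1 \<odot>\<^bsub>V\<^esub> v = v"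
proof -
  interpret module complex_ring V by fact
  show "\<zero>\<^bsub>V\<^esub> \<in> carrier V"
    and "\<And>u v. \<lbrakk>u \<in> carrier V; v \<in> carrier V\<rbrakk> \<Longrightarrow> u \<oplus>\<^bsub>V\<^esub> v \<in> carrier V"
    and "\<And>c v. v \<in> carrier V \<Longrightarrow> c \<odot>\<^bsub>V\<^esub> v \<in> carrier V"
    and "\<And>v. v \<in> carrier V \<Longrightarrow> 1 \<odot>\<^bsub>V\<^esub> v = v"
    using smult_one by auto
  show "\<And>v. v \<in> carrier V \<Longrightarrow> 0 \<odot>\<^bsub>V\<^esub> v = \<zero>\<^bsub>V\<^esub>"
    using smult_l_null by simp
qed

text \<open>Unlike an element of \<open>lin_maps V complex_line\<close>, a functional is not
  constrained off the carrier, so composites and linear combinations can be written as plain lambda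
  terms.\<close>

definition functional :: "(complex, 'v) module \<Rightarrow> ('v \<Rightarrow> complex) \<Rightarrow> bool" where
  "functional V \<phi> \<longleftrightarrow>
     (\<forall>u\<in>carrier V. \<forall>v\<in>carrier V. \<phi> (u \<oplus>\<^bsub>V\<^esub> v) = \<phi> u + \<phi> v) \<and>
     (\<forall>c. \<forall>v\<in>carrier V. \<phi> (c \<odot>\<^bsub>V\<^esub> v) = c * \<phi> v)"

lemma functional_add:
  "\<lbrakk>functional V \<phi>; u \<in> carrier V; v \<in> carrier V\<rbrakk> \<Longrightarrow> \<phi> (u \<oplus>\<^bsub>V\<^esub> v) = \<phi> u + \<phi> v"
  and functional_smult:
  "\<lbrakk>functional V \<phi>; v \<in> carrier V\<rbrakk> \<Longrightarrow> \<phi> (c \<odot>\<^bsub>V\<^esub> v) = c * \<phi> v"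
  by (auto simp: functional_def)

lemma functional_zero: "\<lbrakk>functional V \<phi>; vspace V\<rbrakk> \<Longrightarrow> \<phi> \<zero>\<^bsub>V\<^esub> = 0"
  using functional_smult[of V \<phi> "\<zero>\<^bsub>V\<^esub>" 0] vspaceD(1,4)[of V] by fastforce

text \<open>This is the one operation on functionals that elimination performs, in the shape of the
  closure hypothesis on \<open>P\<close> in \<open>dual_system_exists\<close>.\<close>

lemma functional_combine:
  "\<lbrakk>functional V \<phi>; functional V \<psi>\<rbrakk> \<Longrightarrow> functional V (\<lambda>v. \<phi> v - c * \<psi> v)"
  by (auto simp: functional_def algebra_simps)

lemma functional_sum:
  "(\<And>i. i < n \<Longrightarrow> functional V (\<phi> i)) \<Longrightarrow> functional V (\<lambda>v. \<Sum>i<n. \<phi> i v * c i)" for n :: nat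
  by (auto simp: functional_def sum.distrib sum_distrib_left algebra_simps intro!: sum.cong)

lemma functional_iff_lin_maps:
  "vspace V \<Longrightarrow> functional V \<phi> \<longleftrightarrow> (\<lambda>v\<in>carrier V. \<phi> v) \<in> lin_maps V complex_line"
  by (auto simp: functional_def lin_maps_def vspaceD)

lemma functional_comp:
  "\<lbrakk>f \<in> lin_maps V W; functional W \<phi>\<rbrakk> \<Longrightarrow> functional V (\<lambda>v. \<phi> (f v))"
  unfolding functional_def lin_maps_def by (auto simp: Pi_iff PiE_iff)

text \<open>Every identity required of a module is tested on a separating family of functions.\<close>

lemma vspaceI:
  assumes closed: "\<zero>\<^bsub>V\<^esub> \<in> carrier V"
      "\<And>u v. \<lbrakk>u \<in> carrier V; v \<in> carrier V\<rbrakk> \<Longrightarrow> u \<oplus>\<^bsub>V\<^esub> v \<in> carrier V"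
      "\<And>c v. v \<in> carrier V \<Longrightarrow> c \<odot>\<^bsub>V\<^esub> v \<in> carrier V"
    and lin: "\<And>i. i \<in> I \<Longrightarrow> functional V (J i)"
    and zero: "\<And>i. i \<in> I \<Longrightarrow> J i \<zero>\<^bsub>V\<^esub> = 0"
    and sep: "\<And>u v. \<lbrakk>u \<in> carrier V; v \<in> carrier V; \<And>i. i \<in> I \<Longrightarrow> J i u = J i v\<rbrakk> \<Longrightarrow> u = v"
  shows "vspace V"
proof -
  have add: "J i (u \<oplus>\<^bsub>V\<^esub> v) = J i u + J i v"
    if "i \<in> I" "u \<in> carrier V" "v \<in> carrier V" for i u v
    using functional_add[OF lin] that by simp
  have smult: "J i (c \<odot>\<^bsub>V\<^esub> v) = c * J i v" if "i \<in> I" "v \<in> carrier V" for i c v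
    using functional_smult[OF lin] that by simp
  note * = add smult zero closed
  have "abelian_group V"
  proof (rule abelian_groupI)
    show "\<exists>y\<in>carrier V. y \<oplus>\<^bsub>V\<^esub> x = \<zero>\<^bsub>V\<^esub>" if "x \<in> carrier V" for x
      using that by (intro bexI[of _ "(-1) \<odot>\<^bsub>V\<^esub> x"] sep) (auto simp: *)
  qed (((rule sep; simp add: * algebra_simps) | simp add: *)+)
  then show ?thesis
    by (intro moduleI) (((rule sep; simp add: * algebra_simps) | simp add: * cring_complex_ring)+)
qed

text \<open>Over a field every vector space is separated, but in general only through a Hamel basis.
  As a predicate it is proved from the concrete family that each space below brings along:
  coordinates, evaluations at forms, or matrix coefficients.\<close>

definition separated :: "(complex, 'v) module \<Rightarrow> bool" where
  "separated V \<longleftrightarrow> vspace V \<and>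
     (\<forall>u\<in>carrier V. \<forall>v\<in>carrier V. (\<forall>\<phi>. functional V \<phi> \<longrightarrow> \<phi> u = \<phi> v) \<longrightarrow> u = v)"

lemma separated_vspace: "separated V \<Longrightarrow> vspace V"
  by (simp add: separated_def)

lemma separated_eqI:
  "\<lbrakk>separated V; u \<in> carrier V; v \<in> carrier V; \<And>\<phi>. functional V \<phi> \<Longrightarrow> \<phi> u = \<phi> v\<rbrakk> \<Longrightarrow> u = v"
  by (auto simp: separated_def)

lemma separatedI:
  assumes "\<zero>\<^bsub>V\<^esub> \<in> carrier V"
      "\<And>u v. \<lbrakk>u \<in> carrier V; v \<in> carrier V\<rbrakk> \<Longrightarrow> u \<oplus>\<^bsub>V\<^esub> v \<in> carrier V"
      "\<And>c v. v \<in> carrier V \<Longrightarrow> c \<odot>\<^bsub>V\<^esub> v \<in> carrier V"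
    and lin: "\<And>i. i \<in> I \<Longrightarrow> functional V (J i)"
    and "\<And>i. i \<in> I \<Longrightarrow> J i \<zero>\<^bsub>V\<^esub> = 0"
    and sep: "\<And>u v. \<lbrakk>u \<in> carrier V; v \<in> carrier V; \<And>i. i \<in> I \<Longrightarrow> J i u = J i v\<rbrakk> \<Longrightarrow> u = v"
  shows "separated V"
  unfolding separated_def
proof (intro conjI ballI impI)
  show "vspace V" by (rule vspaceI[of V I J]) (fact assms)+
  show "u = v" if "u \<in> carrier V" "v \<in> carrier V" "\<forall>\<phi>. functional V \<phi> \<longrightarrow> \<phi> u = \<phi> v" for u v
    by (rule sep[OF that(1,2)]) (rule that(3)[rule_format, OF lin])
qed

text \<open>Finite-dimensionality stated dually, by finitely many functionals with trivial common
  kernel. For End F this form is directly accessible, while a spanning set is not.\<close>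

definition finitely_separated :: "(complex, 'v) module \<Rightarrow> bool" where
  "finitely_separated V \<longleftrightarrow> vspace V \<and>
     (\<exists>\<Phi>. finite \<Phi> \<and> (\<forall>\<phi>\<in>\<Phi>. functional V \<phi>) \<and>
        (\<forall>v\<in>carrier V. (\<forall>\<phi>\<in>\<Phi>. \<phi> v = 0) \<longrightarrow> v = \<zero>\<^bsub>V\<^esub>))"

text \<open>Differences are written with the scalar -1, so that additivity and homogeneity of
  functionals evaluate them.\<close>

lemma diff_eq_zeroD:
  assumes "vspace V" "u \<in> carrier V" "v \<in> carrier V" "u \<oplus>\<^bsub>V\<^esub> (-1) \<odot>\<^bsub>V\<^esub> v = \<zero>\<^bsub>V\<^esub>"
  shows "u = v"
proof -
  interpret module complex_ring V by fact
  have "(-1) \<odot>\<^bsub>V\<^esub> v = \<ominus>\<^bsub>V\<^esub> v"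
    using smult_l_minus[of 1 v] assms cring_complex_ring
    by (metis (no_types, lifting) UNIV_I add.inverse_unique add.left_inverse cring.axioms(1)
        complex_ring_simps abelian_group.minus_equality ring_def smult_one)
  then show ?thesis using assms
    by (metis M.add.inv_closed M.minus_equality M.minus_minus)
qed

lemma finitely_separated_imp_separated:
  assumes "finitely_separated V"
  shows "separated V"
  unfolding separated_def
proof (intro conjI ballI impI)
  obtain \<Phi> where V: "vspace V" and \<Phi>: "\<And>\<phi>. \<phi> \<in> \<Phi> \<Longrightarrow> functional V \<phi>"
      "\<And>v. v \<in> carrier V \<Longrightarrow> \<forall>\<phi>\<in>\<Phi>. \<phi> v = 0 \<Longrightarrow> v = \<zero>\<^bsub>V\<^esub>"
    using assms unfolding finitely_separated_def by blast
  show "vspace V" by (rule V)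
  fix u v
  assume uv: "u \<in> carrier V" "v \<in> carrier V" "\<forall>\<phi>. functional V \<phi> \<longrightarrow> \<phi> u = \<phi> v"
  have "\<phi> (u \<oplus>\<^bsub>V\<^esub> (-1) \<odot>\<^bsub>V\<^esub> v) = 0" if "\<phi> \<in> \<Phi>" for \<phi>
    using uv(1,2) V uv(3)[rule_format, OF \<Phi>(1)[OF that]]
      functional_add[OF \<Phi>(1)[OF that]] functional_smult[OF \<Phi>(1)[OF that]]
    by (simp add: vspaceD)
  then have "u \<oplus>\<^bsub>V\<^esub> (-1) \<odot>\<^bsub>V\<^esub> v = \<zero>\<^bsub>V\<^esub>"
    using V uv(1,2) by (intro \<Phi>(2) ballI) (auto simp: vspaceD)
  then show "u = v" by (rule diff_eq_zeroD[OF V uv(1,2)])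
qed

text \<open>A spanning set of least cardinality is independent, and its coordinate functions form
  the separating family.\<close>

lemma finite_dimensional_imp_finitely_separated:
  assumes V: "vspace V" and fd: "finite_dimensional V"
  shows "finitely_separated V"
proof -
  interpret module complex_ring V by fact
  define lc where "lc S c = (\<Oplus>\<^bsub>V\<^esub>s\<in>S. c s \<odot>\<^bsub>V\<^esub> s)" for S c
  define spans where "spans S \<longleftrightarrow> finite S \<and> S \<subseteq> carrier V \<and> (\<forall>v\<in>carrier V. \<exists>c. v = lc S c)" for S
  have "\<exists>S. spans S"
    using fd unfolding finite_dimensional_def spans_def lc_def .
  then obtain S where S: "spans S" and least: "\<And>T. spans T \<Longrightarrow> card S \<le> card T"
    using ex_has_least_nat[of spans _ card] by blast
  have fin: "finite S" and sub: "S \<subseteq> carrier V" using S by (auto simp: spans_def)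
  have cl: "(\<lambda>s. c s \<odot>\<^bsub>V\<^esub> s) \<in> S \<rightarrow> carrier V" for c
    using sub by (auto intro: smult_closed)
  have lc_add: "lc S (\<lambda>s. c s + d s) = lc S c \<oplus>\<^bsub>V\<^esub> lc S d" for c d
  proof -
    have "lc S (\<lambda>s. c s + d s) = (\<Oplus>\<^bsub>V\<^esub>s\<in>S. c s \<odot>\<^bsub>V\<^esub> s \<oplus>\<^bsub>V\<^esub> d s \<odot>\<^bsub>V\<^esub> s)"
      unfolding lc_def by (rule M.finsum_cong') (use sub smult_l_distr cl in auto)
    then show ?thesis unfolding lc_def using M.finsum_addf[OF cl cl] by simp
  qed
  have lc_smult: "lc S (\<lambda>s. k * c s) = k \<odot>\<^bsub>V\<^esub> lc S c" for k c
  proof -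
    have "lc S (\<lambda>s. k * c s) = (\<Oplus>\<^bsub>V\<^esub>s\<in>S. k \<odot>\<^bsub>V\<^esub> (c s \<odot>\<^bsub>V\<^esub> s))"
      unfolding lc_def by (rule M.finsum_cong') (use sub smult_assoc1 cl in auto)
    then show ?thesis unfolding lc_def using finsum_smult_ldistr[OF fin _ cl, of k c] by simp
  qed
  have lc_cl: "lc S c \<in> carrier V" for c
    unfolding lc_def using cl by (rule M.finsum_closed)
  have indep: "c s = 0" if 0: "lc S c = \<zero>\<^bsub>V\<^esub>" and s: "s \<in> S" for c s
  proof (rule ccontr)
    assume cs: "c s \<noteq> 0"
    have "\<exists>e. v = lc (S - {s}) e" if "v \<in> carrier V" for v
    proof -
      obtain d where d: "v = lc S d" using S \<open>v \<in> carrier V\<close> by (auto simp: spans_def)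
      \<comment> \<open>Adding a multiple of the relation \<open>c\<close> leaves the combination
        unchanged; the multiple is chosen so that the coefficient of \<open>s\<close> cancels. Then
        \<open>S - {s}\<close> still spans, against minimality.\<close>
      define e where "e = (\<lambda>r. d r + (- (d s / c s)) * c r)"
      have "lc S e = v"
        unfolding e_def lc_add lc_smult 0 using d lc_cl by simp
      moreover have "e s = 0" using cs by (simp add: e_def)
      moreover have "lc S e = e s \<odot>\<^bsub>V\<^esub> s \<oplus>\<^bsub>V\<^esub> lc (S - {s}) e"
        unfolding lc_def using s fin cl[of e] sub
        by (subst (1) insert_Diff[OF s, symmetric], subst M.finsum_insert)
          (auto simp: Pi_iff)
      moreover have "lc (S - {s}) e \<in> carrier V"
        unfolding lc_def using cl[of e] by (intro M.finsum_closed) auto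
      ultimately have "v = lc (S - {s}) e"
        using s sub vspaceD(4)[OF V, of s] by auto
      then show ?thesis by (rule exI[of _ e])
    qed
    then have "spans (S - {s})" using fin sub by (auto simp: spans_def)
    then show False using least card_Diff1_less[OF fin s] by fastforce
  qed
  \<comment> \<open>The coefficients are picked arbitrarily for each vector. They are linear in the
    vector because independence makes them unique.\<close>
  define co where "co v = (SOME c. v = lc S c)" for v
  have co: "v = lc S (co v)" if "v \<in> carrier V" for v
    using S that unfolding co_def spans_def by (metis (mono_tags, lifting) someI_ex)
  have uniq: "co v s = c s" if "v = lc S c" "s \<in> S" for v c s
  proof -
    have v: "v \<in> carrier V" using that lc_cl by simp
    have "lc S (\<lambda>s. co v s + (-1) * c s) = v \<oplus>\<^bsub>V\<^esub> (-1) \<odot>\<^bsub>V\<^esub> v"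
      using co[OF v] that(1) unfolding lc_add lc_smult by simp
    also have "\<dots> = \<zero>\<^bsub>V\<^esub>"
      using smult_l_distr[of 1 "-1" v] v vspaceD[OF V] by simp
    finally show ?thesis using indep that(2) by fastforce
  qed
  have "functional V (\<lambda>v. co v s)" if "s \<in> S" for s
    unfolding functional_def
  proof (intro conjI ballI allI)
    show "co (u \<oplus>\<^bsub>V\<^esub> v) s = co u s + co v s" if "u \<in> carrier V" "v \<in> carrier V" for u v
      using co[OF that(1)] co[OF that(2)] lc_add[of "co u" "co v"] \<open>s \<in> S\<close>
      by (intro uniq[where c = "\<lambda>s. co u s + co v s"]) simp_all
    show "co (k \<odot>\<^bsub>V\<^esub> v) s = k * co v s" if "v \<in> carrier V" for k v
      using co[OF that] lc_smult[of k "co v"] \<open>s \<in> S\<close>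
      by (intro uniq[where c = "\<lambda>s. k * co v s"]) simp_all
  qed
  moreover have "v = \<zero>\<^bsub>V\<^esub>" if v: "v \<in> carrier V" and 0: "\<forall>s\<in>S. co v s = 0" for v
  proof -
    have "lc S (co v) = lc S (\<lambda>s. 0 * co v s)"
      unfolding lc_def by (rule M.finsum_cong'[OF refl cl]) (use 0 in simp)
    then have "v = lc S (\<lambda>s. 0 * co v s)" using co[OF v] by simp
    then show ?thesis unfolding lc_smult using vspaceD(4)[OF V lc_cl] by simp
  qed
  ultimately show ?thesis
    unfolding finitely_separated_def using V fin
    by (intro conjI exI[of _ "(\<lambda>s v. co v s) ` S"]) auto
qed

section \<open>Subspaces, linear combinations and dual bases\<close>

definition subspace_of :: "(complex, 'v) module \<Rightarrow> 'v set \<Rightarrow> bool" where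
  "subspace_of V K \<longleftrightarrow> K \<subseteq> carrier V \<and> \<zero>\<^bsub>V\<^esub> \<in> K \<and>
     (\<forall>u\<in>K. \<forall>v\<in>K. u \<oplus>\<^bsub>V\<^esub> v \<in> K) \<and> (\<forall>c. \<forall>v\<in>K. c \<odot>\<^bsub>V\<^esub> v \<in> K)"

lemma subspace_of_carrier: "vspace V \<Longrightarrow> subspace_of V (carrier V)"
  by (simp add: subspace_of_def vspaceD)

text \<open>The combination is recorded only by its values under functionals, which determine it
  when the space is separated; later arguments look at nothing else.\<close>

lemma linear_combination_exists:
  fixes n :: nat
  assumes K: "subspace_of V K" "vspace V" and e: "\<And>i. i < n \<Longrightarrow> e i \<in> K"
  shows "\<exists>u\<in>K. \<forall>\<phi>. functional V \<phi> \<longrightarrow> \<phi> u = (\<Sum>i<n. c i * \<phi> (e i))"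
  using e
proof (induction n)
  case 0
  then show ?case using K functional_zero by (auto simp: subspace_of_def)
next
  case (Suc n)
  then obtain u where u: "u \<in> K" "\<And>\<phi>. functional V \<phi> \<Longrightarrow> \<phi> u = (\<Sum>i<n. c i * \<phi> (e i))"
    by (metis less_SucI)
  have en: "e n \<in> K" using Suc by simp
  then have "u \<oplus>\<^bsub>V\<^esub> c n \<odot>\<^bsub>V\<^esub> e n \<in> K" using K u by (auto simp: subspace_of_def)
  moreover have "\<phi> (u \<oplus>\<^bsub>V\<^esub> c n \<odot>\<^bsub>V\<^esub> e n) = (\<Sum>i<Suc n. c i * \<phi> (e i))" if "functional V \<phi>" for \<phi>
    using u en that K unfolding subspace_of_def
    by (auto simp: functional_add functional_smult vspaceD subset_iff)
  ultimately show ?case by blast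
qed

text \<open>
  Gaussian elimination: a nonzero functional splits off a vector, and the remaining functionals
  are corrected by multiples of it.  The predicate \<open>P\<close> keeps track of the span of \<open>\<Phi>\<close>.
\<close>

lemma dual_system_exists:
  assumes V: "vspace V" and \<Phi>: "finite \<Phi>" "\<And>\<phi>. \<phi> \<in> \<Phi> \<Longrightarrow> P \<phi>"
    and P: "\<And>\<phi>. P \<phi> \<Longrightarrow> functional V \<phi>"
      "\<And>\<phi> \<psi> c. \<lbrakk>P \<phi>; P \<psi>\<rbrakk> \<Longrightarrow> P (\<lambda>v. \<phi> v - c * \<psi> v)"
    and K: "subspace_of V K" "\<And>v. \<lbrakk>v \<in> K; \<And>\<phi>. \<phi> \<in> \<Phi> \<Longrightarrow> \<phi> v = 0\<rbrakk> \<Longrightarrow> v = \<zero>\<^bsub>V\<^esub>"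
  shows "\<exists>(n::nat) e \<phi>. (\<forall>i<n. e i \<in> K \<and> P (\<phi> i)) \<and>
           (\<forall>i<n. \<forall>j<n. \<phi> i (e j) = (if i = j then 1 else 0)) \<and>
           (\<forall>v\<in>K. (\<forall>i<n. \<phi> i v = 0) \<longrightarrow> v = \<zero>\<^bsub>V\<^esub>)"
  using \<Phi> K
proof (induction \<Phi> arbitrary: K rule: finite_induct)
  case empty
  then show ?case by (intro exI[of _ 0]) auto
next
  case (insert f \<Phi>)
  have Pf: "P f" and f: "functional V f" using insert.prems(1) P(1) by auto
  show ?case
  proof (cases "\<forall>v\<in>K. f v = 0")
    case True
    show ?thesis
    proof (rule insert.IH)
      show "v = \<zero>\<^bsub>V\<^esub>" if "v \<in> K" "\<And>\<phi>. \<phi> \<in> \<Phi> \<Longrightarrow> \<phi> v = 0" for v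
        using insert.prems(3) that True by blast
    qed (use insert.prems in auto)
  next
    case False
    then obtain v1 where v1: "v1 \<in> K" "f v1 \<noteq> 0" by blast
    \<comment> \<open>Rescaling makes \<open>f v0 = 1\<close>, so \<open>v0\<close> can be the
      vector dual to \<open>f\<close>.\<close>
    define v0 where "v0 = inverse (f v1) \<odot>\<^bsub>V\<^esub> v1"
    have v0: "v0 \<in> K" "f v0 = 1"
      using v1 insert.prems(2) functional_smult[OF f] unfolding v0_def subspace_of_def by auto
    define K' where "K' = {v \<in> K. f v = 0}"
    have "subspace_of V K'"
      using insert.prems(2) functional_zero[OF f V] unfolding subspace_of_def K'_def
      by (auto simp: functional_add[OF f] functional_smult[OF f] subset_iff)
    moreover have "v = \<zero>\<^bsub>V\<^esub>" if "v \<in> K'" "\<And>\<phi>. \<phi> \<in> \<Phi> \<Longrightarrow> \<phi> v = 0" for v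
      using insert.prems(3) that unfolding K'_def by blast
    ultimately have "\<exists>(n::nat) e \<phi>. (\<forall>i<n. e i \<in> K' \<and> P (\<phi> i)) \<and>
           (\<forall>i<n. \<forall>j<n. \<phi> i (e j) = (if i = j then 1 else 0)) \<and>
           (\<forall>v\<in>K'. (\<forall>i<n. \<phi> i v = 0) \<longrightarrow> v = \<zero>\<^bsub>V\<^esub>)"
      using insert.prems(1) by (intro insert.IH) simp_all
    then obtain n :: nat and e \<phi> where IH: "\<forall>i<n. e i \<in> K' \<and> P (\<phi> i)"
      "\<forall>i<n. \<forall>j<n. \<phi> i (e j) = (if i = j then 1 else 0)"
      "\<forall>v\<in>K'. (\<forall>i<n. \<phi> i v = 0) \<longrightarrow> v = \<zero>\<^bsub>V\<^esub>"
      by (elim exE conjE) (rule that)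
    define e' where "e' i = (if i < n then e i else v0)" for i
    \<comment> \<open>Subtracting \<open>\<phi> i v0\<close> times \<open>f\<close> makes the old
      functionals vanish at \<open>v0\<close>. Their values on the old vectors stay the same, since
      those lie in \<open>K'\<close>, where \<open>f\<close> is zero.\<close>
    define \<phi>' where "\<phi>' i = (if i < n then \<lambda>v. \<phi> i v - \<phi> i v0 * f v else f)" for i
    have "e' i \<in> K \<and> P (\<phi>' i)" if "i < Suc n" for i
      using that IH(1)[rule_format, of i] v0 Pf P(2) unfolding e'_def \<phi>'_def K'_def by auto
    moreover have "\<phi>' i (e' j) = (if i = j then 1 else 0)" if "i < Suc n" "j < Suc n" for i j
      using that IH(1)[rule_format, of j] IH(2)[rule_format, of i j] v0 unfolding e'_def \<phi>'_def K'_def by auto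
    moreover have "v = \<zero>\<^bsub>V\<^esub>" if "v \<in> K" and 0: "\<forall>i<Suc n. \<phi>' i v = 0" for v
    proof -
      have "f v = 0" using 0[rule_format, of n] by (simp add: \<phi>'_def)
      moreover have "\<phi> i v = 0" if "i < n" for i
        using 0[rule_format, of i] that \<open>f v = 0\<close> by (simp add: \<phi>'_def)
      ultimately show ?thesis using IH(3) that(1) by (simp add: K'_def)
    qed
    ultimately show ?thesis
      by (intro exI[of _ "Suc n"] exI[of _ e'] exI[of _ \<phi>']) simp
  qed
qed

text \<open>The vector with coefficients \<open>\<phi> i v\<close> along the \<open>e i\<close>
  agrees with \<open>v\<close> under every \<open>\<phi> i\<close>; these separate \<open>K\<close>,
  so the two vectors coincide.\<close>

lemma functional_expansion:
  fixes n :: nat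
  assumes V: "vspace V" and K: "subspace_of V K"
    and e: "\<And>i. i < n \<Longrightarrow> e i \<in> K" and \<phi>: "\<And>i. i < n \<Longrightarrow> functional V (\<phi> i)"
    and dual: "\<And>i j. \<lbrakk>i < n; j < n\<rbrakk> \<Longrightarrow> \<phi> i (e j) = (if i = j then 1 else 0)"
    and sep: "\<And>v. \<lbrakk>v \<in> K; \<And>i. i < n \<Longrightarrow> \<phi> i v = 0\<rbrakk> \<Longrightarrow> v = \<zero>\<^bsub>V\<^esub>"
    and v: "v \<in> K" and \<psi>: "functional V \<psi>"
  shows "\<psi> v = (\<Sum>i<n. \<phi> i v * \<psi> (e i))"
proof -
  obtain u where u: "u \<in> K" "\<forall>\<chi>. functional V \<chi> \<longrightarrow> \<chi> u = (\<Sum>i<n. \<phi> i v * \<chi> (e i))"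
    using linear_combination_exists[OF K V, of n e "\<lambda>i. \<phi> i v"] e by (auto elim!: bexE)
  have cl: "u \<in> carrier V" "v \<in> carrier V" "(-1) \<odot>\<^bsub>V\<^esub> u \<in> carrier V"
    using K u v V by (auto simp: subspace_of_def vspaceD)
  have "v \<oplus>\<^bsub>V\<^esub> (-1) \<odot>\<^bsub>V\<^esub> u = \<zero>\<^bsub>V\<^esub>"
  proof (rule sep)
    show "v \<oplus>\<^bsub>V\<^esub> (-1) \<odot>\<^bsub>V\<^esub> u \<in> K" using K u v by (auto simp: subspace_of_def)
    show "\<phi> i (v \<oplus>\<^bsub>V\<^esub> (-1) \<odot>\<^bsub>V\<^esub> u) = 0" if "i < n" for i
    proof -
      have "\<phi> i u = (\<Sum>j<n. if i = j then \<phi> j v else 0)"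
        unfolding u(2)[rule_format, OF \<phi>[OF that]] by (rule sum.cong) (use that dual in auto)
      then show ?thesis using that cl \<phi>[OF that] by (simp add: functional_add functional_smult)
    qed
  qed
  then have "v = u" by (rule diff_eq_zeroD[OF V cl(2,1)])
  then show ?thesis using u(2)[rule_format, OF \<psi>] by simp
qed

text \<open>The last clause is the expansion of \<open>v\<close> in the basis \<open>e\<close>, seen
  through an arbitrary functional. Keeping \<open>P\<close> general allows coordinates of a
  prescribed kind, which \<open>transport_in_tensor\<close> relies on.\<close>

lemma dual_basis_exists:
  assumes V: "vspace V" and \<Phi>: "finite \<Phi>" "\<And>\<phi>. \<phi> \<in> \<Phi> \<Longrightarrow> P \<phi>"
    and P: "\<And>\<phi>. P \<phi> \<Longrightarrow> functional V \<phi>"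
      "\<And>\<phi> \<psi> c. \<lbrakk>P \<phi>; P \<psi>\<rbrakk> \<Longrightarrow> P (\<lambda>v. \<phi> v - c * \<psi> v)"
    and K: "subspace_of V K" "\<And>v. \<lbrakk>v \<in> K; \<And>\<phi>. \<phi> \<in> \<Phi> \<Longrightarrow> \<phi> v = 0\<rbrakk> \<Longrightarrow> v = \<zero>\<^bsub>V\<^esub>"
  shows "\<exists>(n::nat) e \<phi>. (\<forall>i<n. e i \<in> K \<and> P (\<phi> i)) \<and>
           (\<forall>\<psi>. functional V \<psi> \<longrightarrow> (\<forall>v\<in>K. \<psi> v = (\<Sum>i<n. \<phi> i v * \<psi> (e i))))"
proof -
  have "\<exists>(n::nat) e \<phi>. (\<forall>i<n. e i \<in> K \<and> P (\<phi> i)) \<and>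
           (\<forall>i<n. \<forall>j<n. \<phi> i (e j) = (if i = j then 1 else 0)) \<and>
           (\<forall>v\<in>K. (\<forall>i<n. \<phi> i v = 0) \<longrightarrow> v = \<zero>\<^bsub>V\<^esub>)"
    by (rule dual_system_exists[of V \<Phi> P K]) (fact assms)+
  then obtain n :: nat and e \<phi> where *: "\<forall>i<n. e i \<in> K \<and> P (\<phi> i)"
      "\<forall>i<n. \<forall>j<n. \<phi> i (e j) = (if i = j then 1 else 0)"
      "\<forall>v\<in>K. (\<forall>i<n. \<phi> i v = 0) \<longrightarrow> v = \<zero>\<^bsub>V\<^esub>"
    by (elim exE conjE) (rule that)
  have "\<psi> v = (\<Sum>i<n. \<phi> i v * \<psi> (e i))" if "functional V \<psi>" "v \<in> K" for \<psi> v
    by (rule functional_expansion[OF V K(1), of n e \<phi>]) (use * P(1) that in auto)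
  with *(1) show ?thesis by (intro exI[of _ n] exI[of _ e] exI[of _ \<phi>]) simp
qed

lemma finitely_separated_dual_basis:
  assumes V: "finitely_separated V" and K: "subspace_of V K"
  shows "\<exists>(n::nat) e \<phi>. (\<forall>i<n. e i \<in> K \<and> functional V (\<phi> i)) \<and>
           (\<forall>\<psi>. functional V \<psi> \<longrightarrow> (\<forall>v\<in>K. \<psi> v = (\<Sum>i<n. \<phi> i v * \<psi> (e i))))"
proof -
  obtain \<Phi> where \<Phi>: "finite \<Phi>" "\<forall>\<phi>\<in>\<Phi>. functional V \<phi>"
      "\<forall>v\<in>carrier V. (\<forall>\<phi>\<in>\<Phi>. \<phi> v = 0) \<longrightarrow> v = \<zero>\<^bsub>V\<^esub>" and vs: "vspace V"
    using V unfolding finitely_separated_def by (elim exE conjE) (rule that)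
  show ?thesis
  proof (rule dual_basis_exists[OF vs \<Phi>(1), of "functional V" K])
    show "v = \<zero>\<^bsub>V\<^esub>" if "v \<in> K" "\<And>\<phi>. \<phi> \<in> \<Phi> \<Longrightarrow> \<phi> v = 0" for v
      using \<Phi>(3) K that by (auto simp: subspace_of_def)
  qed (use \<Phi>(2) K functional_combine in auto)
qed

text \<open>The dual basis of \<open>K\<close> defines a projection onto \<open>K\<close>, which
  sends \<open>w\<close> to some \<open>u\<close> different from \<open>w\<close>. If
  \<open>\<psi>\<close> separates them, then \<open>\<psi>\<close> minus its composite with the
  projection vanishes on \<open>K\<close> but not at \<open>w\<close>.\<close>

lemma functional_vanishing_on:
  assumes V: "finitely_separated V" and K: "subspace_of V K" and w: "w \<in> carrier V" "w \<notin> K"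
  shows "\<exists>\<chi>. functional V \<chi> \<and> (\<forall>v\<in>K. \<chi> v = 0) \<and> \<chi> w \<noteq> 0"
proof -
  have vs: "vspace V" and sub: "K \<subseteq> carrier V"
    using V K by (simp_all add: finitely_separated_def subspace_of_def)
  obtain n :: nat and e \<phi> where e: "\<forall>i<n. e i \<in> K \<and> functional V (\<phi> i)"
    "\<forall>\<psi>. functional V \<psi> \<longrightarrow> (\<forall>v\<in>K. \<psi> v = (\<Sum>i<n. \<phi> i v * \<psi> (e i)))"
    using finitely_separated_dual_basis[OF V K] by (elim exE conjE) (rule that)
  obtain u where u: "u \<in> K" "\<forall>\<chi>. functional V \<chi> \<longrightarrow> \<chi> u = (\<Sum>i<n. \<phi> i w * \<chi> (e i))"
    using linear_combination_exists[OF K vs, of n e "\<lambda>i. \<phi> i w"] e(1) by (auto elim!: bexE)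
  have "\<exists>\<psi>. functional V \<psi> \<and> \<psi> w \<noteq> \<psi> u"
  proof (rule ccontr)
    assume "\<not> ?thesis"
    then have "w = u"
      using u(1) w(1) sub
      by (intro separated_eqI[OF finitely_separated_imp_separated[OF V]]) auto
    then show False using u(1) w(2) by simp
  qed
  then obtain \<psi> where \<psi>: "functional V \<psi>" "\<psi> w \<noteq> \<psi> u" by (elim exE conjE)
  \<comment> \<open>The factor 1 brings the term into the shape of
    \<open>functional_combine\<close>.\<close>
  define \<chi> where "\<chi> v = \<psi> v - 1 * (\<Sum>i<n. \<phi> i v * \<psi> (e i))" for v
  have "functional V \<chi>"
    unfolding \<chi>_def by (intro functional_combine functional_sum \<psi>) (use e(1) in simp)
  moreover have "\<forall>v\<in>K. \<chi> v = 0" using e(2)[rule_format, OF \<psi>(1)] by (simp add: \<chi>_def)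
  moreover have "\<chi> w \<noteq> 0"
    using \<psi> u(2)[rule_format, OF \<psi>(1)] by (simp add: \<chi>_def)
  ultimately show ?thesis by (intro exI[of _ \<chi>] conjI)
qed

section \<open>Tensor products\<close>

lemma bilinear_forms_iff:
  assumes "vspace V" "vspace W"
  shows "\<beta> \<in> bilinear_forms V W \<longleftrightarrow>
    (\<forall>w\<in>carrier W. functional V (\<lambda>v. \<beta> v w)) \<and> (\<forall>v\<in>carrier V. functional W (\<beta> v))"
  unfolding bilinear_forms_def functional_iff_lin_maps[OF assms(1)]
    functional_iff_lin_maps[OF assms(2)] by simp

lemma product_bilinear:
  assumes "vspace V" "vspace W" and \<phi>: "functional V \<phi>" and \<psi>: "functional W \<psi>"
  shows "(\<lambda>v w. \<phi> v * \<psi> w) \<in> bilinear_forms V W"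
  unfolding bilinear_forms_iff[OF assms(1,2)] functional_def
  by (simp add: functional_add[OF \<phi>] functional_smult[OF \<phi>]
      functional_add[OF \<psi>] functional_smult[OF \<psi>] algebra_simps)

lemma tensor_space_simps [simp]:
  "zero (tensor_space V W) = (\<lambda>\<beta>. 0)"
  "add (tensor_space V W) = (\<lambda>s t \<beta>. s \<beta> + t \<beta>)"
  "smult (tensor_space V W) = (\<lambda>c t \<beta>. c * t \<beta>)"
  by (simp_all add: tensor_space_def)

lemma tensor_carrier:
  "carrier (tensor_space V W) = {\<lambda>\<beta>. \<Sum>i<n. pure_tensor V W (v i) (w i) \<beta> |(n::nat) v w.
     (\<forall>i<n. v i \<in> carrier V) \<and> (\<forall>i<n. w i \<in> carrier W)}"
  by (simp add: tensor_space_def)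

lemma tensor_zero_closed: "(\<lambda>\<beta>. 0) \<in> carrier (tensor_space V W)"
  unfolding tensor_carrier by (rule CollectI, rule exI[of _ 0]) simp

lemma tensor_snoc_closed:
  assumes "t \<in> carrier (tensor_space V W)" "v \<in> carrier V" "w \<in> carrier W"
  shows "(\<lambda>\<beta>. t \<beta> + pure_tensor V W v w \<beta>) \<in> carrier (tensor_space V W)"
proof -
  obtain n :: nat and vs ws where t: "t = (\<lambda>\<beta>. \<Sum>i<n. pure_tensor V W (vs i) (ws i) \<beta>)"
    "\<forall>i<n. vs i \<in> carrier V" "\<forall>i<n. ws i \<in> carrier W"
    using assms(1) unfolding tensor_carrier by (elim CollectE exE conjE) (rule that)
  have "(\<lambda>\<beta>. t \<beta> + pure_tensor V W v w \<beta>) =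
      (\<lambda>\<beta>. \<Sum>i<Suc n. pure_tensor V W ((vs(n := v)) i) ((ws(n := w)) i) \<beta>)"
    unfolding t(1) by (rule ext) simp
  moreover have "\<forall>i<Suc n. (vs(n := v)) i \<in> carrier V" "\<forall>i<Suc n. (ws(n := w)) i \<in> carrier W"
    using t(2,3) assms(2,3) by (simp_all add: less_Suc_eq)
  ultimately show ?thesis
    unfolding tensor_carrier
    by (intro CollectI exI[of _ "Suc n"] exI[of _ "vs(n := v)"] exI[of _ "ws(n := w)"] conjI)
qed

text \<open>Carrier elements are sums of pure tensors without coefficients, so appending one summand
  is the only inductive step. Later proofs need not fix a representation of a tensor.\<close>

lemma tensor_induct [consumes 1, case_names zero snoc]:
  assumes t: "t \<in> carrier (tensor_space V W)"
    and zero: "P (\<lambda>\<beta>. 0)"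
    and snoc: "\<And>t v w. \<lbrakk>t \<in> carrier (tensor_space V W); P t; v \<in> carrier V; w \<in> carrier W\<rbrakk>
      \<Longrightarrow> P (\<lambda>\<beta>. t \<beta> + pure_tensor V W v w \<beta>)"
  shows "P t"
proof -
  obtain n :: nat and vs ws where t: "t = (\<lambda>\<beta>. \<Sum>i<n. pure_tensor V W (vs i) (ws i) \<beta>)"
    and vw: "\<forall>i<n. vs i \<in> carrier V" "\<forall>i<n. ws i \<in> carrier W"
    using assms(1) unfolding tensor_carrier by (elim CollectE exE conjE) (rule that)
  have "(\<lambda>\<beta>. \<Sum>i<m. pure_tensor V W (vs i) (ws i) \<beta>) \<in> carrier (tensor_space V W) \<and>
      P (\<lambda>\<beta>. \<Sum>i<m. pure_tensor V W (vs i) (ws i) \<beta>)" if "m \<le> n" for m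
    using that
  proof (induction m)
    case 0
    then show ?case using zero tensor_zero_closed by simp
  next
    case (Suc m)
    then have *: "vs m \<in> carrier V" "ws m \<in> carrier W" using vw by simp_all
    show ?case
      using snoc[OF _ _ *] tensor_snoc_closed[OF _ *] Suc by simp
  qed
  then show ?thesis using t by simp
qed

lemma pure_closed:
  assumes "v \<in> carrier V" "w \<in> carrier W"
  shows "pure_tensor V W v w \<in> carrier (tensor_space V W)"
  using tensor_snoc_closed[OF tensor_zero_closed assms] by simp

lemma tensor_add_closed:
  assumes s: "s \<in> carrier (tensor_space V W)" and t: "t \<in> carrier (tensor_space V W)"
  shows "(\<lambda>\<beta>. s \<beta> + t \<beta>) \<in> carrier (tensor_space V W)"
  using t
proof (induct t rule: tensor_induct)
  case zero
  then show ?case using s by simp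
next
  case (snoc t v w)
  show ?case using tensor_snoc_closed[OF snoc(2,3,4)] by (simp add: add.assoc)
qed

lemma tensor_smult_closed:
  assumes V: "vspace V" "vspace W" and t: "t \<in> carrier (tensor_space V W)"
  shows "(\<lambda>\<beta>. c * t \<beta>) \<in> carrier (tensor_space V W)"
  using t
proof (induct t rule: tensor_induct)
  case zero
  then show ?case using tensor_zero_closed by simp
next
  case (snoc t v w)
  have "pure_tensor V W (c \<odot>\<^bsub>V\<^esub> v) w \<beta> = c * pure_tensor V W v w \<beta>" for \<beta>
    using snoc(3,4) functional_smult[of V "\<lambda>v. \<beta> v w" v c]
    unfolding pure_tensor_def bilinear_forms_iff[OF V] by simp
  then show ?case
    using tensor_snoc_closed[OF snoc(2) vspaceD(3)[OF V(1) snoc(3), of c] snoc(4)]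
    by (simp add: distrib_left)
qed

text \<open>The default value 0 off the bilinear forms makes equality of tensors as functions the
  same as equality on bilinear forms.\<close>

lemma tensor_outside: "\<lbrakk>t \<in> carrier (tensor_space V W); \<beta> \<notin> bilinear_forms V W\<rbrakk> \<Longrightarrow> t \<beta> = 0"
  by (induct t rule: tensor_induct) (simp_all add: pure_tensor_def)

lemma functional_evaluation: "functional (tensor_space V W) (\<lambda>t. t \<beta>)"
  by (simp add: functional_def)

lemma tensor_separated:
  assumes "vspace V" "vspace W"
  shows "separated (tensor_space V W)"
proof (rule separatedI[of _ UNIV "\<lambda>\<beta> t. t \<beta>"])
  show "u = v" if "\<And>\<beta>. \<beta> \<in> UNIV \<Longrightarrow> u \<beta> = v \<beta>" for u v :: "('a \<Rightarrow> 'b \<Rightarrow> complex) \<Rightarrow> complex"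
    using that by auto
qed (auto simp: tensor_zero_closed functional_evaluation tensor_add_closed
    tensor_smult_closed[OF assms])

lemma tensor_vspace: "\<lbrakk>vspace V; vspace W\<rbrakk> \<Longrightarrow> vspace (tensor_space V W)"
  by (rule separated_vspace[OF tensor_separated])

text \<open>Bilinear forms are total functions, so two forms that agree on the carriers can still be
  different arguments of \<open>t\<close>. This lemma identifies their values.\<close>

lemma tensor_cong:
  assumes t: "t \<in> carrier (tensor_space V W)" and \<beta>: "\<beta> \<in> bilinear_forms V W"
    and \<beta>': "\<beta>' \<in> bilinear_forms V W"
    and eq: "\<And>v w. \<lbrakk>v \<in> carrier V; w \<in> carrier W\<rbrakk> \<Longrightarrow> \<beta> v w = \<beta>' v w"
  shows "t \<beta> = t \<beta>'"
  using t by (induct t rule: tensor_induct) (simp_all add: pure_tensor_def \<beta> \<beta>' eq)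

lemma pure_tensor_apply: "\<beta> \<in> bilinear_forms V W \<Longrightarrow> pure_tensor V W v w \<beta> = \<beta> v w"
  by (simp add: pure_tensor_def)

text \<open>For a separated target this weak form of bilinearity is the usual one.\<close>

definition bilinear_map ::
    "(complex, 'v) module \<Rightarrow> (complex, 'w) module \<Rightarrow> (complex, 'u) module \<Rightarrow> ('v \<Rightarrow> 'w \<Rightarrow> 'u) \<Rightarrow> bool" where
  "bilinear_map V W U B \<longleftrightarrow> (\<forall>v\<in>carrier V. \<forall>w\<in>carrier W. B v w \<in> carrier U) \<and>
     (\<forall>\<xi>. functional U \<xi> \<longrightarrow> (\<lambda>v w. \<xi> (B v w)) \<in> bilinear_forms V W)"

lemma bilinear_mapD:
  assumes "bilinear_map V W U B"
  shows "\<And>v w. \<lbrakk>v \<in> carrier V; w \<in> carrier W\<rbrakk> \<Longrightarrow> B v w \<in> carrier U"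
    and "\<And>\<xi>. functional U \<xi> \<Longrightarrow> (\<lambda>v w. \<xi> (B v w)) \<in> bilinear_forms V W"
  using assms by (simp_all add: bilinear_map_def)

text \<open>Pointwise existence of the map induced by \<open>B\<close>. The value at
  \<open>t\<close> is specified by what each functional must see, a condition that mentions no
  representation of \<open>t\<close>, so there is no well-definedness to check.\<close>

lemma tensor_represent:
  assumes U: "vspace U" and B: "bilinear_map V W U B" and t: "t \<in> carrier (tensor_space V W)"
  shows "\<exists>u\<in>carrier U. \<forall>\<xi>. functional U \<xi> \<longrightarrow> \<xi> u = t (\<lambda>v w. \<xi> (B v w))"
  using t
proof (induct t rule: tensor_induct)
  case zero
  show ?case
    by (intro bexI[of _ "\<zero>\<^bsub>U\<^esub>"] allI impI) (auto simp: functional_zero U vspaceD)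
next
  case (snoc t v w)
  obtain u where u: "u \<in> carrier U" "\<forall>\<xi>. functional U \<xi> \<longrightarrow> \<xi> u = t (\<lambda>v w. \<xi> (B v w))"
    using snoc(2) by (elim bexE)
  have b: "B v w \<in> carrier U" using bilinear_mapD(1)[OF B] snoc(3,4) by simp
  show ?case
  proof (intro bexI[of _ "u \<oplus>\<^bsub>U\<^esub> B v w"] allI impI)
    show "u \<oplus>\<^bsub>U\<^esub> B v w \<in> carrier U" using U u b by (simp add: vspaceD)
    show "\<xi> (u \<oplus>\<^bsub>U\<^esub> B v w) =
        t (\<lambda>v w. \<xi> (B v w)) + pure_tensor V W v w (\<lambda>v w. \<xi> (B v w))" if \<xi>: "functional U \<xi>" for \<xi>
      unfolding pure_tensor_apply[OF bilinear_mapD(2)[OF B \<xi>]]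
      using functional_add[OF \<xi> u(1) b] u(2)[rule_format, OF \<xi>] by simp
  qed
qed

section \<open>Linear maps and the universal property of the tensor product\<close>

lemma lin_mapsD:
  assumes "f \<in> lin_maps V W"
  shows "\<And>x. x \<in> carrier V \<Longrightarrow> f x \<in> carrier W"
    and "\<And>x y. \<lbrakk>x \<in> carrier V; y \<in> carrier V\<rbrakk> \<Longrightarrow> f (x \<oplus>\<^bsub>V\<^esub> y) = f x \<oplus>\<^bsub>W\<^esub> f y"
    and "\<And>c x. x \<in> carrier V \<Longrightarrow> f (c \<odot>\<^bsub>V\<^esub> x) = c \<odot>\<^bsub>W\<^esub> f x"
    and "f \<in> extensional (carrier V)"
  using assms by (auto simp: lin_maps_def PiE_iff)

lemma lin_mapsI:
  assumes "\<And>x. x \<in> carrier V \<Longrightarrow> f x \<in> carrier W"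
    and "\<And>x y. \<lbrakk>x \<in> carrier V; y \<in> carrier V\<rbrakk> \<Longrightarrow> f (x \<oplus>\<^bsub>V\<^esub> y) = f x \<oplus>\<^bsub>W\<^esub> f y"
    and "\<And>c x. x \<in> carrier V \<Longrightarrow> f (c \<odot>\<^bsub>V\<^esub> x) = c \<odot>\<^bsub>W\<^esub> f x"
    and "f \<in> extensional (carrier V)"
  shows "f \<in> lin_maps V W"
  using assms by (auto simp: lin_maps_def PiE_iff)

lemma lin_maps_zero: "\<lbrakk>f \<in> lin_maps V W; vspace V; vspace W\<rbrakk> \<Longrightarrow> f \<zero>\<^bsub>V\<^esub> = \<zero>\<^bsub>W\<^esub>"
  using lin_mapsD(3)[of f V W "\<zero>\<^bsub>V\<^esub>" 0] vspaceD(1,4)[of V] vspaceD(4)[of W] lin_mapsD(1)[of f V W]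
  by fastforce

lemma lin_mapsI_functionals:
  assumes V: "vspace V" and W: "separated W"
    and cl: "\<And>x. x \<in> carrier V \<Longrightarrow> f x \<in> carrier W"
    and lin: "\<And>\<xi>. functional W \<xi> \<Longrightarrow> functional V (\<lambda>x. \<xi> (f x))"
  shows "(\<lambda>x\<in>carrier V. f x) \<in> lin_maps V W"
proof (rule lin_mapsI)
  note Wv = separated_vspace[OF W]
  fix x y c assume x: "x \<in> carrier V"
  show "(\<lambda>x\<in>carrier V. f x) (c \<odot>\<^bsub>V\<^esub> x) = c \<odot>\<^bsub>W\<^esub> (\<lambda>x\<in>carrier V. f x) x"
  proof (rule separated_eqI[OF W])
    show "\<xi> ((\<lambda>x\<in>carrier V. f x) (c \<odot>\<^bsub>V\<^esub> x)) = \<xi> (c \<odot>\<^bsub>W\<^esub> (\<lambda>x\<in>carrier V. f x) x)"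
      if \<xi>: "functional W \<xi>" for \<xi>
      using x V functional_smult[OF lin[OF \<xi>] x] functional_smult[OF \<xi> cl[OF x]]
      by (simp add: vspaceD)
  qed (use x V Wv in \<open>auto simp: vspaceD cl\<close>)
  assume y: "y \<in> carrier V"
  show "(\<lambda>x\<in>carrier V. f x) (x \<oplus>\<^bsub>V\<^esub> y) = (\<lambda>x\<in>carrier V. f x) x \<oplus>\<^bsub>W\<^esub> (\<lambda>x\<in>carrier V. f x) y"
  proof (rule separated_eqI[OF W])
    show "\<xi> ((\<lambda>x\<in>carrier V. f x) (x \<oplus>\<^bsub>V\<^esub> y)) =
        \<xi> ((\<lambda>x\<in>carrier V. f x) x \<oplus>\<^bsub>W\<^esub> (\<lambda>x\<in>carrier V. f x) y)"
      if \<xi>: "functional W \<xi>" for \<xi>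
      using x y V functional_add[OF lin[OF \<xi>] x y] functional_add[OF \<xi> cl[OF x] cl[OF y]]
      by (simp add: vspaceD)
  qed (use x y V Wv in \<open>auto simp: vspaceD cl\<close>)
qed (use cl in auto)

text \<open>Prescribed values on pure tensors already fix every functional of \<open>L t\<close>.
  For a separated target this gives uniqueness of the lift.\<close>

lemma lin_maps_tensor_functional:
  assumes V: "vspace V" "vspace W" and U: "vspace U" and L: "L \<in> lin_maps (tensor_space V W) U"
    and B: "bilinear_map V W U B"
    and LB: "\<And>v w. \<lbrakk>v \<in> carrier V; w \<in> carrier W\<rbrakk> \<Longrightarrow> L (pure_tensor V W v w) = B v w"
    and t: "t \<in> carrier (tensor_space V W)" and \<xi>: "functional U \<xi>"
  shows "\<xi> (L t) = t (\<lambda>v w. \<xi> (B v w))"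
  using t
proof (induct t rule: tensor_induct)
  case zero
  then show ?case
    using lin_maps_zero[OF L tensor_vspace[OF V] U] functional_zero[OF \<xi> U] by simp
next
  case (snoc t v w)
  have "\<xi> (L (\<lambda>\<beta>. t \<beta> + pure_tensor V W v w \<beta>)) = \<xi> (L t \<oplus>\<^bsub>U\<^esub> L (pure_tensor V W v w))"
    using lin_mapsD(2)[OF L snoc(1) pure_closed[OF snoc(3,4)]] by simp
  also have "\<dots> = \<xi> (L t) + \<xi> (B v w)"
    using functional_add[OF \<xi> lin_mapsD(1)[OF L snoc(1)] lin_mapsD(1)[OF L pure_closed[OF snoc(3,4)]]]
      LB[OF snoc(3,4)] by simp
  finally show ?case
    using snoc(2) pure_tensor_apply[OF bilinear_mapD(2)[OF B \<xi>]] by simp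
qed

text \<open>The third clause is the working form: a lifted map is evaluated by testing it with a
  functional and feeding the resulting bilinear form to \<open>t\<close>.\<close>

lemma tensor_lift:
  assumes V: "vspace V" "vspace W" and U: "separated U" and B: "bilinear_map V W U B"
  shows "tensor_lift V W U B \<in> lin_maps (tensor_space V W) U"
    and "\<And>v w. \<lbrakk>v \<in> carrier V; w \<in> carrier W\<rbrakk> \<Longrightarrow> tensor_lift V W U B (pure_tensor V W v w) = B v w"
    and "\<And>t \<xi>. \<lbrakk>t \<in> carrier (tensor_space V W); functional U \<xi>\<rbrakk>
      \<Longrightarrow> \<xi> (tensor_lift V W U B t) = t (\<lambda>v w. \<xi> (B v w))"
proof -
  note Uv = separated_vspace[OF U]
  define Q where "Q L \<longleftrightarrow> L \<in> lin_maps (tensor_space V W) U \<and>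
    (\<forall>v\<in>carrier V. \<forall>w\<in>carrier W. L (pure_tensor V W v w) = B v w)" for L
  define l where "l t = (SOME u. u \<in> carrier U \<and>
    (\<forall>\<xi>. functional U \<xi> \<longrightarrow> \<xi> u = t (\<lambda>v w. \<xi> (B v w))))" for t
  have l: "l t \<in> carrier U \<and> (\<forall>\<xi>. functional U \<xi> \<longrightarrow> \<xi> (l t) = t (\<lambda>v w. \<xi> (B v w)))"
    if "t \<in> carrier (tensor_space V W)" for t
    using tensor_represent[OF Uv B that] unfolding Bex_def l_def by (rule someI_ex)
  have l1: "l t \<in> carrier U" if "t \<in> carrier (tensor_space V W)" for t
    using l[OF that] by (rule conjunct1)
  have l2: "\<xi> (l t) = t (\<lambda>v w. \<xi> (B v w))" if "t \<in> carrier (tensor_space V W)" "functional U \<xi>" for t \<xi>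
    using l[OF that(1), THEN conjunct2, rule_format, OF that(2)] .
  have Q: "Q (\<lambda>t\<in>carrier (tensor_space V W). l t)"
    unfolding Q_def
  proof (intro conjI ballI)
    show "(\<lambda>t\<in>carrier (tensor_space V W). l t) \<in> lin_maps (tensor_space V W) U"
    proof (rule lin_mapsI_functionals[OF tensor_vspace[OF V] U l1])
      fix \<xi> assume \<xi>: "functional U \<xi>"
      show "functional (tensor_space V W) (\<lambda>t. \<xi> (l t))"
        unfolding functional_def
        by (simp add: l2[OF _ \<xi>] tensor_add_closed tensor_smult_closed[OF V])
    qed
    fix v w assume vw: "v \<in> carrier V" "w \<in> carrier W"
    have "l (pure_tensor V W v w) = B v w"
    proof (rule separated_eqI[OF U l1[OF pure_closed[OF vw]] bilinear_mapD(1)[OF B vw]])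
      show "\<xi> (l (pure_tensor V W v w)) = \<xi> (B v w)" if "functional U \<xi>" for \<xi>
        using l2[OF pure_closed[OF vw] that] pure_tensor_apply[OF bilinear_mapD(2)[OF B that]] by simp
    qed
    then show "(\<lambda>t\<in>carrier (tensor_space V W). l t) (pure_tensor V W v w) = B v w"
      by (simp add: pure_closed vw)
  qed
  have val: "\<xi> (L t) = t (\<lambda>v w. \<xi> (B v w))"
    if "Q L" "t \<in> carrier (tensor_space V W)" "functional U \<xi>" for L t \<xi>
    using that(1) unfolding Q_def
    by (intro lin_maps_tensor_functional[OF V Uv _ B _ that(2,3)]) auto
  have uniq: "L = (\<lambda>t\<in>carrier (tensor_space V W). l t)" if L: "Q L" for L
  proof (rule extensionalityI[of _ "carrier (tensor_space V W)"])
    show "L \<in> extensional (carrier (tensor_space V W))"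
      by (rule lin_mapsD(4)[OF conjunct1[OF L[unfolded Q_def]]])
    fix t assume t: "t \<in> carrier (tensor_space V W)"
    have "L t = l t"
    proof (rule separated_eqI[OF U _ l1[OF t]])
      show "L t \<in> carrier U" by (rule lin_mapsD(1)[OF conjunct1[OF L[unfolded Q_def]] t])
      show "\<xi> (L t) = \<xi> (l t)" if "functional U \<xi>" for \<xi>
        using val[OF L t that] l2[OF t that] by simp
    qed
    then show "L t = (\<lambda>t\<in>carrier (tensor_space V W). l t) t" using t by simp
  qed simp
  have "Q (tensor_lift V W U B)"
    unfolding tensor_lift_def Q_def[symmetric] by (rule theI[of Q, OF Q uniq])
  then show "tensor_lift V W U B \<in> lin_maps (tensor_space V W) U"
    and "\<And>v w. \<lbrakk>v \<in> carrier V; w \<in> carrier W\<rbrakk> \<Longrightarrow> tensor_lift V W U B (pure_tensor V W v w) = B v w"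
    and "\<And>t \<xi>. \<lbrakk>t \<in> carrier (tensor_space V W); functional U \<xi>\<rbrakk>
      \<Longrightarrow> \<xi> (tensor_lift V W U B t) = t (\<lambda>v w. \<xi> (B v w))"
    using val by (simp_all add: Q_def)
qed

lemma lin_maps_bilinear:
  assumes V: "vspace V" "vspace W" "vspace X" "vspace Y"
    and f: "f \<in> lin_maps V X" and g: "g \<in> lin_maps W Y" and \<beta>: "\<beta> \<in> bilinear_forms X Y"
  shows "(\<lambda>v w. \<beta> (f v) (g w)) \<in> bilinear_forms V W"
  unfolding bilinear_forms_iff[OF V(1,2)]
proof (intro conjI ballI)
  note \<beta>' = \<beta>[unfolded bilinear_forms_iff[OF V(3,4)]]
  show "functional V (\<lambda>v. \<beta> (f v) (g w))" if "w \<in> carrier W" for w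
    by (rule functional_comp[OF f conjunct1[OF \<beta>', rule_format, OF lin_mapsD(1)[OF g that]]])
  show "functional W (\<lambda>w. \<beta> (f v) (g w))" if "v \<in> carrier V" for v
    by (rule functional_comp[OF g conjunct2[OF \<beta>', rule_format, OF lin_mapsD(1)[OF f that]]])
qed

lemma pure_tensor_linear:
  assumes V: "vspace V" "vspace W"
  shows "\<And>v v' w. \<lbrakk>v \<in> carrier V; v' \<in> carrier V; w \<in> carrier W\<rbrakk> \<Longrightarrow>
      pure_tensor V W (v \<oplus>\<^bsub>V\<^esub> v') w = (\<lambda>\<beta>. pure_tensor V W v w \<beta> + pure_tensor V W v' w \<beta>)"
    and "\<And>v w w'. \<lbrakk>v \<in> carrier V; w \<in> carrier W; w' \<in> carrier W\<rbrakk> \<Longrightarrow>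
      pure_tensor V W v (w \<oplus>\<^bsub>W\<^esub> w') = (\<lambda>\<beta>. pure_tensor V W v w \<beta> + pure_tensor V W v w' \<beta>)"
    and "\<And>c v w. \<lbrakk>v \<in> carrier V; w \<in> carrier W\<rbrakk> \<Longrightarrow>
      pure_tensor V W (c \<odot>\<^bsub>V\<^esub> v) w = (\<lambda>\<beta>. c * pure_tensor V W v w \<beta>)"
    and "\<And>c v w. \<lbrakk>v \<in> carrier V; w \<in> carrier W\<rbrakk> \<Longrightarrow>
      pure_tensor V W v (c \<odot>\<^bsub>W\<^esub> w) = (\<lambda>\<beta>. c * pure_tensor V W v w \<beta>)"
  unfolding pure_tensor_def by (auto simp: fun_eq_iff bilinear_forms_iff[OF V] functional_def)

lemma pure_bilinear_map:
  assumes V: "vspace V" "vspace W" "vspace X" "vspace Y"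
    and f: "f \<in> lin_maps V X" and g: "g \<in> lin_maps W Y"
  shows "bilinear_map V W (tensor_space X Y) (\<lambda>v w. pure_tensor X Y (f v) (g w))"
proof -
  have cl: "pure_tensor X Y (f v) (g w) \<in> carrier (tensor_space X Y)"
    if "v \<in> carrier V" "w \<in> carrier W" for v w
    by (intro pure_closed lin_mapsD(1)[OF f] lin_mapsD(1)[OF g] that)
  show ?thesis
    unfolding bilinear_map_def
  proof (intro conjI ballI allI impI cl)
    fix \<xi> assume \<xi>: "functional (tensor_space X Y) \<xi>"
    note \<xi>' = functional_add[OF \<xi>, simplified] functional_smult[OF \<xi>, simplified]
    show "(\<lambda>v w. \<xi> (pure_tensor X Y (f v) (g w))) \<in> bilinear_forms V W"
      unfolding bilinear_forms_iff[OF V(1,2)] functional_def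
      by (intro conjI ballI allI;
          simp add: lin_mapsD[OF f] lin_mapsD[OF g] pure_tensor_linear[OF V(3,4)] cl \<xi>')
  qed
qed

lemma tensor_map:
  assumes V: "vspace V" "vspace W" "vspace X" "vspace Y"
    and f: "f \<in> lin_maps V X" and g: "g \<in> lin_maps W Y"
  shows "tensor_map V W X Y f g \<in> lin_maps (tensor_space V W) (tensor_space X Y)"
    and "\<And>v w. \<lbrakk>v \<in> carrier V; w \<in> carrier W\<rbrakk>
      \<Longrightarrow> tensor_map V W X Y f g (pure_tensor V W v w) = pure_tensor X Y (f v) (g w)"
    and "\<And>t \<beta>. \<lbrakk>t \<in> carrier (tensor_space V W); \<beta> \<in> bilinear_forms X Y\<rbrakk>
      \<Longrightarrow> tensor_map V W X Y f g t \<beta> = t (\<lambda>v w. \<beta> (f v) (g w))"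
proof -
  note * = tensor_lift[OF V(1,2) tensor_separated[OF V(3,4)] pure_bilinear_map[OF V f g]]
  show "tensor_map V W X Y f g \<in> lin_maps (tensor_space V W) (tensor_space X Y)"
    and "\<And>v w. \<lbrakk>v \<in> carrier V; w \<in> carrier W\<rbrakk>
      \<Longrightarrow> tensor_map V W X Y f g (pure_tensor V W v w) = pure_tensor X Y (f v) (g w)"
    unfolding tensor_map_def by (rule *(1), rule *(2))
  fix t \<beta> assume t: "t \<in> carrier (tensor_space V W)" and \<beta>: "\<beta> \<in> bilinear_forms X Y"
  show "tensor_map V W X Y f g t \<beta> = t (\<lambda>v w. \<beta> (f v) (g w))"
    unfolding tensor_map_def *(3)[OF t functional_evaluation] pure_tensor_apply[OF \<beta>] ..
qed

text \<open>The vector \<open>r\<close> is the contraction of \<open>t\<close> by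
  \<open>\<psi>\<close> in the second factor. It is the image of \<open>t\<close> under the map
  induced by the bilinear map sending \<open>v, w\<close> to \<open>\<psi> w\<close> times
  \<open>v\<close>.\<close>

lemma tensor_slice_left:
  assumes V: "vspace V" "vspace W" and \<psi>: "functional W \<psi>" and t: "t \<in> carrier (tensor_space V W)"
  shows "\<exists>r\<in>carrier V. \<forall>\<xi>. functional V \<xi> \<longrightarrow> \<xi> r = t (\<lambda>v w. \<xi> v * \<psi> w)"
proof -
  have form: "(\<lambda>v w. \<xi> (\<psi> w \<odot>\<^bsub>V\<^esub> v)) \<in> bilinear_forms V W" if \<xi>: "functional V \<xi>" for \<xi>
    unfolding bilinear_forms_iff[OF V] functional_def
    by (simp add: functional_add[OF \<xi>] functional_smult[OF \<xi>] vspaceD[OF V(1)]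
        functional_add[OF \<psi>] functional_smult[OF \<psi>] algebra_simps)
  have B: "bilinear_map V W V (\<lambda>v w. \<psi> w \<odot>\<^bsub>V\<^esub> v)"
    unfolding bilinear_map_def using form by (simp add: vspaceD[OF V(1)])
  obtain r where r: "r \<in> carrier V" "\<forall>\<xi>. functional V \<xi> \<longrightarrow> \<xi> r = t (\<lambda>v w. \<xi> (\<psi> w \<odot>\<^bsub>V\<^esub> v))"
    using tensor_represent[OF V(1) B t] by (elim bexE)
  show ?thesis
  proof (intro bexI[OF _ r(1)] allI impI)
    fix \<xi> assume \<xi>: "functional V \<xi>"
    show "\<xi> r = t (\<lambda>v w. \<xi> v * \<psi> w)"
      unfolding r(2)[rule_format, OF \<xi>]
      by (rule tensor_cong[OF t form[OF \<xi>] product_bilinear[OF V \<xi> \<psi>]])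
        (simp add: functional_smult[OF \<xi>])
  qed
qed

lemma tensor_slice_right:
  assumes V: "vspace V" "vspace W" and \<phi>: "functional V \<phi>" and t: "t \<in> carrier (tensor_space V W)"
  shows "\<exists>r\<in>carrier W. \<forall>\<xi>. functional W \<xi> \<longrightarrow> \<xi> r = t (\<lambda>v w. \<phi> v * \<xi> w)"
proof -
  have form: "(\<lambda>v w. \<xi> (\<phi> v \<odot>\<^bsub>W\<^esub> w)) \<in> bilinear_forms V W" if \<xi>: "functional W \<xi>" for \<xi>
    unfolding bilinear_forms_iff[OF V] functional_def
    by (simp add: functional_add[OF \<xi>] functional_smult[OF \<xi>] vspaceD[OF V(2)]
        functional_add[OF \<phi>] functional_smult[OF \<phi>] algebra_simps)
  have B: "bilinear_map V W W (\<lambda>v w. \<phi> v \<odot>\<^bsub>W\<^esub> w)"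
    unfolding bilinear_map_def using form by (simp add: vspaceD[OF V(2)])
  obtain r where r: "r \<in> carrier W" "\<forall>\<xi>. functional W \<xi> \<longrightarrow> \<xi> r = t (\<lambda>v w. \<xi> (\<phi> v \<odot>\<^bsub>W\<^esub> w))"
    using tensor_represent[OF V(2) B t] by (elim bexE)
  show ?thesis
  proof (intro bexI[OF _ r(1)] allI impI)
    fix \<xi> assume \<xi>: "functional W \<xi>"
    show "\<xi> r = t (\<lambda>v w. \<phi> v * \<xi> w)"
      unfolding r(2)[rule_format, OF \<xi>]
      by (rule tensor_cong[OF t form[OF \<xi>] product_bilinear[OF V \<phi> \<xi>]])
        (simp add: functional_smult[OF \<xi>])
  qed
qed

lemma sum_products_bilinear:
  fixes n :: nat
  assumes V: "vspace V" "vspace W"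
    and f: "\<And>i. i < n \<Longrightarrow> functional V (\<phi> i)" "\<And>i. i < n \<Longrightarrow> functional W (\<psi> i)"
  shows "(\<lambda>v w. \<Sum>i<n. \<phi> i v * \<psi> i w) \<in> bilinear_forms V W"
  unfolding bilinear_forms_iff[OF V] functional_def
  using functional_add[OF f(1)] functional_smult[OF f(1)] functional_add[OF f(2)] functional_smult[OF f(2)]
  by (simp add: sum.distrib[symmetric] sum_distrib_left algebra_simps)

lemma tensor_sum_products:
  fixes n :: nat
  assumes V: "vspace V" "vspace W" and t: "t \<in> carrier (tensor_space V W)"
    and f: "\<And>i. i < n \<Longrightarrow> functional V (\<phi> i)" "\<And>i. i < n \<Longrightarrow> functional W (\<psi> i)"
  shows "t (\<lambda>v w. \<Sum>i<n. \<phi> i v * \<psi> i w) = (\<Sum>i<n. t (\<lambda>v w. \<phi> i v * \<psi> i w))"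
  using t
proof (induct t rule: tensor_induct)
  case (snoc t v w)
  have "(\<Sum>i<n. pure_tensor V W v w (\<lambda>v w. \<phi> i v * \<psi> i w)) = (\<Sum>i<n. \<phi> i v * \<psi> i w)"
    by (intro sum.cong refl pure_tensor_apply product_bilinear V f) auto
  then show ?case
    using snoc(2) pure_tensor_apply[OF sum_products_bilinear[OF V f]] by (simp add: sum.distrib)
qed simp

text \<open>A dual basis of \<open>V\<close> writes any bilinear form as
  \<open>\<Sum>i. \<phi> i v * \<beta> (e i) w\<close>, a finite sum of products of functionals; so
  products suffice to test equality.\<close>

lemma tensor_eqI:
  assumes V: "finitely_separated V" and W: "vspace W"
    and s: "s \<in> carrier (tensor_space V W)" and t: "t \<in> carrier (tensor_space V W)"
    and eq: "\<And>\<phi> \<psi>. \<lbrakk>functional V \<phi>; functional W \<psi>\<rbrakk>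
      \<Longrightarrow> s (\<lambda>v w. \<phi> v * \<psi> w) = t (\<lambda>v w. \<phi> v * \<psi> w)"
  shows "s = t"
proof (rule ext)
  fix \<beta>
  have Vv: "vspace V" using V by (simp add: finitely_separated_def)
  show "s \<beta> = t \<beta>"
  proof (cases "\<beta> \<in> bilinear_forms V W")
    case False
    then show ?thesis using tensor_outside s t by metis
  next
    case True
    obtain n :: nat and e \<phi> where e: "\<forall>i<n. e i \<in> carrier V \<and> functional V (\<phi> i)"
      "\<forall>\<psi>. functional V \<psi> \<longrightarrow> (\<forall>v\<in>carrier V. \<psi> v = (\<Sum>i<n. \<phi> i v * \<psi> (e i)))"
      using finitely_separated_dual_basis[OF V subspace_of_carrier[OF Vv]]
      by (elim exE conjE) (rule that)
    have \<phi>: "functional V (\<phi> i)" "functional W (\<beta> (e i))" if "i < n" for i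
      using e(1) that True unfolding bilinear_forms_iff[OF Vv W] by simp_all
    have form: "(\<lambda>v w. \<Sum>i<n. \<phi> i v * \<beta> (e i) w) \<in> bilinear_forms V W"
      by (rule sum_products_bilinear[OF Vv W \<phi>])
    have expand: "u \<beta> = (\<Sum>i<n. u (\<lambda>v w. \<phi> i v * \<beta> (e i) w))" if u: "u \<in> carrier (tensor_space V W)" for u
    proof -
      have "u \<beta> = u (\<lambda>v w. \<Sum>i<n. \<phi> i v * \<beta> (e i) w)"
      proof (rule tensor_cong[OF u True form])
        fix v w assume "v \<in> carrier V" "w \<in> carrier W"
        then show "\<beta> v w = (\<Sum>i<n. \<phi> i v * \<beta> (e i) w)"
          using True e(2)[rule_format, of "\<lambda>v. \<beta> v w"] unfolding bilinear_forms_iff[OF Vv W] by simp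
      qed
      then show ?thesis using tensor_sum_products[OF Vv W u \<phi>] by simp
    qed
    show ?thesis
      unfolding expand[OF s] expand[OF t] by (intro sum.cong refl eq \<phi>) simp_all
  qed
qed

section \<open>Spaces of linear maps, and linear maps out of a tensor product\<close>

lemma lin_space_simps [simp]:
  "carrier (lin_space V W) = lin_maps V W"
  "zero (lin_space V W) = (\<lambda>x\<in>carrier V. \<zero>\<^bsub>W\<^esub>)"
  "add (lin_space V W) = (\<lambda>f g. \<lambda>x\<in>carrier V. f x \<oplus>\<^bsub>W\<^esub> g x)"
  "smult (lin_space V W) = (\<lambda>c f. \<lambda>x\<in>carrier V. c \<odot>\<^bsub>W\<^esub> f x)"
  by (simp_all add: lin_space_def)

lemma lin_maps_eqI:
  assumes "f \<in> lin_maps V W" "g \<in> lin_maps V W" "\<And>x. x \<in> carrier V \<Longrightarrow> f x = g x"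
  shows "f = g"
  using lin_mapsD(4)[OF assms(1)] lin_mapsD(4)[OF assms(2)] assms(3) by (rule extensionalityI)

lemma lin_space_separated:
  assumes V: "vspace V" and W: "separated W"
  shows "separated (lin_space V W)"
proof (rule separatedI[of _ "{(x, \<xi>). x \<in> carrier V \<and> functional W \<xi>}" "\<lambda>(x, \<xi>) f. \<xi> (f x)"])
  note Wv = separated_vspace[OF W]
  interpret W: module complex_ring W by (rule Wv)
  show "zero (lin_space V W) \<in> carrier (lin_space V W)"
    unfolding lin_space_simps by (rule lin_mapsI) (simp_all add: vspaceD[OF V])
  show "add (lin_space V W) f g \<in> carrier (lin_space V W)"
    if "f \<in> carrier (lin_space V W)" "g \<in> carrier (lin_space V W)" for f g
  proof -
    have f: "f \<in> lin_maps V W" and g: "g \<in> lin_maps V W" using that by simp_all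
    show ?thesis
      unfolding lin_space_simps
    proof (rule lin_mapsI_functionals[OF V W])
      show "f x \<oplus>\<^bsub>W\<^esub> g x \<in> carrier W" if "x \<in> carrier V" for x
        using lin_mapsD(1)[OF f that] lin_mapsD(1)[OF g that] by simp
      fix \<xi> assume \<xi>: "functional W \<xi>"
      note f\<xi> = functional_comp[OF f \<xi>] and g\<xi> = functional_comp[OF g \<xi>]
      show "functional V (\<lambda>x. \<xi> (f x \<oplus>\<^bsub>W\<^esub> g x))"
        unfolding functional_def
        by (simp add: functional_add[OF \<xi>] lin_mapsD(1)[OF f] lin_mapsD(1)[OF g] vspaceD[OF V]
            functional_add[OF f\<xi>] functional_smult[OF f\<xi>] functional_add[OF g\<xi>]
            functional_smult[OF g\<xi>] algebra_simps)
    qed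
  qed
  show "smult (lin_space V W) c f \<in> carrier (lin_space V W)"
    if "f \<in> carrier (lin_space V W)" for c f
  proof -
    have f: "f \<in> lin_maps V W" using that by simp
    show ?thesis
      unfolding lin_space_simps
    proof (rule lin_mapsI_functionals[OF V W])
      show "c \<odot>\<^bsub>W\<^esub> f x \<in> carrier W" if "x \<in> carrier V" for x
        using lin_mapsD(1)[OF f that] by (simp add: vspaceD(3)[OF Wv])
      fix \<xi> assume \<xi>: "functional W \<xi>"
      note f\<xi> = functional_comp[OF f \<xi>]
      show "functional V (\<lambda>x. \<xi> (c \<odot>\<^bsub>W\<^esub> f x))"
        unfolding functional_def
        by (simp add: functional_smult[OF \<xi>] lin_mapsD(1)[OF f] vspaceD[OF V]
            functional_add[OF f\<xi>] functional_smult[OF f\<xi>] algebra_simps)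
    qed
  qed
next
  fix i assume "i \<in> {(x, \<xi>). x \<in> carrier V \<and> functional W \<xi>}"
  then obtain x \<xi> where i: "i = (x, \<xi>)" "x \<in> carrier V" and \<xi>: "functional W \<xi>" by auto
  show "functional (lin_space V W) ((\<lambda>(x, \<xi>) f. \<xi> (f x)) i)"
    unfolding functional_def
    by (simp add: i functional_add[OF \<xi>] functional_smult[OF \<xi>] lin_mapsD(1)[of _ V W])
  show "(\<lambda>(x, \<xi>) f. \<xi> (f x)) i (zero (lin_space V W)) = 0"
    using functional_zero[OF \<xi> separated_vspace[OF W]] i by simp
next
  fix f g assume "f \<in> carrier (lin_space V W)" "g \<in> carrier (lin_space V W)"
    and eq: "\<And>i. i \<in> {(x, \<xi>). x \<in> carrier V \<and> functional W \<xi>}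
      \<Longrightarrow> (\<lambda>(x, \<xi>) f. \<xi> (f x)) i f = (\<lambda>(x, \<xi>) f. \<xi> (f x)) i g"
  then have f: "f \<in> lin_maps V W" and g: "g \<in> lin_maps V W" by simp_all
  show "f = g"
  proof (rule lin_maps_eqI[OF f g])
    fix x assume x: "x \<in> carrier V"
    show "f x = g x"
    proof (rule separated_eqI[OF W lin_mapsD(1)[OF f x] lin_mapsD(1)[OF g x]])
      show "\<xi> (f x) = \<xi> (g x)" if "functional W \<xi>" for \<xi>
        using eq[of "(x, \<xi>)"] x that by simp
    qed
  qed
qed

lemma lin_maps_tensor_eqI:
  assumes V: "vspace V" "vspace W" and U: "vspace U"
    and L: "L \<in> lin_maps (tensor_space V W) U" and L': "L' \<in> lin_maps (tensor_space V W) U"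
    and eq: "\<And>v w. \<lbrakk>v \<in> carrier V; w \<in> carrier W\<rbrakk>
      \<Longrightarrow> L (pure_tensor V W v w) = L' (pure_tensor V W v w)"
  shows "L = L'"
proof (rule lin_maps_eqI[OF L L'])
  fix t assume "t \<in> carrier (tensor_space V W)"
  then show "L t = L' t"
  proof (induct t rule: tensor_induct)
    case zero
    show ?case
      using lin_maps_zero[OF L tensor_vspace[OF V] U] lin_maps_zero[OF L' tensor_vspace[OF V] U] by simp
  next
    case (snoc t v w)
    then show ?case
      using lin_mapsD(2)[OF L snoc(1) pure_closed[OF snoc(3,4)]]
        lin_mapsD(2)[OF L' snoc(1) pure_closed[OF snoc(3,4)]] eq by simp
  qed
qed

lemma lin_maps_comp:
  assumes V: "vspace V" and f: "f \<in> lin_maps V W" and g: "g \<in> lin_maps W X"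
  shows "compose (carrier V) g f \<in> lin_maps V X"
  by (rule lin_mapsI) (simp_all add: compose_def lin_mapsD[OF f] lin_mapsD[OF g] vspaceD[OF V])

lemma lin_isos_inverse:
  assumes W: "vspace W" and V: "vspace V" and f: "f \<in> lin_isos V W"
  shows "(\<lambda>w\<in>carrier W. inv_into (carrier V) f w) \<in> lin_maps W V"
proof -
  have lin: "f \<in> lin_maps V W" and bij: "bij_betw f (carrier V) (carrier W)"
    using f by (simp_all add: lin_isos_def)
  define g where "g = inv_into (carrier V) f"
  have g: "g w \<in> carrier V" "f (g w) = w" if "w \<in> carrier W" for w
    using that bij_betw_imp_surj_on[OF bij] unfolding g_def
    by (simp_all add: inv_into_into f_inv_into_f)
  have gf: "g (f v) = v" if "v \<in> carrier V" for v
    using that bij_betw_imp_inj_on[OF bij] unfolding g_def by simp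
  have "(\<lambda>w\<in>carrier W. g w) \<in> lin_maps W V"
  proof (rule lin_mapsI)
    show "(\<lambda>w\<in>carrier W. g w) (x \<oplus>\<^bsub>W\<^esub> y) = (\<lambda>w\<in>carrier W. g w) x \<oplus>\<^bsub>V\<^esub> (\<lambda>w\<in>carrier W. g w) y"
      if xy: "x \<in> carrier W" "y \<in> carrier W" for x y
      using gf[OF vspaceD(2)[OF V g(1)[OF xy(1)] g(1)[OF xy(2)]]] xy g(2) vspaceD(2)[OF W xy]
      by (simp add: lin_mapsD(2)[OF lin g(1)[OF xy(1)] g(1)[OF xy(2)]])
    show "(\<lambda>w\<in>carrier W. g w) (c \<odot>\<^bsub>W\<^esub> x) = c \<odot>\<^bsub>V\<^esub> (\<lambda>w\<in>carrier W. g w) x"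
      if x: "x \<in> carrier W" for c x
      using gf[OF vspaceD(3)[OF V g(1)[OF x], of c]] x g(2) vspaceD(3)[OF W x, of c]
      by (simp add: lin_mapsD(3)[OF lin g(1)[OF x]])
  qed (simp_all add: g)
  then show ?thesis by (simp add: g_def)
qed

section \<open>Exactness in the category of vector spaces\<close>

lemma Vec_simps:
  "Obj Vec = {V. vspace V \<and> finite_dimensional V}"
  "Dom Vec a = fst a" "Cod Vec a = snd (snd a)"
  "Id Vec V = (V, \<lambda>x\<in>carrier V. x, V)"
  "Comp Vec b a = (fst a, compose (carrier (fst a)) (vmap b) (vmap a), snd (snd b))"
  "ZeroA Vec V W = (V, \<lambda>x\<in>carrier V. \<zero>\<^bsub>W\<^esub>, W)"
  "AddA Vec a a' = (fst a, \<lambda>x\<in>carrier (fst a). vmap a x \<oplus>\<^bsub>snd (snd a)\<^esub> vmap a' x, snd (snd a))"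
  "ScaleA Vec c a = (fst a, \<lambda>x\<in>carrier (fst a). c \<odot>\<^bsub>snd (snd a)\<^esub> vmap a x, snd (snd a))"
  by (auto simp: Vec_def lin_space_def split: prod.splits)

lemma Vec_obj:
  assumes "V \<in> Obj Vec"
  shows "vspace V" "finitely_separated V" "separated V"
  using assms finite_dimensional_imp_finitely_separated finitely_separated_imp_separated
  by (auto simp: Vec_simps)

lemma Vec_hom_iff:
  "a \<in> Hom Vec V W \<longleftrightarrow> V \<in> Obj Vec \<and> W \<in> Obj Vec \<and> vmap a \<in> lin_maps V W \<and> a = (V, vmap a, W)"
  by (cases a) (auto simp: Hom_def Vec_def)

lemma Vec_homD:
  assumes "a \<in> Hom Vec V W"
  shows "vmap a \<in> lin_maps V W" "fst a = V" "snd (snd a) = W" "V \<in> Obj Vec" "W \<in> Obj Vec"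
  using assms unfolding Vec_hom_iff by (auto, metis fst_conv, metis snd_conv)

lemma Vec_homI:
  "\<lbrakk>V \<in> Obj Vec; W \<in> Obj Vec; f \<in> lin_maps V W\<rbrakk> \<Longrightarrow> (V, f, W) \<in> Hom Vec V W"
  by (simp add: Vec_hom_iff)

lemma Vec_hom_eqI:
  assumes a: "a \<in> Hom Vec V W" and b: "b \<in> Hom Vec V W"
    and eq: "\<And>x. x \<in> carrier V \<Longrightarrow> vmap a x = vmap b x"
  shows "a = b"
proof -
  have "vmap a = vmap b"
    using lin_mapsD(4)[OF Vec_homD(1)[OF a]] lin_mapsD(4)[OF Vec_homD(1)[OF b]] eq
    by (rule extensionalityI)
  then show ?thesis using a b unfolding Vec_hom_iff by metis
qed

lemma Vec_comp_apply:
  "\<lbrakk>a \<in> Hom Vec V W; x \<in> carrier V\<rbrakk> \<Longrightarrow> vmap (Comp Vec b a) x = vmap b (vmap a x)"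
  by (simp add: Vec_simps compose_def Vec_homD(2))

lemma Vec_comp_hom:
  assumes a: "a \<in> Hom Vec V W" and b: "b \<in> Hom Vec W X"
  shows "Comp Vec b a \<in> Hom Vec V X"
proof -
  note a' = Vec_homD[OF a] and b' = Vec_homD[OF b]
  have "compose (carrier V) (vmap b) (vmap a) \<in> lin_maps V X"
    by (rule lin_maps_comp[OF Vec_obj(1)[OF a'(4)] a'(1) b'(1)])
  then show ?thesis
    using a' b' by (simp add: Vec_hom_iff Vec_simps(5))
qed

lemma Vec_zero_hom:
  assumes V: "V \<in> Obj Vec" and W: "W \<in> Obj Vec"
  shows "ZeroA Vec V W \<in> Hom Vec V W"
proof -
  interpret W: module complex_ring W using W by (rule Vec_obj)
  have "(\<lambda>x\<in>carrier V. \<zero>\<^bsub>W\<^esub>) \<in> lin_maps V W"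
    by (rule lin_mapsI) (simp_all add: vspaceD[OF Vec_obj(1)[OF V]])
  then show ?thesis using V W by (simp add: Vec_hom_iff Vec_simps(6))
qed

text \<open>Endomorphisms of rank at most one serve as test arrows for universal properties in
  \<open>Vec\<close>. They live on spaces already at hand, so no line or quotient has to be realised
  in the carrier type.\<close>

lemma rank_one_lin_maps:
  assumes V: "vspace V" and W: "vspace W" and \<phi>: "functional V \<phi>" and w: "w \<in> carrier W"
  shows "(\<lambda>v\<in>carrier V. \<phi> v \<odot>\<^bsub>W\<^esub> w) \<in> lin_maps V W"
proof -
  interpret W: module complex_ring W by fact
  show ?thesis
    using W.smult_l_distr[of _ _ w] W.smult_assoc1[of _ _ w] w
    by (intro lin_mapsI) (simp_all add: vspaceD[OF V] functional_add[OF \<phi>] functional_smult[OF \<phi>])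
qed

text \<open>If \<open>\<phi> x = 1\<close>, the endomorphism sending \<open>v\<close> to
  \<open>\<phi> v\<close> times \<open>x\<close> is killed by \<open>f\<close>, so it factors
  through \<open>k\<close>; at \<open>x\<close> the factorisation yields a preimage. The zero vector
  admits no such \<open>\<phi>\<close> and is treated apart.\<close>

lemma Vec_kernel_exact:
  assumes k: "is_kernel Vec k f" and x: "x \<in> carrier (Dom Vec f)"
    and fx: "vmap f x = \<zero>\<^bsub>Cod Vec f\<^esub>"
  shows "\<exists>y\<in>carrier (Dom Vec k). vmap k y = x"
proof -
  define K where "K = Dom Vec k"
  define V where "V = Dom Vec f"
  define W where "W = Cod Vec f"
  have f: "f \<in> Hom Vec V W" and k': "k \<in> Hom Vec K V"
    using k by (auto simp: is_kernel_def Hom_def K_def V_def W_def)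
  note f' = Vec_homD[OF f] and kk = Vec_homD[OF k']
  note Vo = Vec_obj[OF f'(4)] and Wo = Vec_obj[OF f'(5)] and Ko = Vec_obj[OF kk(4)]
  have xV: "x \<in> carrier V" using x by (simp add: V_def)
  show ?thesis
  proof (cases "x = \<zero>\<^bsub>V\<^esub>")
    case True
    then show ?thesis
      using lin_maps_zero[OF kk(1) Ko(1) Vo(1)] vspaceD(1)[OF Ko(1)]
      by (intro bexI[of _ "\<zero>\<^bsub>K\<^esub>"]) (auto simp: K_def)
  next
    case False
    have "subspace_of V {\<zero>\<^bsub>V\<^esub>}"
    proof -
      interpret module complex_ring V by (rule Vo)
      show ?thesis by (auto simp: subspace_of_def)
    qed
    then obtain \<phi>0 where \<phi>0: "functional V \<phi>0" "\<phi>0 x \<noteq> 0"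
      using functional_vanishing_on[OF Vo(2) _ xV, of "{\<zero>\<^bsub>V\<^esub>}"] False by auto
    \<comment> \<open>This is \<open>\<phi>0\<close> divided by \<open>\<phi>0 x\<close>, written so
      that \<open>functional_combine\<close> applies.\<close>
    define \<phi> where "\<phi> v = \<phi>0 v - (1 - inverse (\<phi>0 x)) * \<phi>0 v" for v
    have \<phi>: "functional V \<phi>" unfolding \<phi>_def by (rule functional_combine[OF \<phi>0(1,1)])
    have \<phi>x: "\<phi> x = 1" using \<phi>0(2) by (simp add: \<phi>_def algebra_simps)
    define h where "h = (V, \<lambda>v\<in>carrier V. \<phi> v \<odot>\<^bsub>V\<^esub> x, V)"
    have h: "h \<in> Hom Vec V V"
      unfolding h_def by (intro Vec_homI f'(4) rank_one_lin_maps Vo(1) \<phi> xV)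
    have "Comp Vec f h = ZeroA Vec V W"
    proof (rule Vec_hom_eqI[OF Vec_comp_hom[OF h f] Vec_zero_hom[OF f'(4,5)]])
      fix v assume v: "v \<in> carrier V"
      interpret W: module complex_ring W by (rule Wo)
      show "vmap (Comp Vec f h) v = vmap (ZeroA Vec V W) v"
        using v fx unfolding Vec_comp_apply[OF h v]
        by (simp add: h_def lin_mapsD(3)[OF f'(1) xV] W_def[symmetric] Vec_simps(6))
    qed
    then have "\<exists>u. u \<in> Hom Vec V K \<and> Comp Vec k u = h"
      using k h unfolding is_kernel_def K_def[symmetric] V_def[symmetric] W_def[symmetric] by blast
    then obtain u where u: "u \<in> Hom Vec V K" "Comp Vec k u = h" by blast
    have "vmap k (vmap u x) = x"
      using Vec_comp_apply[OF u(1) xV, of k] xV \<phi>x vspaceD(5)[OF Vo(1) xV]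
      unfolding u(2) by (simp add: h_def)
    then show ?thesis
      using lin_mapsD(1)[OF Vec_homD(1)[OF u(1)] xV] by (intro bexI[of _ "vmap u x"]) (auto simp: K_def)
  qed
qed

lemma lin_maps_image_subspace:
  assumes f: "f \<in> lin_maps V W" and V: "vspace V" and W: "vspace W"
  shows "subspace_of W (f ` carrier V)"
  unfolding subspace_of_def
proof (intro conjI allI ballI)
  show "f ` carrier V \<subseteq> carrier W" using lin_mapsD(1)[OF f] by auto
  show "\<zero>\<^bsub>W\<^esub> \<in> f ` carrier V"
    using lin_maps_zero[OF f V W] vspaceD(1)[OF V] by (metis imageI)
  show "u \<oplus>\<^bsub>W\<^esub> v \<in> f ` carrier V" if "u \<in> f ` carrier V" "v \<in> f ` carrier V" for u v
    using that by (auto simp: lin_mapsD(2)[OF f, symmetric] vspaceD[OF V])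
  show "c \<odot>\<^bsub>W\<^esub> v \<in> f ` carrier V" if "v \<in> f ` carrier V" for c v
    using that by (auto simp: lin_mapsD(3)[OF f, symmetric] vspaceD[OF V])
qed

text \<open>If \<open>w\<close> is not in the image, take \<open>\<chi>\<close> vanishing on the
  image with \<open>\<chi> w \<noteq> 0\<close>. The endomorphism sending \<open>v\<close> to
  \<open>\<chi> v\<close> times \<open>w\<close> and the zero map both become zero after
  \<open>q\<close>, so they are equal. But \<open>\<chi>\<close> takes the value
  \<open>\<chi> w * \<chi> w\<close> on the image of \<open>w\<close>.\<close>

lemma Vec_cokernel_surj:
  assumes q: "is_cokernel Vec q f" and w: "w \<in> carrier (Cod Vec q)"
  shows "\<exists>v\<in>carrier (Dom Vec q). vmap q v = w"
proof (rule ccontr)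
  assume no: "\<not> ?thesis"
  define V where "V = Dom Vec q"
  define W where "W = Cod Vec q"
  define A where "A = Dom Vec f"
  have q': "q \<in> Hom Vec V W" and f: "f \<in> Hom Vec A V"
    using q by (auto simp: is_cokernel_def Hom_def V_def W_def A_def)
  note qq = Vec_homD[OF q'] and ff = Vec_homD[OF f]
  note Vo = Vec_obj[OF qq(4)] and Wo = Vec_obj[OF qq(5)]
  have wW: "w \<in> carrier W" using w by (simp add: W_def)
  have nw: "w \<notin> vmap q ` carrier V" using no by (auto simp: V_def)
  obtain \<chi> where \<chi>: "functional W \<chi>" "\<forall>v\<in>vmap q ` carrier V. \<chi> v = 0" "\<chi> w \<noteq> 0"
    using functional_vanishing_on[OF Wo(2) lin_maps_image_subspace[OF qq(1) Vo(1) Wo(1)] wW nw]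
    by (elim exE conjE)
  define h where "h = (W, \<lambda>v\<in>carrier W. \<chi> v \<odot>\<^bsub>W\<^esub> w, W)"
  have h: "h \<in> Hom Vec W W"
    unfolding h_def by (intro Vec_homI qq(5) rank_one_lin_maps Wo(1) \<chi>(1) wW)
  have z: "ZeroA Vec X Y \<in> Hom Vec X Y" if "X \<in> Obj Vec" "Y \<in> Obj Vec" for X Y :: "'a vobj"
    using that by (rule Vec_zero_hom)
  have hq: "Comp Vec h q = ZeroA Vec V W"
  proof (rule Vec_hom_eqI[OF Vec_comp_hom[OF q' h] z[OF qq(4,5)]])
    fix v assume v: "v \<in> carrier V"
    show "vmap (Comp Vec h q) v = vmap (ZeroA Vec V W) v"
      using v \<chi>(2) lin_mapsD(1)[OF qq(1) v] unfolding Vec_comp_apply[OF q' v]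
      by (simp add: h_def vspaceD(4)[OF Wo(1) wW] Vec_simps(6))
  qed
  have zq: "Comp Vec (ZeroA Vec W W) q = ZeroA Vec V W"
  proof (rule Vec_hom_eqI[OF Vec_comp_hom[OF q' z[OF qq(5,5)]] z[OF qq(4,5)]])
    fix v assume v: "v \<in> carrier V"
    show "vmap (Comp Vec (ZeroA Vec W W) q) v = vmap (ZeroA Vec V W) v"
      using v lin_mapsD(1)[OF qq(1) v] unfolding Vec_comp_apply[OF q' v] by (simp add: Vec_simps(6))
  qed
  have zf: "Comp Vec (ZeroA Vec V W) f = ZeroA Vec A W"
  proof (rule Vec_hom_eqI[OF Vec_comp_hom[OF f z[OF qq(4,5)]] z[OF ff(4) qq(5)]])
    fix v assume v: "v \<in> carrier A"
    show "vmap (Comp Vec (ZeroA Vec V W) f) v = vmap (ZeroA Vec A W) v"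
      using v lin_mapsD(1)[OF ff(1) v] unfolding Vec_comp_apply[OF f v] by (simp add: Vec_simps(6))
  qed
  have "Cod Vec f = V" using ff(3) by (simp add: Vec_simps)
  then have "\<exists>!u. u \<in> Hom Vec W W \<and> Comp Vec u q = ZeroA Vec V W"
    using q z[OF qq(4,5)] zf unfolding is_cokernel_def A_def[symmetric] W_def[symmetric] by blast
  then have "h = ZeroA Vec W W" using h hq zq z[OF qq(5,5)] by blast
  then have "vmap h w = \<zero>\<^bsub>W\<^esub>" using wW by (simp add: Vec_simps(6))
  then have *: "\<chi> w \<odot>\<^bsub>W\<^esub> w = \<zero>\<^bsub>W\<^esub>" using wW by (simp add: h_def)
  have "\<chi> w * \<chi> w = \<chi> \<zero>\<^bsub>W\<^esub>"
    unfolding functional_smult[OF \<chi>(1) wW, symmetric] * ..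
  then show False using functional_zero[OF \<chi>(1) Wo(1)] \<chi>(3) by simp
qed


section \<open>Abelian categories with finitely many simple objects\<close>

context linear_category
begin

lemma hom_objs: "f \<in> Hom C X Y \<Longrightarrow> X \<in> Obj C \<and> Y \<in> Obj C"
  by (auto simp: Hom_def dom_obj cod_obj)

lemma zero_hom: "\<lbrakk>X \<in> Obj C; Y \<in> Obj C\<rbrakk> \<Longrightarrow> ZeroA C X Y \<in> Hom C X Y"
  using vspaceD(1)[OF hom_module] by (simp add: hom_space_def)

lemma scale_zero: "f \<in> Hom C X Y \<Longrightarrow> ScaleA C 0 f = ZeroA C X Y"
  using vspaceD(4)[OF hom_module[of X Y], of f] hom_objs[of f X Y] by (simp add: hom_space_def)

lemma zero_comp:
  assumes "u \<in> Hom C W X" "Y \<in> Obj C"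
  shows "ZeroA C X Y \<cdot> u = ZeroA C W Y"
proof -
  have z: "ZeroA C X Y \<in> Hom C X Y" using assms hom_objs zero_hom by blast
  show ?thesis
    using comp_scale_left[OF assms(1) z, of 0] scale_zero[OF z] scale_zero[OF comp_hom[OF assms(1) z]]
    by simp
qed

lemma comp_zero:
  assumes "u \<in> Hom C X Y" "W \<in> Obj C"
  shows "u \<cdot> ZeroA C W X = ZeroA C W Y"
proof -
  have z: "ZeroA C W X \<in> Hom C W X" using assms hom_objs zero_hom by blast
  show ?thesis
    using comp_scale_right[OF z assms(1), of 0] scale_zero[OF z] scale_zero[OF comp_hom[OF z assms(1)]]
    by simp
qed

lemma cokernel_epi:
  assumes "is_cokernel C q f"
  shows "is_epi C q"
  unfolding is_epi_def
proof (intro conjI allI ballI impI)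
  have q: "q \<in> Hom C (Cod C f) (Cod C q)" and f: "f \<in> Hom C (Dom C f) (Cod C f)"
    and qf: "q \<cdot> f = ZeroA C (Dom C f) (Cod C q)"
    using assms by (auto simp: is_cokernel_def Hom_def)
  show "q \<in> Arr C" using assms by (simp add: is_cokernel_def)
  fix X u v
  assume u: "u \<in> Hom C (Cod C q) X" and v: "v \<in> Hom C (Cod C q) X" and eq: "u \<cdot> q = v \<cdot> q"
  have "(u \<cdot> q) \<cdot> f = ZeroA C (Dom C f) X"
    unfolding comp_assoc[OF f q u] qf using comp_zero[OF u] hom_objs[OF f] by simp
  then have "\<exists>!w. w \<in> Hom C (Cod C q) X \<and> w \<cdot> q = u \<cdot> q"
    using assms comp_hom[OF q u] unfolding is_cokernel_def by blast
  then show "u = v" using u v eq by auto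
qed

end

context abelian_category
begin

text \<open>By normality \<open>e\<close> is the cokernel of some \<open>f\<close>. As
  \<open>f\<close> factors through the kernel \<open>k\<close> of \<open>e\<close>, an arrow that
  kills \<open>k\<close> also kills \<open>f\<close>, so \<open>e\<close> is a cokernel of
  \<open>k\<close> as well.\<close>

lemma epi_short_exact:
  assumes "is_epi C e"
  shows "\<exists>k. short_exact C k e"
proof -
  obtain f where f: "is_cokernel C e f" using epi_normal[OF assms] by blast
  obtain k where k: "is_kernel C k e" using kernels[of e] assms by (auto simp: is_epi_def)
  have e': "e \<in> Hom C (Cod C f) (Cod C e)" and f': "f \<in> Hom C (Dom C f) (Dom C e)"
    and ef: "e \<cdot> f = ZeroA C (Dom C f) (Cod C e)" and cod: "Cod C k = Cod C f"
    and k': "k \<in> Hom C (Dom C k) (Cod C f)"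
    using f k by (auto simp: is_cokernel_def is_kernel_def Hom_def)
  obtain u where u: "u \<in> Hom C (Dom C f) (Dom C k)" "k \<cdot> u = f"
    using k f' ef unfolding is_kernel_def by blast
  have "is_cokernel C e k"
    unfolding is_cokernel_def
  proof (intro conjI allI ballI impI)
    show "e \<in> Arr C" "k \<in> Arr C" "Dom C e = Cod C k" "e \<cdot> k = ZeroA C (Dom C k) (Cod C e)"
      using k by (auto simp: is_kernel_def)
    fix X h assume h: "h \<in> Hom C (Cod C k) X" and hk: "h \<cdot> k = ZeroA C (Dom C k) X"
    have h': "h \<in> Hom C (Cod C f) X" using h cod by simp
    have "h \<cdot> f = ZeroA C (Dom C f) X"
      using comp_assoc[OF u(1) k' h'] zero_comp[OF u(1)] hom_objs[OF h'] hk u(2) by simp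
    then show "\<exists>!u. u \<in> Hom C (Cod C e) X \<and> u \<cdot> e = h"
      using f h' unfolding is_cokernel_def by blast
  qed
  with k show ?thesis unfolding short_exact_def by blast
qed

end

text \<open>One projective for each isomorphism class is enough: its epimorphism onto the
  representative is followed by an isomorphism to the given simple object. Minimality of the covers
  is not claimed.\<close>

lemma (in finite_abelian_category) projective_covers_of_simples:
  "\<exists>T. finite T \<and> T \<subseteq> Obj C \<and>
     (\<forall>X. simple_obj C X \<longrightarrow> (\<exists>P\<in>T. projective_obj C P \<and> (\<exists>e\<in>Hom C P X. is_epi C e)))"
proof -
  obtain S where S: "finite S" "\<And>X. simple_obj C X \<Longrightarrow> \<exists>Y\<in>S. isomorphic C X Y"
    using finitely_many_simples by blast
  obtain e where e: "\<And>Y. Y \<in> Obj C \<Longrightarrow> is_epi C (e Y) \<and> projective_obj C (Dom C (e Y)) \<and> Cod C (e Y) = Y"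
    using enough_projectives by metis
  \<comment> \<open>The finite set \<open>S\<close> of representatives may contain elements that are
    not objects, hence the intersection.\<close>
  define T where "T = (\<lambda>Y. Dom C (e Y)) ` (S \<inter> Obj C)"
  have "\<exists>P\<in>T. projective_obj C P \<and> (\<exists>d\<in>Hom C P X. is_epi C d)" if X: "simple_obj C X" for X
  proof -
    obtain Y h where Y: "Y \<in> S" "h \<in> Hom C X Y" "is_iso_arr C h"
      using S(2)[OF X] by (auto simp: isomorphic_def)
    then obtain g where g: "g \<in> Hom C Y X" "g \<cdot> h = Id C X" "h \<cdot> g = Id C Y"
      by (auto simp: is_iso_arr_def inverse_arrows_def Hom_def)
    have YO: "Y \<in> Obj C" using hom_objs[OF Y(2)] by simp
    note eY = e[OF YO]
    define P where "P = Dom C (e Y)"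
    have eh: "e Y \<in> Hom C P Y" using eY by (auto simp: is_epi_def Hom_def P_def)
    have canc: "f = f'" if "f \<in> Hom C Y Z" "f' \<in> Hom C Y Z" "f \<cdot> e Y = f' \<cdot> e Y" for Z f f'
      using eY that unfolding is_epi_def by auto
    have cX: "Cod C (g \<cdot> e Y) = X" "g \<cdot> e Y \<in> Arr C" using comp_hom[OF eh g(1)] by (auto simp: Hom_def)
    have "is_epi C (g \<cdot> e Y)"
      unfolding is_epi_def cX(1)
    proof (intro conjI cX(2) allI ballI impI)
      fix Z u v assume u: "u \<in> Hom C X Z" and v: "v \<in> Hom C X Z"
        and eq: "u \<cdot> g \<cdot> e Y = v \<cdot> g \<cdot> e Y"
      have "(u \<cdot> g) \<cdot> e Y = (v \<cdot> g) \<cdot> e Y"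
        unfolding comp_assoc[OF eh g(1) u] comp_assoc[OF eh g(1) v] by (rule eq)
      then have "u \<cdot> g = v \<cdot> g"
        by (rule canc[OF comp_hom[OF g(1) u] comp_hom[OF g(1) v]])
      then have "u \<cdot> (g \<cdot> h) = v \<cdot> (g \<cdot> h)"
        unfolding comp_assoc[OF Y(2) g(1) u, symmetric] comp_assoc[OF Y(2) g(1) v, symmetric] by simp
      then show "u = v" using g(2) comp_id_right u v by simp
    qed
    moreover have "P \<in> T" using Y(1) YO by (simp add: T_def P_def)
    ultimately show ?thesis using eY comp_hom[OF eh g(1)] P_def by blast
  qed
  moreover have "finite T" "T \<subseteq> Obj C"
    using S(1) e by (auto simp: T_def is_epi_def dom_obj)
  ultimately show ?thesis by blast
qed

section \<open>Natural endomorphisms of an exact functor to vector spaces\<close>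

locale exact_vec_functor = finite_abelian_category C + exact_faithful_functor C Vec F
  for C :: "('o, 'm, 'x) lcat_scheme" and F :: "('o, 'm, 'v vobj, 'v varr, 'z) fnctr_scheme"
begin

abbreviation "E \<equiv> End_alg C Vec F"

lemma F_vec:
  assumes "X \<in> Obj C"
  shows "vspace (FObj F X)" "finitely_separated (FObj F X)" "separated (FObj F X)"
  using Vec_obj[OF F_obj[OF assms]] by auto

lemma F_lin: "f \<in> Hom C X Y \<Longrightarrow> vmap (FArr F f) \<in> lin_maps (FObj F X) (FObj F Y)"
  using Vec_homD(1)[OF F_hom] .

lemma F_closed: "\<lbrakk>f \<in> Hom C X Y; x \<in> carrier (FObj F X)\<rbrakk> \<Longrightarrow> vmap (FArr F f) x \<in> carrier (FObj F Y)"
  using lin_mapsD(1)[OF F_lin] .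

lemma F_comp_apply:
  assumes "f \<in> Hom C X Y" "g \<in> Hom C Y Z" "x \<in> carrier (FObj F X)"
  shows "vmap (FArr F (g \<cdot>\<^bsub>C\<^esub> f)) x = vmap (FArr F g) (vmap (FArr F f) x)"
  unfolding F_comp[OF assms(1,2)] by (rule Vec_comp_apply[OF F_hom[OF assms(1)] assms(3)])

lemma F_id_apply: "\<lbrakk>X \<in> Obj C; x \<in> carrier (FObj F X)\<rbrakk> \<Longrightarrow> vmap (FArr F (Id C X)) x = x"
  by (simp add: F_id Vec_simps(4))

lemma E_simps:
  "zero E = (\<lambda>X\<in>Obj C. ZeroA Vec (FObj F X) (FObj F X))"
  "add E a b = (\<lambda>X\<in>Obj C. AddA Vec (a X) (b X))"
  "smult E c a = (\<lambda>X\<in>Obj C. ScaleA Vec c (a X))"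
  "mult E a b = (\<lambda>X\<in>Obj C. Comp Vec (a X) (b X))"
  "one E = (\<lambda>X\<in>Obj C. Id Vec (FObj F X))"
  by (simp_all add: End_alg_def)

lemma E_hom: "\<lbrakk>a \<in> carrier E; X \<in> Obj C\<rbrakk> \<Longrightarrow> a X \<in> Hom Vec (FObj F X) (FObj F X)"
  by (auto simp: End_alg_def)

lemma E_lin: "\<lbrakk>a \<in> carrier E; X \<in> Obj C\<rbrakk> \<Longrightarrow> vmap (a X) \<in> lin_maps (FObj F X) (FObj F X)"
  using Vec_homD(1)[OF E_hom] .

lemma E_natural:
  assumes a: "a \<in> carrier E" and f: "f \<in> Hom C X Y" and x: "x \<in> carrier (FObj F X)"
  shows "vmap (a Y) (vmap (FArr F f) x) = vmap (FArr F f) (vmap (a X) x)"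
proof -
  have f': "f \<in> Arr C" "Dom C f = X" "Cod C f = Y" using f by (auto simp: Hom_def)
  have "a Y \<cdot>\<^bsub>Vec\<^esub> FArr F f = FArr F f \<cdot>\<^bsub>Vec\<^esub> a X"
    using a f' unfolding End_alg_def by auto
  then have "vmap (a Y \<cdot>\<^bsub>Vec\<^esub> FArr F f) x = vmap (FArr F f \<cdot>\<^bsub>Vec\<^esub> a X) x" by simp
  then show ?thesis
    using Vec_comp_apply[OF F_hom[OF f] x] Vec_comp_apply[OF E_hom[OF a] x] hom_objs[OF f] by simp
qed

lemma E_intro:
  assumes m: "\<And>X. X \<in> Obj C \<Longrightarrow> m X \<in> lin_maps (FObj F X) (FObj F X)"
    and nat: "\<And>X Y f x. \<lbrakk>f \<in> Hom C X Y; x \<in> carrier (FObj F X)\<rbrakk>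
      \<Longrightarrow> m Y (vmap (FArr F f) x) = vmap (FArr F f) (m X x)"
  shows "(\<lambda>X\<in>Obj C. (FObj F X, m X, FObj F X)) \<in> carrier E" (is "?a \<in> _")
proof -
  have hom: "?a X \<in> Hom Vec (FObj F X) (FObj F X)" if "X \<in> Obj C" for X
    using that by (simp add: Vec_homI F_obj m)
  have "?a (Cod C f) \<cdot>\<^bsub>Vec\<^esub> FArr F f = FArr F f \<cdot>\<^bsub>Vec\<^esub> ?a (Dom C f)" if f: "f \<in> Arr C" for f
  proof -
    define X Y where "X = Dom C f" and "Y = Cod C f"
    have fh: "f \<in> Hom C X Y" using f by (simp add: Hom_def X_def Y_def)
    have XY: "X \<in> Obj C" "Y \<in> Obj C" using hom_objs[OF fh] by auto
    have "?a Y \<cdot>\<^bsub>Vec\<^esub> FArr F f = FArr F f \<cdot>\<^bsub>Vec\<^esub> ?a X"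
    proof (rule Vec_hom_eqI[OF Vec_comp_hom[OF F_hom[OF fh] hom[OF XY(2)]]
          Vec_comp_hom[OF hom[OF XY(1)] F_hom[OF fh]]])
      fix x assume x: "x \<in> carrier (FObj F X)"
      show "vmap (?a Y \<cdot>\<^bsub>Vec\<^esub> FArr F f) x = vmap (FArr F f \<cdot>\<^bsub>Vec\<^esub> ?a X) x"
        unfolding Vec_comp_apply[OF F_hom[OF fh] x] Vec_comp_apply[OF hom[OF XY(1)] x]
        using XY nat[OF fh x] by simp
    qed
    then show ?thesis by (simp add: X_def Y_def)
  qed
  then show ?thesis using hom unfolding End_alg_def by auto
qed

lemma E_eqI:
  assumes a: "a \<in> carrier E" and b: "b \<in> carrier E"
    and eq: "\<And>X x. \<lbrakk>X \<in> Obj C; x \<in> carrier (FObj F X)\<rbrakk> \<Longrightarrow> vmap (a X) x = vmap (b X) x"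
  shows "a = b"
proof (rule extensionalityI[of _ "Obj C"])
  show "a \<in> extensional (Obj C)" "b \<in> extensional (Obj C)"
    using a b by (auto simp: End_alg_def PiE_iff)
  show "a X = b X" if "X \<in> Obj C" for X
    by (rule Vec_hom_eqI[OF E_hom[OF a that] E_hom[OF b that] eq[OF that]])
qed

lemma E_apply:
  assumes "X \<in> Obj C" "x \<in> carrier (FObj F X)"
  shows "vmap (\<zero>\<^bsub>E\<^esub> X) x = \<zero>\<^bsub>FObj F X\<^esub>"
    and "\<And>a b. \<lbrakk>a \<in> carrier E; b \<in> carrier E\<rbrakk>
      \<Longrightarrow> vmap ((a \<oplus>\<^bsub>E\<^esub> b) X) x = vmap (a X) x \<oplus>\<^bsub>FObj F X\<^esub> vmap (b X) x"
    and "\<And>a c. a \<in> carrier E \<Longrightarrow> vmap ((c \<odot>\<^bsub>E\<^esub> a) X) x = c \<odot>\<^bsub>FObj F X\<^esub> vmap (a X) x"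
  using assms by (simp_all add: E_simps Vec_simps(6-8) Vec_homD[OF E_hom])

text \<open>A matrix coefficient is linear in the endomorphism; this links functionals on single
  spaces \<open>F X\<close> to functionals on \<open>E\<close>.\<close>

lemma functional_component:
  assumes X: "X \<in> Obj C" "x \<in> carrier (FObj F X)" and \<xi>: "functional (FObj F X) \<xi>"
  shows "functional E (\<lambda>a. \<xi> (vmap (a X) x))"
  unfolding functional_def
  using lin_mapsD(1)[OF E_lin[OF _ X(1)] X(2)]
  by (simp add: E_apply[OF X] functional_add[OF \<xi>] functional_smult[OF \<xi>])

lemma E_zero_closed: "\<zero>\<^bsub>E\<^esub> \<in> carrier E"
proof -
  have "\<zero>\<^bsub>E\<^esub> = (\<lambda>X\<in>Obj C. (FObj F X, \<lambda>x\<in>carrier (FObj F X). \<zero>\<^bsub>FObj F X\<^esub>, FObj F X))"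
    by (auto simp: E_simps Vec_simps(6) fun_eq_iff)
  moreover have "\<dots> \<in> carrier E"
  proof (rule E_intro)
    show "(\<lambda>x\<in>carrier (FObj F X). \<zero>\<^bsub>FObj F X\<^esub>) \<in> lin_maps (FObj F X) (FObj F X)" if "X \<in> Obj C" for X
      using Vec_homD(1)[OF Vec_zero_hom[OF F_obj[OF that] F_obj[OF that]]] by (simp add: Vec_simps(6))
  next
    fix X Y f x assume f: "f \<in> Hom C X Y" and x: "x \<in> carrier (FObj F X)"
    show "(\<lambda>x\<in>carrier (FObj F Y). \<zero>\<^bsub>FObj F Y\<^esub>) (vmap (FArr F f) x) =
        vmap (FArr F f) ((\<lambda>x\<in>carrier (FObj F X). \<zero>\<^bsub>FObj F X\<^esub>) x)"
      using x F_closed[OF f x] lin_maps_zero[OF F_lin[OF f]] F_vec(1) hom_objs[OF f] by simp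
  qed
  ultimately show ?thesis by simp
qed

lemma E_lin_space: "X \<in> Obj C \<Longrightarrow> vspace (lin_space (FObj F X) (FObj F X))"
  by (intro separated_vspace lin_space_separated F_vec)

lemma E_add_closed:
  assumes a: "a \<in> carrier E" and b: "b \<in> carrier E"
  shows "a \<oplus>\<^bsub>E\<^esub> b \<in> carrier E"
proof -
  define s where "s X = (\<lambda>x\<in>carrier (FObj F X). vmap (a X) x \<oplus>\<^bsub>FObj F X\<^esub> vmap (b X) x)" for X
  have "a \<oplus>\<^bsub>E\<^esub> b = (\<lambda>X\<in>Obj C. (FObj F X, s X, FObj F X))"
    using Vec_homD(2,3)[OF E_hom[OF a]] by (auto simp: E_simps Vec_simps(7) fun_eq_iff s_def)
  moreover have "\<dots> \<in> carrier E"
  proof (rule E_intro)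
    show "s X \<in> lin_maps (FObj F X) (FObj F X)" if X: "X \<in> Obj C" for X
      using vspaceD(2)[OF E_lin_space[OF X], unfolded lin_space_simps, OF E_lin[OF a X] E_lin[OF b X]]
      by (simp add: s_def)
  next
    fix X Y f x assume f: "f \<in> Hom C X Y" and x: "x \<in> carrier (FObj F X)"
    have X: "X \<in> Obj C" using hom_objs[OF f] by simp
    show "s Y (vmap (FArr F f) x) = vmap (FArr F f) (s X x)"
      using x F_closed[OF f x] lin_mapsD(1)[OF E_lin[OF a X] x] lin_mapsD(1)[OF E_lin[OF b X] x]
      by (simp add: s_def E_natural[OF a f x] E_natural[OF b f x] lin_mapsD(2)[OF F_lin[OF f]])
  qed
  ultimately show ?thesis by simp
qed

lemma E_smult_closed:
  assumes a: "a \<in> carrier E"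
  shows "c \<odot>\<^bsub>E\<^esub> a \<in> carrier E"
proof -
  define s where "s X = (\<lambda>x\<in>carrier (FObj F X). c \<odot>\<^bsub>FObj F X\<^esub> vmap (a X) x)" for X
  have "c \<odot>\<^bsub>E\<^esub> a = (\<lambda>X\<in>Obj C. (FObj F X, s X, FObj F X))"
    using Vec_homD(2,3)[OF E_hom[OF a]] by (auto simp: E_simps Vec_simps(8) fun_eq_iff s_def)
  moreover have "\<dots> \<in> carrier E"
  proof (rule E_intro)
    show "s X \<in> lin_maps (FObj F X) (FObj F X)" if X: "X \<in> Obj C" for X
      using vspaceD(3)[OF E_lin_space[OF X], unfolded lin_space_simps, OF E_lin[OF a X], of c]
      by (simp add: s_def)
  next
    fix X Y f x assume f: "f \<in> Hom C X Y" and x: "x \<in> carrier (FObj F X)"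
    have X: "X \<in> Obj C" using hom_objs[OF f] by simp
    show "s Y (vmap (FArr F f) x) = vmap (FArr F f) (s X x)"
      using x F_closed[OF f x] lin_mapsD(1)[OF E_lin[OF a X] x]
      by (simp add: s_def E_natural[OF a f x] lin_mapsD(3)[OF F_lin[OF f]])
  qed
  ultimately show ?thesis by simp
qed

lemma E_eqI_functionals:
  assumes a: "a \<in> carrier E" and b: "b \<in> carrier E"
    and eq: "\<And>X x \<xi>. \<lbrakk>X \<in> Obj C; x \<in> carrier (FObj F X); functional (FObj F X) \<xi>\<rbrakk>
      \<Longrightarrow> \<xi> (vmap (a X) x) = \<xi> (vmap (b X) x)"
  shows "a = b"
proof (rule E_eqI[OF a b])
  fix X x assume X: "X \<in> Obj C" and x: "x \<in> carrier (FObj F X)"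
  show "vmap (a X) x = vmap (b X) x"
    by (rule separated_eqI[OF F_vec(3)[OF X] lin_mapsD(1)[OF E_lin[OF a X] x]
          lin_mapsD(1)[OF E_lin[OF b X] x] eq[OF X x]])
qed

lemma E_separated: "separated E"
proof (rule separatedI[of _ "{(X, x, \<xi>). X \<in> Obj C \<and> x \<in> carrier (FObj F X) \<and> functional (FObj F X) \<xi>}"
      "\<lambda>(X, x, \<xi>) a. \<xi> (vmap (a X) x)"])
  fix i
  assume "i \<in> {(X, x, \<xi>). X \<in> Obj C \<and> x \<in> carrier (FObj F X) \<and> functional (FObj F X) \<xi>}"
  then obtain X x \<xi> where i: "i = (X, x, \<xi>)" "X \<in> Obj C" "x \<in> carrier (FObj F X)"
      "functional (FObj F X) \<xi>" by auto
  show "functional E ((\<lambda>(X, x, \<xi>) a. \<xi> (vmap (a X) x)) i)"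
    using functional_component[OF i(2-4)] by (simp add: i(1))
  show "(\<lambda>(X, x, \<xi>) a. \<xi> (vmap (a X) x)) i \<zero>\<^bsub>E\<^esub> = 0"
    using functional_zero[OF i(4) F_vec(1)[OF i(2)]] by (simp add: i(1) E_apply(1)[OF i(2,3)])
next
  fix a b assume a: "a \<in> carrier E" and b: "b \<in> carrier E"
    and eq: "\<And>i. i \<in> {(X, x, \<xi>). X \<in> Obj C \<and> x \<in> carrier (FObj F X) \<and> functional (FObj F X) \<xi>}
      \<Longrightarrow> (\<lambda>(X, x, \<xi>) a. \<xi> (vmap (a X) x)) i a = (\<lambda>(X, x, \<xi>) a. \<xi> (vmap (a X) x)) i b"
  show "a = b"
  proof (rule E_eqI_functionals[OF a b])
    show "\<xi> (vmap (a X) x) = \<xi> (vmap (b X) x)"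
      if "X \<in> Obj C" "x \<in> carrier (FObj F X)" "functional (FObj F X) \<xi>" for X x \<xi>
      using eq[of "(X, x, \<xi>)"] that by simp
  qed
qed (rule E_zero_closed E_add_closed E_smult_closed; assumption)+

lemma E_vspace: "vspace E"
  by (rule separated_vspace[OF E_separated])

text \<open>Exactness of \<open>F\<close> speaks of short exact sequences, so the epimorphism is
  first completed to one by its kernel.\<close>

lemma F_epi_surj:
  assumes "is_epi C e" and w: "w \<in> carrier (FObj F (Cod C e))"
  shows "\<exists>v\<in>carrier (FObj F (Dom C e)). vmap (FArr F e) v = w"
proof -
  obtain k where k: "short_exact C k e" using epi_short_exact[OF assms(1)] by blast
  have coker: "is_cokernel Vec (FArr F e) (FArr F k)" using F_exact[OF k] by (simp add: short_exact_def)
  have "e \<in> Hom C (Dom C e) (Cod C e)" using assms(1) by (auto simp: is_epi_def Hom_def)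
  note Fe = Vec_homD(2,3)[OF F_hom[OF this]]
  show ?thesis using Vec_cokernel_surj[OF coker] w by (simp add: Vec_simps(2,3) Fe)
qed

lemma F_exact_apply:
  assumes fg: "short_exact C f g" and x: "x \<in> carrier (FObj F (Dom C g))"
    and 0: "vmap (FArr F g) x = \<zero>\<^bsub>FObj F (Cod C g)\<^esub>"
  shows "\<exists>y\<in>carrier (FObj F (Dom C f)). vmap (FArr F f) y = x"
proof -
  have ker: "is_kernel Vec (FArr F f) (FArr F g)" using F_exact[OF fg] by (simp add: short_exact_def)
  have "f \<in> Hom C (Dom C f) (Cod C f)" "g \<in> Hom C (Dom C g) (Cod C g)"
    using fg by (auto simp: short_exact_def is_kernel_def Hom_def)
  note F = Vec_homD(2,3)[OF F_hom[OF this(1)]] Vec_homD(2,3)[OF F_hom[OF this(2)]]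
  show ?thesis using Vec_kernel_exact[OF ker] x 0 by (simp add: Vec_simps(2,3) F)
qed

text \<open>On a zero object the identity equals 0 times the identity, and the linear functor
  \<open>F\<close> carries this equation to \<open>F X\<close>.\<close>

lemma F_zero_obj:
  assumes X: "is_zero_obj C X" and x: "x \<in> carrier (FObj F X)"
  shows "x = \<zero>\<^bsub>FObj F X\<^esub>"
proof -
  have XO: "X \<in> Obj C" using X by (simp add: is_zero_obj_def)
  have "Id C X = ZeroA C X X"
    using X XO id_hom[OF XO] zero_hom[OF XO XO] unfolding is_zero_obj_def by blast
  also have "\<dots> = ScaleA C 0 (Id C X)" using scale_zero[OF id_hom[OF XO]] by simp
  finally have "FArr F (Id C X) = ScaleA Vec 0 (FArr F (Id C X))"
    using F_scale[of "Id C X" 0] id_hom[OF XO] by (simp add: Hom_def)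
  then have "vmap (FArr F (Id C X)) x = vmap (ScaleA Vec 0 (FArr F (Id C X))) x" by simp
  then show ?thesis
    using x vspaceD(4)[OF F_vec(1)[OF XO] x] F_id_apply[OF XO x] Vec_homD(2,3)[OF F_hom[OF id_hom[OF XO]]]
    by (simp add: Vec_simps(8))
qed

text \<open>Induction on length along a short exact sequence from \<open>A\<close> through
  \<open>X\<close> to a simple \<open>S\<close>. Let \<open>e\<close> be an epimorphism from
  \<open>P\<close> in \<open>T\<close> onto \<open>S\<close>, and lift it to \<open>l\<close> from
  \<open>P\<close> to \<open>X\<close>. Choose \<open>p\<close> whose image under \<open>e\<close>
  is the image of \<open>x\<close> in \<open>F S\<close>. Then \<open>x\<close> minus the image of
  \<open>p\<close> under \<open>l\<close> comes from \<open>F A\<close>, and by naturality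
  \<open>a\<close> kills both parts.\<close>

lemma E_vanishing:
  assumes a: "a \<in> carrier E"
    and T: "\<And>X. simple_obj C X \<Longrightarrow> \<exists>P\<in>T. projective_obj C P \<and> (\<exists>e\<in>Hom C P X. is_epi C e)"
    and vanish: "\<And>P p. \<lbrakk>P \<in> T; p \<in> carrier (FObj F P)\<rbrakk> \<Longrightarrow> vmap (a P) p = \<zero>\<^bsub>FObj F P\<^esub>"
    and X: "finite_length C X" and x: "x \<in> carrier (FObj F X)"
  shows "vmap (a X) x = \<zero>\<^bsub>FObj F X\<^esub>"
  using X x
proof (induct arbitrary: x rule: finite_length.induct)
  case (zero X)
  have XO: "X \<in> Obj C" using zero(1) by (simp add: is_zero_obj_def)
  show ?case by (rule F_zero_obj[OF zero(1) lin_mapsD(1)[OF E_lin[OF a XO] zero(2)]])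
next
  case (extend f g)
  define A X S where "A = Dom C f" and "X = Cod C f" and "S = Cod C g"
  have "is_kernel C f g" "is_cokernel C g f" using extend(1) by (simp_all add: short_exact_def)
  then have "f \<in> Arr C \<and> g \<in> Arr C \<and> Dom C g = X"
    unfolding is_kernel_def is_cokernel_def X_def by (elim conjE) (intro conjI)
  then have arr: "f \<in> Arr C" "g \<in> Arr C" and gD: "Dom C g = X" by simp_all
  have f: "f \<in> Hom C A X" and g: "g \<in> Hom C X S"
    using arr gD by (simp_all add: Hom_def A_def X_def S_def)
  have objs: "A \<in> Obj C" "X \<in> Obj C" "S \<in> Obj C" using hom_objs[OF f] hom_objs[OF g] by auto
  have x: "x \<in> carrier (FObj F X)" using extend(5) by (simp add: X_def)
  obtain P e where P: "P \<in> T" "projective_obj C P" "e \<in> Hom C P S" "is_epi C e"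
    using T[OF extend(4)] S_def by blast
  have "is_epi C g"
    using extend(1) unfolding short_exact_def by (elim conjE) (rule cokernel_epi)
  then obtain l where l: "l \<in> Hom C P X" "g \<cdot>\<^bsub>C\<^esub> l = e"
    using P(2,3) gD unfolding projective_obj_def S_def by blast
  have eD: "Dom C e = P" "Cod C e = S" using P(3) by (auto simp: Hom_def)
  obtain p where p: "p \<in> carrier (FObj F P)" "vmap (FArr F e) p = vmap (FArr F g) x"
    using F_epi_surj[OF P(4)] F_closed[OF g x] unfolding eD by blast
  note VX = vspaceD[OF F_vec(1)[OF objs(2)]] and VS = vspaceD[OF F_vec(1)[OF objs(3)]]
  define lp where "lp = vmap (FArr F l) p"
  have lp: "lp \<in> carrier (FObj F X)" unfolding lp_def by (rule F_closed[OF l(1) p(1)])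
  define r where "r = x \<oplus>\<^bsub>FObj F X\<^esub> (-1) \<odot>\<^bsub>FObj F X\<^esub> lp"
  have r: "r \<in> carrier (FObj F X)" using VX lp x by (simp add: r_def)
  interpret X: module complex_ring "FObj F X" by (rule F_vec(1)[OF objs(2)])
  interpret S: module complex_ring "FObj F S" by (rule F_vec(1)[OF objs(3)])
  have cancel: "u \<oplus>\<^bsub>FObj F S\<^esub> (-1) \<odot>\<^bsub>FObj F S\<^esub> u = \<zero>\<^bsub>FObj F S\<^esub>" if "u \<in> carrier (FObj F S)" for u
    using S.smult_l_distr[of 1 "-1" u] that VS by simp
  have glp: "vmap (FArr F g) lp = vmap (FArr F g) x"
    using F_comp_apply[OF l(1) g p(1)] p(2) l(2) by (simp add: lp_def)
  have "vmap (FArr F g) r = \<zero>\<^bsub>FObj F S\<^esub>"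
    unfolding r_def using lin_mapsD(2)[OF F_lin[OF g] x VX(3)[OF lp]] lin_mapsD(3)[OF F_lin[OF g] lp]
      cancel[OF F_closed[OF g x]] by (simp add: glp)
  then obtain y where y: "y \<in> carrier (FObj F A)" "vmap (FArr F f) y = r"
    using F_exact_apply[OF extend(1)] r unfolding gD A_def S_def by blast
  have 0: "vmap (FArr F h) \<zero>\<^bsub>FObj F B\<^esub> = \<zero>\<^bsub>FObj F X\<^esub>" if "h \<in> Hom C B X" for h B
    using lin_maps_zero[OF F_lin[OF that]] F_vec(1) hom_objs[OF that] by blast
  have a_r: "vmap (a X) r = \<zero>\<^bsub>FObj F X\<^esub>"
    using E_natural[OF a f y(1)] extend(3)[of y] y 0[OF f] by (simp add: A_def)
  have a_lp: "vmap (a X) lp = \<zero>\<^bsub>FObj F X\<^esub>"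
    using E_natural[OF a l(1) p(1)] vanish[OF P(1) p(1)] 0[OF l(1)] by (simp add: lp_def)
  have "vmap (a X) r = vmap (a X) x \<oplus>\<^bsub>FObj F X\<^esub> (-1) \<odot>\<^bsub>FObj F X\<^esub> vmap (a X) lp"
    unfolding r_def using lin_mapsD(2)[OF E_lin[OF a objs(2)] x VX(3)[OF lp]]
      lin_mapsD(3)[OF E_lin[OF a objs(2)] lp] by simp
  then have "vmap (a X) x = vmap (a X) lp"
    using a_r diff_eq_zeroD[OF F_vec(1)[OF objs(2)] lin_mapsD(1)[OF E_lin[OF a objs(2)] x]
        lin_mapsD(1)[OF E_lin[OF a objs(2)] lp]] by simp
  then show ?case using a_lp by (simp add: X_def)
qed

text \<open>The separating family of \<open>E\<close> is drawn from these functionals because each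
  of them, applied to left coefficients, again produces a natural endomorphism; see
  \<open>right_coefficient_endomorphism\<close>.\<close>

definition matrix_coefficients :: "(('o \<Rightarrow> 'v varr) \<Rightarrow> complex) set" where
  "matrix_coefficients = {\<lambda>a. \<xi> (vmap (a X) x) |X x \<xi>.
     X \<in> Obj C \<and> x \<in> carrier (FObj F X) \<and> functional (FObj F X) \<xi>}"

lemma matrix_coefficients_functional: "\<phi> \<in> matrix_coefficients \<Longrightarrow> functional E \<phi>"
  unfolding matrix_coefficients_def using functional_component by auto

lemma finite_coefficients_at_object:
  assumes P: "P \<in> Obj C"
  shows "\<exists>\<Phi>. finite \<Phi> \<and> \<Phi> \<subseteq> matrix_coefficients \<and>
    (\<forall>a\<in>carrier E. (\<forall>\<phi>\<in>\<Phi>. \<phi> a = 0) \<longrightarrow> (\<forall>p\<in>carrier (FObj F P). vmap (a P) p = \<zero>\<^bsub>FObj F P\<^esub>))"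
proof -
  note V = F_vec[OF P]
  obtain n :: nat and e \<phi> where e: "\<forall>i<n. e i \<in> carrier (FObj F P) \<and> functional (FObj F P) (\<phi> i)"
    "\<forall>\<psi>. functional (FObj F P) \<psi> \<longrightarrow> (\<forall>v\<in>carrier (FObj F P). \<psi> v = (\<Sum>i<n. \<phi> i v * \<psi> (e i)))"
    using finitely_separated_dual_basis[OF V(2) subspace_of_carrier[OF V(1)]]
    by (elim exE conjE) (rule that)
  \<comment> \<open>These are the entries of the matrix of \<open>a P\<close> in the basis
    \<open>e\<close> of \<open>F P\<close>.\<close>
  define \<Phi> where "\<Phi> = (\<lambda>(i, j) a. \<phi> j (vmap (a P) (e i))) ` ({..<n} \<times> {..<n})"
  have "\<Phi> \<subseteq> matrix_coefficients"
    using P e(1) unfolding \<Phi>_def matrix_coefficients_def by auto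
  moreover have "vmap (a P) p = \<zero>\<^bsub>FObj F P\<^esub>"
    if a: "a \<in> carrier E" and 0: "\<forall>\<chi>\<in>\<Phi>. \<chi> a = 0" and p: "p \<in> carrier (FObj F P)" for a p
  proof (rule separated_eqI[OF V(3) lin_mapsD(1)[OF E_lin[OF a P] p] vspaceD(1)[OF V(1)]])
    fix \<psi> assume \<psi>: "functional (FObj F P) \<psi>"
    have coeff: "\<phi> j (vmap (a P) (e i)) = 0" if "i < n" "j < n" for i j
      using 0 that unfolding \<Phi>_def by auto
    have "\<psi> (vmap (a P) (e i)) = 0" if i: "i < n" for i
    proof -
      have ei: "vmap (a P) (e i) \<in> carrier (FObj F P)"
        using lin_mapsD(1)[OF E_lin[OF a P]] e(1) i by simp
      show ?thesis unfolding e(2)[rule_format, OF \<psi> ei] by (rule sum.neutral) (simp add: coeff i)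
    qed
    then show "\<psi> (vmap (a P) p) = \<psi> \<zero>\<^bsub>FObj F P\<^esub>"
      unfolding functional_zero[OF \<psi> V(1)]
        e(2)[rule_format, OF functional_comp[OF E_lin[OF a P] \<psi>] p] by simp
  qed
  moreover have "finite \<Phi>" by (simp add: \<Phi>_def)
  ultimately show ?thesis by (intro exI[of _ \<Phi>]) simp
qed

text \<open>Matrix entries at the finitely many projectives suffice, since
  \<open>E_vanishing\<close> spreads their vanishing to every object of finite length.\<close>

lemma finite_separating_coefficients:
  "\<exists>\<Phi>. finite \<Phi> \<and> \<Phi> \<subseteq> matrix_coefficients \<and>
    (\<forall>a\<in>carrier E. (\<forall>\<phi>\<in>\<Phi>. \<phi> a = 0) \<longrightarrow> a = \<zero>\<^bsub>E\<^esub>)"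
proof -
  obtain T where T: "finite T" "T \<subseteq> Obj C"
    "\<And>X. simple_obj C X \<Longrightarrow> \<exists>P\<in>T. projective_obj C P \<and> (\<exists>e\<in>Hom C P X. is_epi C e)"
    using projective_covers_of_simples by blast
  have "\<forall>P\<in>T. \<exists>\<Phi>. finite \<Phi> \<and> \<Phi> \<subseteq> matrix_coefficients \<and>
    (\<forall>a\<in>carrier E. (\<forall>\<phi>\<in>\<Phi>. \<phi> a = 0) \<longrightarrow> (\<forall>p\<in>carrier (FObj F P). vmap (a P) p = \<zero>\<^bsub>FObj F P\<^esub>))"
    by (intro ballI finite_coefficients_at_object subsetD[OF T(2)])
  then obtain \<Phi> where \<Phi>: "\<forall>P\<in>T. finite (\<Phi> P) \<and> \<Phi> P \<subseteq> matrix_coefficients \<and>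
    (\<forall>a\<in>carrier E. (\<forall>\<phi>\<in>\<Phi> P. \<phi> a = 0) \<longrightarrow> (\<forall>p\<in>carrier (FObj F P). vmap (a P) p = \<zero>\<^bsub>FObj F P\<^esub>))"
    unfolding bchoice_iff by (elim exE)
  have "a = \<zero>\<^bsub>E\<^esub>" if a: "a \<in> carrier E" and 0: "\<forall>\<phi>\<in>(\<Union>P\<in>T. \<Phi> P). \<phi> a = 0" for a
  proof (rule E_eqI[OF a E_zero_closed])
    have v: "vmap (a P) p = \<zero>\<^bsub>FObj F P\<^esub>" if "P \<in> T" "p \<in> carrier (FObj F P)" for P p
      using \<Phi> a 0 that by simp
    fix X x assume X: "X \<in> Obj C" and x: "x \<in> carrier (FObj F X)"
    show "vmap (a X) x = vmap (\<zero>\<^bsub>E\<^esub> X) x"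
      unfolding E_apply(1)[OF X x] by (rule E_vanishing[OF a T(3) v obj_finite_length[OF X] x])
  qed
  then show ?thesis
    using T(1) \<Phi> by (intro conjI exI[of _ "\<Union>P\<in>T. \<Phi> P"]) auto
qed

lemma E_finitely_separated: "finitely_separated E"
proof -
  obtain \<Phi> where \<Phi>: "finite \<Phi>" "\<Phi> \<subseteq> matrix_coefficients"
      "\<forall>a\<in>carrier E. (\<forall>\<phi>\<in>\<Phi>. \<phi> a = 0) \<longrightarrow> a = \<zero>\<^bsub>E\<^esub>"
    using finite_separating_coefficients by (elim exE conjE)
  then show ?thesis
    unfolding finitely_separated_def using matrix_coefficients_functional
    by (intro conjI E_vspace exI[of _ \<Phi>]) auto
qed

section \<open>The algebra structure, and endomorphisms given by coefficients\<close>

lemma E_one_closed: "\<one>\<^bsub>E\<^esub> \<in> carrier E"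
proof -
  have "(\<lambda>X\<in>Obj C. (FObj F X, \<lambda>x\<in>carrier (FObj F X). x, FObj F X)) \<in> carrier E"
  proof (rule E_intro)
    show "(\<lambda>x\<in>carrier (FObj F X). x) \<in> lin_maps (FObj F X) (FObj F X)" if "X \<in> Obj C" for X
      by (rule lin_mapsI) (simp_all add: vspaceD[OF F_vec(1)[OF that]])
  next
    fix X Y f x assume f: "f \<in> Hom C X Y" and x: "x \<in> carrier (FObj F X)"
    show "(\<lambda>x\<in>carrier (FObj F Y). x) (vmap (FArr F f) x) =
        vmap (FArr F f) ((\<lambda>x\<in>carrier (FObj F X). x) x)"
      using x F_closed[OF f x] by simp
  qed
  then show ?thesis by (simp add: E_simps(5) Vec_simps(4))
qed

lemma E_mult_closed:
  assumes a: "a \<in> carrier E" and b: "b \<in> carrier E"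
  shows "a \<otimes>\<^bsub>E\<^esub> b \<in> carrier E"
proof -
  define s where "s X = compose (carrier (FObj F X)) (vmap (a X)) (vmap (b X))" for X
  have eq: "Comp Vec (a X) (b X) = (FObj F X, s X, FObj F X)" if "X \<in> Obj C" for X
    using Vec_homD(2,3)[OF E_hom[OF a that]] Vec_homD(2,3)[OF E_hom[OF b that]]
    by (simp add: Vec_simps(5) s_def)
  then have "a \<otimes>\<^bsub>E\<^esub> b = (\<lambda>X\<in>Obj C. (FObj F X, s X, FObj F X))"
    by (auto simp: E_simps(4) fun_eq_iff)
  moreover have "\<dots> \<in> carrier E"
  proof (rule E_intro)
    show "s X \<in> lin_maps (FObj F X) (FObj F X)" if X: "X \<in> Obj C" for X
      using Vec_homD(1)[OF Vec_comp_hom[OF E_hom[OF b X] E_hom[OF a X]]] eq[OF X] by simp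
  next
    fix X Y f x assume f: "f \<in> Hom C X Y" and x: "x \<in> carrier (FObj F X)"
    have X: "X \<in> Obj C" using hom_objs[OF f] by simp
    show "s Y (vmap (FArr F f) x) = vmap (FArr F f) (s X x)"
      using x F_closed[OF f x] E_natural[OF b f x] E_natural[OF a f lin_mapsD(1)[OF E_lin[OF b X] x]]
      by (simp add: s_def compose_def)
  qed
  ultimately show ?thesis by simp
qed

lemma F_iso_bij:
  assumes f: "f \<in> Hom C X Y" and iso: "is_iso_arr C f"
  shows "bij_betw (vmap (FArr F f)) (carrier (FObj F X)) (carrier (FObj F Y))"
proof -
  obtain g where g: "g \<in> Hom C Y X" "g \<cdot>\<^bsub>C\<^esub> f = Id C X" "f \<cdot>\<^bsub>C\<^esub> g = Id C Y"
    using iso f by (auto simp: is_iso_arr_def inverse_arrows_def Hom_def)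
  have objs: "X \<in> Obj C" "Y \<in> Obj C" using hom_objs[OF f] by auto
  show ?thesis
  proof (rule bij_betw_byWitness[where f' = "vmap (FArr F g)"])
    show "\<forall>x\<in>carrier (FObj F X). vmap (FArr F g) (vmap (FArr F f) x) = x"
      using F_comp_apply[OF f g(1)] F_id_apply[OF objs(1)] by (simp add: g(2))
    show "\<forall>y\<in>carrier (FObj F Y). vmap (FArr F f) (vmap (FArr F g) y) = y"
      using F_comp_apply[OF g(1) f] F_id_apply[OF objs(2)] by (simp add: g(3))
  qed (use F_closed[OF f] F_closed[OF g(1)] in auto)
qed

text \<open>Here \<open>\<mu> X x \<xi>\<close> prescribes the number
  \<open>\<xi> (a\<^sub>X x)\<close>. The three hypotheses say that the prescription comes from a
  vector, is linear in \<open>x\<close> and is natural; separatedness of each \<open>F X\<close>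
  turns them into a natural linear family.\<close>

lemma E_from_coefficients:
  assumes rep: "\<And>X x. \<lbrakk>X \<in> Obj C; x \<in> carrier (FObj F X)\<rbrakk>
      \<Longrightarrow> \<exists>m\<in>carrier (FObj F X). \<forall>\<xi>. functional (FObj F X) \<xi> \<longrightarrow> \<xi> m = \<mu> X x \<xi>"
    and lin: "\<And>X \<xi>. \<lbrakk>X \<in> Obj C; functional (FObj F X) \<xi>\<rbrakk> \<Longrightarrow> functional (FObj F X) (\<lambda>x. \<mu> X x \<xi>)"
    and nat: "\<And>X Y f x \<xi>. \<lbrakk>f \<in> Hom C X Y; x \<in> carrier (FObj F X); functional (FObj F Y) \<xi>\<rbrakk>
      \<Longrightarrow> \<mu> Y (vmap (FArr F f) x) \<xi> = \<mu> X x (\<lambda>v. \<xi> (vmap (FArr F f) v))"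
  shows "\<exists>a\<in>carrier E. \<forall>X\<in>Obj C. \<forall>x\<in>carrier (FObj F X). \<forall>\<xi>. functional (FObj F X) \<xi> \<longrightarrow>
    \<xi> (vmap (a X) x) = \<mu> X x \<xi>"
proof -
  define m where "m X x = (SOME m. m \<in> carrier (FObj F X) \<and>
    (\<forall>\<xi>. functional (FObj F X) \<xi> \<longrightarrow> \<xi> m = \<mu> X x \<xi>))" for X x
  have m: "m X x \<in> carrier (FObj F X) \<and> (\<forall>\<xi>. functional (FObj F X) \<xi> \<longrightarrow> \<xi> (m X x) = \<mu> X x \<xi>)"
    if "X \<in> Obj C" "x \<in> carrier (FObj F X)" for X x
    using rep[OF that] unfolding Bex_def m_def by (rule someI_ex)
  have m1: "m X x \<in> carrier (FObj F X)" if "X \<in> Obj C" "x \<in> carrier (FObj F X)" for X x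
    using m[OF that] by (rule conjunct1)
  have m2: "\<xi> (m X x) = \<mu> X x \<xi>"
    if "X \<in> Obj C" "x \<in> carrier (FObj F X)" "functional (FObj F X) \<xi>" for X x \<xi>
    using m[OF that(1,2), THEN conjunct2, rule_format, OF that(3)] .
  define M where "M X = (\<lambda>x\<in>carrier (FObj F X). m X x)" for X
  have "(\<lambda>X\<in>Obj C. (FObj F X, M X, FObj F X)) \<in> carrier E"
  proof (rule E_intro)
    fix X assume X: "X \<in> Obj C"
    show "M X \<in> lin_maps (FObj F X) (FObj F X)"
      unfolding M_def
    proof (rule lin_mapsI_functionals[OF F_vec(1)[OF X] F_vec(3)[OF X] m1[OF X]])
      fix \<xi> assume \<xi>: "functional (FObj F X) \<xi>"
      note l = lin[OF X \<xi>]
      show "functional (FObj F X) (\<lambda>x. \<xi> (m X x))"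
        unfolding functional_def
        by (simp add: m2[OF X _ \<xi>] functional_add[OF l] functional_smult[OF l] vspaceD[OF F_vec(1)[OF X]])
    qed
  next
    fix X Y f x assume f: "f \<in> Hom C X Y" and x: "x \<in> carrier (FObj F X)"
    have X: "X \<in> Obj C" and Y: "Y \<in> Obj C" using hom_objs[OF f] by auto
    note fx = F_closed[OF f x]
    have "m Y (vmap (FArr F f) x) = vmap (FArr F f) (m X x)"
    proof (rule separated_eqI[OF F_vec(3)[OF Y] m1[OF Y fx] F_closed[OF f m1[OF X x]]])
      fix \<xi> assume \<xi>: "functional (FObj F Y) \<xi>"
      show "\<xi> (m Y (vmap (FArr F f) x)) = \<xi> (vmap (FArr F f) (m X x))"
        unfolding m2[OF Y fx \<xi>] nat[OF f x \<xi>]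
        by (rule m2[OF X x functional_comp[OF F_lin[OF f] \<xi>], symmetric])
    qed
    then show "M Y (vmap (FArr F f) x) = vmap (FArr F f) (M X x)"
      using x fx by (simp add: M_def)
  qed
  then show ?thesis
    by (rule rev_bexI) (simp add: M_def m2)
qed

end

section \<open>The coproduct of a quasi-fiber functor\<close>

locale fiber_functor = finite_tensor_category C + quasi_fiber_functor C F
  for C :: "('o, 'm, 'x) tcat_scheme" and F :: "('o, 'm, 'v) fiber"

sublocale fiber_functor \<subseteq> exact_vec_functor C F ..

context fiber_functor
begin

section \<open>The action of the tensor square of End F on tensor products\<close>

lemma EndF_eq: "EndF C F = E"
  by (simp add: EndF_def)

abbreviation "T X Y \<equiv> tensor_space (FObj F X) (FObj F Y)"

lemma T_vec:
  assumes "X \<in> Obj C" "Y \<in> Obj C"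
  shows "vspace (T X Y)" "separated (T X Y)"
  using tensor_separated[OF F_vec(1)[OF assms(1)] F_vec(1)[OF assms(2)]]
    tensor_vspace[OF F_vec(1)[OF assms(1)] F_vec(1)[OF assms(2)]] by auto

text \<open>Linearity in either endomorphism is an identity between linear maps out of a tensor
  product, so it is checked on pure tensors.\<close>

lemma tensor_map_bilinear:
  assumes X: "X \<in> Obj C" and Y: "Y \<in> Obj C"
  shows "bilinear_map E E (lin_space (T X Y) (T X Y))
    (\<lambda>b c. tensor_map (FObj F X) (FObj F Y) (FObj F X) (FObj F Y) (vmap (b X)) (vmap (c Y)))"
    (is "bilinear_map E E ?L ?B")
proof -
  note V = F_vec(1)[OF X] F_vec(1)[OF Y]
  note tm = tensor_map[OF V V E_lin[OF _ X] E_lin[OF _ Y]]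
  note L = separated_vspace[OF lin_space_separated[OF T_vec(1)[OF X Y] T_vec(2)[OF X Y]]]
  note eqI = lin_maps_tensor_eqI[OF V T_vec(1)[OF X Y]]
  note cl = lin_mapsD(1)[OF E_lin[OF _ X]] lin_mapsD(1)[OF E_lin[OF _ Y]]
  have B: "?B b c \<in> lin_maps (T X Y) (T X Y)" if "b \<in> carrier E" "c \<in> carrier E" for b c
    by (rule tm(1)[OF that])
  note Lcl = vspaceD(2,3)[OF L, unfolded lin_space_simps(1)]
  note lin = pure_tensor_linear[OF V]
  have add1: "?B (b \<oplus>\<^bsub>E\<^esub> b') c = ?B b c \<oplus>\<^bsub>?L\<^esub> ?B b' c"
    if "b \<in> carrier E" "b' \<in> carrier E" "c \<in> carrier E" for b b' c
    by (rule eqI[OF B[OF E_add_closed[OF that(1,2)] that(3)] Lcl(1)[OF B[OF that(1,3)] B[OF that(2,3)]]])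
      (simp add: tm(2) that E_add_closed E_apply X Y cl pure_closed lin)
  have add2: "?B b (c \<oplus>\<^bsub>E\<^esub> c') = ?B b c \<oplus>\<^bsub>?L\<^esub> ?B b c'"
    if "b \<in> carrier E" "c \<in> carrier E" "c' \<in> carrier E" for b c c'
    by (rule eqI[OF B[OF that(1) E_add_closed[OF that(2,3)]] Lcl(1)[OF B[OF that(1,2)] B[OF that(1,3)]]])
      (simp add: tm(2) that E_add_closed E_apply X Y cl pure_closed lin)
  have smult1: "?B (k \<odot>\<^bsub>E\<^esub> b) c = k \<odot>\<^bsub>?L\<^esub> ?B b c"
    if "b \<in> carrier E" "c \<in> carrier E" for k b c
    by (rule eqI[OF B[OF E_smult_closed[OF that(1)] that(2)] Lcl(2)[OF B[OF that]]])
      (simp add: tm(2) that E_smult_closed E_apply X Y cl pure_closed lin)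
  have smult2: "?B b (k \<odot>\<^bsub>E\<^esub> c) = k \<odot>\<^bsub>?L\<^esub> ?B b c"
    if "b \<in> carrier E" "c \<in> carrier E" for k b c
    by (rule eqI[OF B[OF that(1) E_smult_closed[OF that(2)]] Lcl(2)[OF B[OF that]]])
      (simp add: tm(2) that E_smult_closed E_apply X Y cl pure_closed lin)
  show ?thesis
    unfolding bilinear_map_def
  proof (intro conjI ballI allI impI)
    show "?B b c \<in> carrier ?L" if "b \<in> carrier E" "c \<in> carrier E" for b c
      using B[OF that] by simp
    fix \<xi> assume \<xi>: "functional ?L \<xi>"
    note \<xi>_add = functional_add[OF \<xi>, unfolded lin_space_simps(1)]
      and \<xi>_smult = functional_smult[OF \<xi>, unfolded lin_space_simps(1)]
    show "(\<lambda>b c. \<xi> (?B b c)) \<in> bilinear_forms E E"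
      unfolding bilinear_forms_iff[OF E_vspace E_vspace] functional_def
      by (intro conjI ballI allI)
        (simp_all only: add1 add2 smult1 smult2 \<xi>_add[OF B B] \<xi>_smult[OF B])
  qed
qed

text \<open>The bilinearity recorded in the third clause lets \<open>tensor_cong\<close> replace the
  form by another one that agrees with it on \<open>E\<close>.\<close>

lemma tensor_action:
  assumes X: "X \<in> Obj C" and Y: "Y \<in> Obj C" and t: "t \<in> carrier (tensor_space E E)"
  shows "tensor_action C F X Y t \<in> lin_maps (T X Y) (T X Y)"
    and "\<And>z \<beta>. z \<in> carrier (T X Y) \<Longrightarrow> tensor_action C F X Y t z \<beta> =
      t (\<lambda>b c. tensor_map (FObj F X) (FObj F Y) (FObj F X) (FObj F Y) (vmap (b X)) (vmap (c Y)) z \<beta>)"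
    and "\<And>z \<beta>. z \<in> carrier (T X Y) \<Longrightarrow>
      (\<lambda>b c. tensor_map (FObj F X) (FObj F Y) (FObj F X) (FObj F Y) (vmap (b X)) (vmap (c Y)) z \<beta>)
        \<in> bilinear_forms E E"
proof -
  note sep = lin_space_separated[OF T_vec(1)[OF X Y] T_vec(2)[OF X Y]]
  note lift = tensor_lift[OF E_vspace E_vspace sep tensor_map_bilinear[OF X Y]]
  have ev: "functional (lin_space (T X Y) (T X Y)) (\<lambda>f. f z \<beta>)" if "z \<in> carrier (T X Y)" for z \<beta>
    using that by (simp add: functional_def)
  show "tensor_action C F X Y t \<in> lin_maps (T X Y) (T X Y)"
    using lin_mapsD(1)[OF lift(1) t] by (simp add: tensor_action_def EndF_eq)
  show "tensor_action C F X Y t z \<beta> =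
      t (\<lambda>b c. tensor_map (FObj F X) (FObj F Y) (FObj F X) (FObj F Y) (vmap (b X)) (vmap (c Y)) z \<beta>)"
    if "z \<in> carrier (T X Y)" for z \<beta>
    unfolding tensor_action_def EndF_eq by (rule lift(3)[OF t ev[OF that]])
  show "(\<lambda>b c. tensor_map (FObj F X) (FObj F Y) (FObj F X) (FObj F Y) (vmap (b X)) (vmap (c Y)) z \<beta>)
      \<in> bilinear_forms E E" if "z \<in> carrier (T X Y)" for z \<beta>
    by (rule bilinear_mapD(2)[OF tensor_map_bilinear[OF X Y] ev[OF that]])
qed

lemma tensor_action_pure:
  assumes X: "X \<in> Obj C" and Y: "Y \<in> Obj C" and t: "t \<in> carrier (tensor_space E E)"
    and x: "x \<in> carrier (FObj F X)" and y: "y \<in> carrier (FObj F Y)"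
    and \<xi>: "functional (FObj F X) \<xi>" and \<psi>: "functional (FObj F Y) \<psi>"
  shows "tensor_action C F X Y t (pure_tensor (FObj F X) (FObj F Y) x y) (\<lambda>v w. \<xi> v * \<psi> w) =
    t (\<lambda>b c. \<xi> (vmap (b X) x) * \<psi> (vmap (c Y) y))"
proof -
  note V = F_vec(1)[OF X] F_vec(1)[OF Y]
  have p: "pure_tensor (FObj F X) (FObj F Y) x y \<in> carrier (T X Y)" by (rule pure_closed[OF x y])
  show ?thesis
    unfolding tensor_action(2)[OF X Y t p]
  proof (rule tensor_cong[OF t tensor_action(3)[OF X Y t p]
        product_bilinear[OF E_vspace E_vspace functional_component[OF X x \<xi>] functional_component[OF Y y \<psi>]]])
    fix b c assume b: "b \<in> carrier E" and c: "c \<in> carrier E"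
    show "tensor_map (FObj F X) (FObj F Y) (FObj F X) (FObj F Y) (vmap (b X)) (vmap (c Y))
        (pure_tensor (FObj F X) (FObj F Y) x y) (\<lambda>v w. \<xi> v * \<psi> w) =
      \<xi> (vmap (b X) x) * \<psi> (vmap (c Y) y)"
      unfolding tensor_map(2)[OF V V E_lin[OF b X] E_lin[OF c Y] x y]
      by (rule pure_tensor_apply[OF product_bilinear[OF V \<xi> \<psi>]])
  qed
qed

text \<open>The action determines \<open>s\<close> on products of two matrix coefficients. A general
  functional on \<open>E\<close> need not be a single matrix coefficient, so slices are used: an
  element of \<open>E\<close> is determined by its matrix coefficients, which allows an arbitrary
  functional in one factor at a time.\<close>

lemma tensor_action_inj:
  assumes s: "s \<in> carrier (tensor_space E E)" and t: "t \<in> carrier (tensor_space E E)"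
    and eq: "\<And>X Y z. \<lbrakk>X \<in> Obj C; Y \<in> Obj C; z \<in> carrier (T X Y)\<rbrakk>
      \<Longrightarrow> tensor_action C F X Y s z = tensor_action C F X Y t z"
  shows "s = t"
proof (rule tensor_eqI[OF E_finitely_separated E_vspace s t])
  have coeff: "s (\<lambda>b c. \<xi> (vmap (b X) x) * \<psi> (vmap (c Y) y)) =
      t (\<lambda>b c. \<xi> (vmap (b X) x) * \<psi> (vmap (c Y) y))"
    if "X \<in> Obj C" "Y \<in> Obj C" "x \<in> carrier (FObj F X)" "y \<in> carrier (FObj F Y)"
      "functional (FObj F X) \<xi>" "functional (FObj F Y) \<psi>" for X Y x y \<xi> \<psi>
    using eq[OF that(1,2) pure_closed[OF that(3,4)]]
      tensor_action_pure[OF that(1,2) s that(3-6)] tensor_action_pure[OF that(1,2) t that(3-6)] by simp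
  \<comment> \<open>The first factor is now arbitrary, while the second is still a matrix
    coefficient.\<close>
  have half: "s (\<lambda>b c. \<phi> b * \<psi> (vmap (c Y) y)) = t (\<lambda>b c. \<phi> b * \<psi> (vmap (c Y) y))"
    if Y: "Y \<in> Obj C" "y \<in> carrier (FObj F Y)" "functional (FObj F Y) \<psi>" and \<phi>: "functional E \<phi>"
    for Y y \<psi> \<phi>
  proof -
    note g = functional_component[OF Y]
    obtain r where r: "r \<in> carrier E"
      "\<forall>\<phi>. functional E \<phi> \<longrightarrow> \<phi> r = s (\<lambda>b c. \<phi> b * \<psi> (vmap (c Y) y))"
      using tensor_slice_left[OF E_vspace E_vspace g s] by (elim bexE)
    obtain r' where r': "r' \<in> carrier E"
      "\<forall>\<phi>. functional E \<phi> \<longrightarrow> \<phi> r' = t (\<lambda>b c. \<phi> b * \<psi> (vmap (c Y) y))"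
      using tensor_slice_left[OF E_vspace E_vspace g t] by (elim bexE)
    have "r = r'"
    proof (rule E_eqI_functionals[OF r(1) r'(1)])
      fix X x \<xi> assume X: "X \<in> Obj C" "x \<in> carrier (FObj F X)" "functional (FObj F X) \<xi>"
      note f = functional_component[OF X]
      show "\<xi> (vmap (r X) x) = \<xi> (vmap (r' X) x)"
        unfolding r(2)[rule_format, OF f] r'(2)[rule_format, OF f]
        by (rule coeff[OF X(1) Y(1) X(2) Y(2) X(3) Y(3)])
    qed
    then show ?thesis using r(2)[rule_format, OF \<phi>] r'(2)[rule_format, OF \<phi>] by simp
  qed
  fix \<phi> \<psi> assume \<phi>: "functional E \<phi>" and \<psi>: "functional E \<psi>"
  obtain r where r: "r \<in> carrier E" "\<forall>\<psi>. functional E \<psi> \<longrightarrow> \<psi> r = s (\<lambda>b c. \<phi> b * \<psi> c)"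
    using tensor_slice_right[OF E_vspace E_vspace \<phi> s] by (elim bexE)
  obtain r' where r': "r' \<in> carrier E" "\<forall>\<psi>. functional E \<psi> \<longrightarrow> \<psi> r' = t (\<lambda>b c. \<phi> b * \<psi> c)"
    using tensor_slice_right[OF E_vspace E_vspace \<phi> t] by (elim bexE)
  have "r = r'"
  proof (rule E_eqI_functionals[OF r(1) r'(1)])
    fix X x \<xi> assume X: "X \<in> Obj C" "x \<in> carrier (FObj F X)" "functional (FObj F X) \<xi>"
    note f = functional_component[OF X]
    show "\<xi> (vmap (r X) x) = \<xi> (vmap (r' X) x)"
      unfolding r(2)[rule_format, OF f] r'(2)[rule_format, OF f] by (rule half[OF X \<phi>])
  qed
  then show "s (\<lambda>b c. \<phi> b * \<psi> c) = t (\<lambda>b c. \<phi> b * \<psi> c)"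
    using r(2)[rule_format, OF \<psi>] r'(2)[rule_format, OF \<psi>] by simp
qed

section \<open>Transport of an endomorphism to tensor products, and its coefficients\<close>

lemma FibTens_iso:
  assumes "X \<in> Obj C" "Y \<in> Obj C"
  shows "FibTens F X Y \<in> lin_maps (T X Y) (FObj F (X \<boxdot>\<^bsub>C\<^esub> Y))"
    and "bij_betw (FibTens F X Y) (carrier (T X Y)) (carrier (FObj F (X \<boxdot>\<^bsub>C\<^esub> Y)))"
  using F_tens_iso[OF assms] by (auto simp: lin_isos_def)

lemma FibTens_inj:
  "\<lbrakk>X \<in> Obj C; Y \<in> Obj C; z \<in> carrier (T X Y); z' \<in> carrier (T X Y); FibTens F X Y z = FibTens F X Y z'\<rbrakk>
    \<Longrightarrow> z = z'"
  using bij_betw_imp_inj_on[OF FibTens_iso(2)] by (rule inj_onD)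

text \<open>The map \<open>\<eta>\<close> is the conjugate of the component of \<open>a\<close> at
  the product object by the isomorphism \<open>FibTens F X Y\<close>.\<close>

lemma transported_action:
  assumes a: "a \<in> carrier E" and X: "X \<in> Obj C" and Y: "Y \<in> Obj C"
  shows "\<exists>\<eta>\<in>lin_maps (T X Y) (T X Y). \<forall>z\<in>carrier (T X Y).
    FibTens F X Y (\<eta> z) = vmap (a (X \<boxdot>\<^bsub>C\<^esub> Y)) (FibTens F X Y z)"
proof -
  note XY = tens_obj[OF X Y] and J = FibTens_iso[OF X Y]
  define i where "i = (\<lambda>w\<in>carrier (FObj F (X \<boxdot>\<^bsub>C\<^esub> Y)). inv_into (carrier (T X Y)) (FibTens F X Y) w)"
  have i: "i \<in> lin_maps (FObj F (X \<boxdot>\<^bsub>C\<^esub> Y)) (T X Y)"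
    unfolding i_def by (rule lin_isos_inverse[OF F_vec(1)[OF XY] T_vec(1)[OF X Y] F_tens_iso[OF X Y]])
  have Ji: "FibTens F X Y (i w) = w" if "w \<in> carrier (FObj F (X \<boxdot>\<^bsub>C\<^esub> Y))" for w
    using that bij_betw_imp_surj_on[OF J(2)] by (simp add: i_def f_inv_into_f)
  note aJ = lin_maps_comp[OF T_vec(1)[OF X Y] J(1) E_lin[OF a XY]]
  show ?thesis
  proof (rule bexI[OF _ lin_maps_comp[OF T_vec(1)[OF X Y] aJ i]], rule ballI)
    fix z assume z: "z \<in> carrier (T X Y)"
    show "FibTens F X Y (compose (carrier (T X Y)) i
        (compose (carrier (T X Y)) (vmap (a (X \<boxdot>\<^bsub>C\<^esub> Y))) (FibTens F X Y)) z) =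
      vmap (a (X \<boxdot>\<^bsub>C\<^esub> Y)) (FibTens F X Y z)"
      using z Ji[OF lin_mapsD(1)[OF E_lin[OF a XY] lin_mapsD(1)[OF J(1) z]]] by (simp add: compose_def)
  qed
qed

definition transport :: "('o \<Rightarrow> 'v varr) \<Rightarrow> 'o \<Rightarrow> 'o \<Rightarrow> (('v \<Rightarrow> 'v \<Rightarrow> complex) \<Rightarrow> complex)
    \<Rightarrow> (('v \<Rightarrow> 'v \<Rightarrow> complex) \<Rightarrow> complex)" where
  "transport a X Y = (SOME \<eta>. \<eta> \<in> lin_maps (T X Y) (T X Y) \<and> (\<forall>z\<in>carrier (T X Y).
    FibTens F X Y (\<eta> z) = vmap (a (X \<boxdot>\<^bsub>C\<^esub> Y)) (FibTens F X Y z)))"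

lemma transport:
  assumes "a \<in> carrier E" "X \<in> Obj C" "Y \<in> Obj C"
  shows "transport a X Y \<in> lin_maps (T X Y) (T X Y)"
    and "\<And>z. z \<in> carrier (T X Y) \<Longrightarrow>
      FibTens F X Y (transport a X Y z) = vmap (a (X \<boxdot>\<^bsub>C\<^esub> Y)) (FibTens F X Y z)"
proof -
  have "transport a X Y \<in> lin_maps (T X Y) (T X Y) \<and> (\<forall>z\<in>carrier (T X Y).
    FibTens F X Y (transport a X Y z) = vmap (a (X \<boxdot>\<^bsub>C\<^esub> Y)) (FibTens F X Y z))"
    using transported_action[OF assms] unfolding transport_def Bex_def by (rule someI_ex)
  then show "transport a X Y \<in> lin_maps (T X Y) (T X Y)"
    and "\<And>z. z \<in> carrier (T X Y) \<Longrightarrow>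
      FibTens F X Y (transport a X Y z) = vmap (a (X \<boxdot>\<^bsub>C\<^esub> Y)) (FibTens F X Y z)" by auto
qed

text \<open>After the injective map \<open>FibTens F X' Y'\<close> the claim combines naturality of
  \<open>FibTens\<close> with naturality of \<open>a\<close> at the arrow
  \<open>f \<boxtimes> g\<close>.\<close>

lemma transport_natural:
  assumes a: "a \<in> carrier E" and f: "f \<in> Hom C X X'" and g: "g \<in> Hom C Y Y'"
    and z: "z \<in> carrier (T X Y)"
  shows "transport a X' Y' (tensor_map (FObj F X) (FObj F Y) (FObj F X') (FObj F Y')
      (vmap (FArr F f)) (vmap (FArr F g)) z) =
    tensor_map (FObj F X) (FObj F Y) (FObj F X') (FObj F Y') (vmap (FArr F f)) (vmap (FArr F g))
      (transport a X Y z)"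
proof -
  have objs: "X \<in> Obj C" "X' \<in> Obj C" "Y \<in> Obj C" "Y' \<in> Obj C"
    using hom_objs[OF f] hom_objs[OF g] by auto
  let ?fg = "tensor_map (FObj F X) (FObj F Y) (FObj F X') (FObj F Y') (vmap (FArr F f)) (vmap (FArr F g))"
  have fg: "?fg \<in> lin_maps (T X Y) (T X' Y')"
    by (rule tensor_map(1)[OF F_vec(1)[OF objs(1)] F_vec(1)[OF objs(3)] F_vec(1)[OF objs(2)]
          F_vec(1)[OF objs(4)] F_lin[OF f] F_lin[OF g]])
  note tr = transport[OF a objs(1,3)] and tr' = transport[OF a objs(2,4)]
  note \<eta>z = lin_mapsD(1)[OF tr(1) z] and fgz = lin_mapsD(1)[OF fg z]
  show ?thesis
  proof (rule FibTens_inj[OF objs(2,4) lin_mapsD(1)[OF tr'(1) fgz] lin_mapsD(1)[OF fg \<eta>z]])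
    have "FibTens F X' Y' (transport a X' Y' (?fg z)) =
        vmap (a (X' \<boxdot>\<^bsub>C\<^esub> Y')) (vmap (FArr F (f \<boxtimes>\<^bsub>C\<^esub> g)) (FibTens F X Y z))"
      unfolding tr'(2)[OF fgz] F_tens_natural[OF f g z] ..
    also have "\<dots> = vmap (FArr F (f \<boxtimes>\<^bsub>C\<^esub> g)) (FibTens F X Y (transport a X Y z))"
      unfolding tr(2)[OF z]
      by (rule E_natural[OF a tens_hom[OF f g] lin_mapsD(1)[OF FibTens_iso(1)[OF objs(1,3)] z]])
    also have "\<dots> = FibTens F X' Y' (?fg (transport a X Y z))"
      by (rule F_tens_natural[OF f g \<eta>z, symmetric])
    finally show "FibTens F X' Y' (transport a X' Y' (?fg z)) =
        FibTens F X' Y' (?fg (transport a X Y z))" .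
  qed
qed

text \<open>The pairing of \<open>\<xi> \<otimes> \<psi>\<close> with the transported action on
  \<open>x \<otimes> y\<close>. Since a tensor is a functional on bilinear forms, pairing means
  applying it to the product form.\<close>

definition coefficient where
  "coefficient a X Y x y \<xi> \<psi> =
    transport a X Y (pure_tensor (FObj F X) (FObj F Y) x y) (\<lambda>v w. \<xi> v * \<psi> w)"

lemma coefficient_natural:
  assumes a: "a \<in> carrier E" and f: "f \<in> Hom C X X'" and g: "g \<in> Hom C Y Y'"
    and x: "x \<in> carrier (FObj F X)" and y: "y \<in> carrier (FObj F Y)"
    and \<xi>: "functional (FObj F X') \<xi>" and \<psi>: "functional (FObj F Y') \<psi>"
  shows "coefficient a X' Y' (vmap (FArr F f) x) (vmap (FArr F g) y) \<xi> \<psi> =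
    coefficient a X Y x y (\<lambda>v. \<xi> (vmap (FArr F f) v)) (\<lambda>w. \<psi> (vmap (FArr F g) w))"
proof -
  have objs: "X \<in> Obj C" "X' \<in> Obj C" "Y \<in> Obj C" "Y' \<in> Obj C"
    using hom_objs[OF f] hom_objs[OF g] by auto
  note V = F_vec(1)[OF objs(1)] F_vec(1)[OF objs(3)] F_vec(1)[OF objs(2)] F_vec(1)[OF objs(4)]
  note tm = tensor_map[OF V F_lin[OF f] F_lin[OF g]]
  show ?thesis
    unfolding coefficient_def tm(2)[OF x y, symmetric] transport_natural[OF a f g pure_closed[OF x y]]
    by (rule tm(3)[OF lin_mapsD(1)[OF transport(1)[OF a objs(1,3)] pure_closed[OF x y]]
          product_bilinear[OF V(3,4) \<xi> \<psi>]])
qed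

lemma functional_comp_id:
  assumes "X \<in> Obj C" "functional (FObj F X) \<xi>"
  shows "functional (FObj F X) (\<lambda>v. \<xi> (vmap (FArr F (Id C X)) v))"
  using functional_comp[OF F_lin[OF id_hom[OF assms(1)]] assms(2)] .

text \<open>Joint naturality with an identity in the second slot. Composing \<open>\<psi>\<close>
  with the image of an identity changes nothing on the carrier but possibly off it, hence the appeal
  to \<open>tensor_cong\<close>.\<close>

lemma coefficient_natural_left:
  assumes a: "a \<in> carrier E" and f: "f \<in> Hom C X X'" and Y: "Y \<in> Obj C"
    and x: "x \<in> carrier (FObj F X)" and y: "y \<in> carrier (FObj F Y)"
    and \<xi>: "functional (FObj F X') \<xi>" and \<psi>: "functional (FObj F Y) \<psi>"
  shows "coefficient a X' Y (vmap (FArr F f) x) y \<xi> \<psi> =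
    coefficient a X Y x y (\<lambda>v. \<xi> (vmap (FArr F f) v)) \<psi>"
proof -
  have X: "X \<in> Obj C" using hom_objs[OF f] by simp
  note V = F_vec(1)[OF X] F_vec(1)[OF Y] and f\<xi> = functional_comp[OF F_lin[OF f] \<xi>]
  have "coefficient a X Y x y (\<lambda>v. \<xi> (vmap (FArr F f) v)) (\<lambda>w. \<psi> (vmap (FArr F (Id C Y)) w)) =
      coefficient a X Y x y (\<lambda>v. \<xi> (vmap (FArr F f) v)) \<psi>"
    unfolding coefficient_def
    by (rule tensor_cong[OF lin_mapsD(1)[OF transport(1)[OF a X Y] pure_closed[OF x y]]
          product_bilinear[OF V f\<xi> functional_comp_id[OF Y \<psi>]] product_bilinear[OF V f\<xi> \<psi>]])
      (simp add: F_id_apply[OF Y])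
  then show ?thesis
    using coefficient_natural[OF a f id_hom[OF Y] x y \<xi> \<psi>] F_id_apply[OF Y y] by simp
qed

lemma coefficient_natural_right:
  assumes a: "a \<in> carrier E" and g: "g \<in> Hom C Y Y'" and X: "X \<in> Obj C"
    and x: "x \<in> carrier (FObj F X)" and y: "y \<in> carrier (FObj F Y)"
    and \<xi>: "functional (FObj F X) \<xi>" and \<psi>: "functional (FObj F Y') \<psi>"
  shows "coefficient a X Y' x (vmap (FArr F g) y) \<xi> \<psi> =
    coefficient a X Y x y \<xi> (\<lambda>w. \<psi> (vmap (FArr F g) w))"
proof -
  have Y: "Y \<in> Obj C" using hom_objs[OF g] by simp
  note V = F_vec(1)[OF X] F_vec(1)[OF Y] and g\<psi> = functional_comp[OF F_lin[OF g] \<psi>]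
  have "coefficient a X Y x y (\<lambda>v. \<xi> (vmap (FArr F (Id C X)) v)) (\<lambda>w. \<psi> (vmap (FArr F g) w)) =
      coefficient a X Y x y \<xi> (\<lambda>w. \<psi> (vmap (FArr F g) w))"
    unfolding coefficient_def
    by (rule tensor_cong[OF lin_mapsD(1)[OF transport(1)[OF a X Y] pure_closed[OF x y]]
          product_bilinear[OF V functional_comp_id[OF X \<xi>] g\<psi>] product_bilinear[OF V \<xi> g\<psi>]])
      (simp add: F_id_apply[OF X])
  then show ?thesis
    using coefficient_natural[OF a id_hom[OF X] g x y \<xi> \<psi>] F_id_apply[OF X x] by simp
qed

lemma coefficient_functional:
  assumes a: "a \<in> carrier E" and X: "X \<in> Obj C" and Y: "Y \<in> Obj C"
  shows "y \<in> carrier (FObj F Y) \<Longrightarrow> functional (FObj F X) (\<lambda>x. coefficient a X Y x y \<xi> \<psi>)"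
    and "x \<in> carrier (FObj F X) \<Longrightarrow> functional (FObj F Y) (\<lambda>y. coefficient a X Y x y \<xi> \<psi>)"
proof -
  note V = F_vec(1)[OF X] F_vec(1)[OF Y]
  note \<eta> = functional_comp[OF transport(1)[OF a X Y] functional_evaluation,
      of "\<lambda>v w. \<xi> v * \<psi> w"]
  show "functional (FObj F X) (\<lambda>x. coefficient a X Y x y \<xi> \<psi>)" if y: "y \<in> carrier (FObj F Y)"
    unfolding functional_def coefficient_def
  proof (intro conjI ballI allI)
    fix u v c assume v: "v \<in> carrier (FObj F X)"
    note p = pure_closed[OF v y]
    show "transport a X Y (pure_tensor (FObj F X) (FObj F Y) (c \<odot>\<^bsub>FObj F X\<^esub> v) y) (\<lambda>v w. \<xi> v * \<psi> w) =
        c * transport a X Y (pure_tensor (FObj F X) (FObj F Y) v y) (\<lambda>v w. \<xi> v * \<psi> w)"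
      using functional_smult[OF \<eta> p, of c] pure_tensor_linear(3)[OF V v y] by simp
    assume u: "u \<in> carrier (FObj F X)"
    show "transport a X Y (pure_tensor (FObj F X) (FObj F Y) (u \<oplus>\<^bsub>FObj F X\<^esub> v) y) (\<lambda>v w. \<xi> v * \<psi> w) =
        transport a X Y (pure_tensor (FObj F X) (FObj F Y) u y) (\<lambda>v w. \<xi> v * \<psi> w) +
        transport a X Y (pure_tensor (FObj F X) (FObj F Y) v y) (\<lambda>v w. \<xi> v * \<psi> w)"
      using functional_add[OF \<eta> pure_closed[OF u y] p] pure_tensor_linear(1)[OF V u v y] by simp
  qed
  show "functional (FObj F Y) (\<lambda>y. coefficient a X Y x y \<xi> \<psi>)" if x: "x \<in> carrier (FObj F X)"
    unfolding functional_def coefficient_def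
  proof (intro conjI ballI allI)
    fix u v c assume v: "v \<in> carrier (FObj F Y)"
    note p = pure_closed[OF x v]
    show "transport a X Y (pure_tensor (FObj F X) (FObj F Y) x (c \<odot>\<^bsub>FObj F Y\<^esub> v)) (\<lambda>v w. \<xi> v * \<psi> w) =
        c * transport a X Y (pure_tensor (FObj F X) (FObj F Y) x v) (\<lambda>v w. \<xi> v * \<psi> w)"
      using functional_smult[OF \<eta> p, of c] pure_tensor_linear(4)[OF V x v] by simp
    assume u: "u \<in> carrier (FObj F Y)"
    show "transport a X Y (pure_tensor (FObj F X) (FObj F Y) x (u \<oplus>\<^bsub>FObj F Y\<^esub> v)) (\<lambda>v w. \<xi> v * \<psi> w) =
        transport a X Y (pure_tensor (FObj F X) (FObj F Y) x u) (\<lambda>v w. \<xi> v * \<psi> w) +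
        transport a X Y (pure_tensor (FObj F X) (FObj F Y) x v) (\<lambda>v w. \<xi> v * \<psi> w)"
      using functional_add[OF \<eta> pure_closed[OF x u] p] pure_tensor_linear(2)[OF V x u v] by simp
  qed
qed

text \<open>At each \<open>X\<close> the value \<open>b\<^sub>X x\<close> is the contraction by
  \<open>\<psi>\<close> of the transported action on \<open>x \<otimes> y\<close>.\<close>

lemma left_coefficient_endomorphism:
  assumes a: "a \<in> carrier E" and Y: "Y \<in> Obj C" and y: "y \<in> carrier (FObj F Y)"
    and \<psi>: "functional (FObj F Y) \<psi>"
  shows "\<exists>b\<in>carrier E. \<forall>X\<in>Obj C. \<forall>x\<in>carrier (FObj F X). \<forall>\<xi>. functional (FObj F X) \<xi> \<longrightarrow>
    \<xi> (vmap (b X) x) = coefficient a X Y x y \<xi> \<psi>"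
proof (rule E_from_coefficients)
  show "\<exists>m\<in>carrier (FObj F X). \<forall>\<xi>. functional (FObj F X) \<xi> \<longrightarrow> \<xi> m = coefficient a X Y x y \<xi> \<psi>"
    if X: "X \<in> Obj C" and x: "x \<in> carrier (FObj F X)" for X x
    unfolding coefficient_def
    by (rule tensor_slice_left[OF F_vec(1)[OF X] F_vec(1)[OF Y] \<psi>
          lin_mapsD(1)[OF transport(1)[OF a X Y] pure_closed[OF x y]]])
qed (rule coefficient_functional(1)[OF a _ Y y] coefficient_natural_left[OF a _ Y _ y _ \<psi>]; assumption)+

lemma right_coefficient_endomorphism:
  assumes a: "a \<in> carrier E" and X: "X \<in> Obj C" and x: "x \<in> carrier (FObj F X)"
    and \<xi>: "functional (FObj F X) \<xi>"
  shows "\<exists>c\<in>carrier E. \<forall>Y\<in>Obj C. \<forall>y\<in>carrier (FObj F Y). \<forall>\<psi>. functional (FObj F Y) \<psi> \<longrightarrow>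
    \<psi> (vmap (c Y) y) = coefficient a X Y x y \<xi> \<psi>"
proof (rule E_from_coefficients)
  show "\<exists>m\<in>carrier (FObj F Y). \<forall>\<psi>. functional (FObj F Y) \<psi> \<longrightarrow> \<psi> m = coefficient a X Y x y \<xi> \<psi>"
    if Y: "Y \<in> Obj C" and y: "y \<in> carrier (FObj F Y)" for Y y
    unfolding coefficient_def
    by (rule tensor_slice_right[OF F_vec(1)[OF X] F_vec(1)[OF Y] \<xi>
          lin_mapsD(1)[OF transport(1)[OF a X Y] pure_closed[OF x y]]])
qed (rule coefficient_functional(2)[OF a X _ x] coefficient_natural_right[OF a _ X x _ \<xi>]; assumption)+

text \<open>
  Expand the left coefficients of \<open>a\<close> in a basis \<open>u k\<close> of the finite-dimensional algebra of
  endomorphisms.  The coordinate functionals \<open>\<phi> k\<close> are combinations of matrix coefficients, and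
  the predicate \<open>P\<close> records that such functionals turn left coefficients into endomorphisms \<open>d k\<close>;
  then \<open>\<Sum>k. u k \<otimes> d k\<close> acts as \<open>a\<close> does.
\<close>

lemma transport_in_tensor:
  assumes a: "a \<in> carrier E"
  shows "\<exists>t\<in>carrier (tensor_space E E). \<forall>X\<in>Obj C. \<forall>Y\<in>Obj C.
    tensor_action C F X Y t = transport a X Y"
proof -
  define l where "l Y y \<psi> = (SOME b. b \<in> carrier E \<and> (\<forall>X\<in>Obj C. \<forall>x\<in>carrier (FObj F X). \<forall>\<xi>.
    functional (FObj F X) \<xi> \<longrightarrow> \<xi> (vmap (b X) x) = coefficient a X Y x y \<xi> \<psi>))" for Y y \<psi>
  have l: "l Y y \<psi> \<in> carrier E \<and> (\<forall>X\<in>Obj C. \<forall>x\<in>carrier (FObj F X). \<forall>\<xi>.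
      functional (FObj F X) \<xi> \<longrightarrow> \<xi> (vmap (l Y y \<psi> X) x) = coefficient a X Y x y \<xi> \<psi>)"
    if "Y \<in> Obj C" "y \<in> carrier (FObj F Y)" "functional (FObj F Y) \<psi>" for Y y \<psi>
    using left_coefficient_endomorphism[OF a that] unfolding Bex_def l_def by (rule someI_ex)
  note l1 = conjunct1[OF l]
  have l2: "\<xi> (vmap (l Y y \<psi> X) x) = coefficient a X Y x y \<xi> \<psi>"
    if "Y \<in> Obj C" "y \<in> carrier (FObj F Y)" "functional (FObj F Y) \<psi>"
      "X \<in> Obj C" "x \<in> carrier (FObj F X)" "functional (FObj F X) \<xi>" for X Y x y \<xi> \<psi>
    using l[OF that(1-3), THEN conjunct2, rule_format, OF that(4-6)] .
  \<comment> \<open>If the coproduct of \<open>a\<close> is pictured as a sum of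
    \<open>b \<otimes> c\<close>, then \<open>d\<close> is the sum of \<open>\<phi> b\<close> times
    \<open>c\<close>: \<open>\<phi>\<close> is applied to the first leg.\<close>
  define Q where "Q \<phi> d \<longleftrightarrow> (\<forall>Y\<in>Obj C. \<forall>y\<in>carrier (FObj F Y). \<forall>\<psi>. functional (FObj F Y) \<psi> \<longrightarrow>
    \<psi> (vmap (d Y) y) = \<phi> (l Y y \<psi>))" for \<phi> d
  define P where "P \<phi> \<longleftrightarrow> functional E \<phi> \<and> (\<exists>d\<in>carrier E. Q \<phi> d)" for \<phi>
  obtain \<Phi> where \<Phi>: "finite \<Phi>" "\<Phi> \<subseteq> matrix_coefficients"
      "\<forall>b\<in>carrier E. (\<forall>\<phi>\<in>\<Phi>. \<phi> b = 0) \<longrightarrow> b = \<zero>\<^bsub>E\<^esub>"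
    using finite_separating_coefficients by (elim exE conjE)
  have P_coeff: "P \<phi>" if "\<phi> \<in> \<Phi>" for \<phi>
  proof -
    have "\<phi> \<in> matrix_coefficients" using \<Phi>(2) that by auto
    then obtain X x \<xi> where \<phi>: "\<phi> = (\<lambda>a. \<xi> (vmap (a X) x))"
      and X: "X \<in> Obj C" "x \<in> carrier (FObj F X)" "functional (FObj F X) \<xi>"
      unfolding matrix_coefficients_def by (elim CollectE exE conjE) (rule that)
    obtain d where d: "d \<in> carrier E" "\<forall>Y\<in>Obj C. \<forall>y\<in>carrier (FObj F Y). \<forall>\<psi>.
        functional (FObj F Y) \<psi> \<longrightarrow> \<psi> (vmap (d Y) y) = coefficient a X Y x y \<xi> \<psi>"
      using right_coefficient_endomorphism[OF a X] by (elim bexE)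
    have "Q \<phi> d"
      unfolding Q_def \<phi>
    proof (intro ballI allI impI)
      fix Y y \<psi> assume Y: "Y \<in> Obj C" "y \<in> carrier (FObj F Y)" "functional (FObj F Y) \<psi>"
      \<comment> \<open>Both sides are the same coefficient of \<open>a\<close>, read once as an
        endomorphism in \<open>Y\<close> and once as an endomorphism in \<open>X\<close>.\<close>
      show "\<psi> (vmap (d Y) y) = \<xi> (vmap (l Y y \<psi> X) x)"
        unfolding l2[OF Y X] by (rule d(2)[rule_format, OF Y])
    qed
    then show ?thesis using functional_component[OF X] d(1) unfolding P_def \<phi> by blast
  qed
  have P_combine: "P (\<lambda>v. \<phi> v - c * \<phi>' v)" if P: "P \<phi>" "P \<phi>'" for \<phi> \<phi>' c
  proof -
    obtain d where d: "d \<in> carrier E" "Q \<phi> d" using P(1) unfolding P_def by (elim conjE bexE)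
    obtain d' where d': "d' \<in> carrier E" "Q \<phi>' d'" using P(2) unfolding P_def by (elim conjE bexE)
    define e where "e = d \<oplus>\<^bsub>E\<^esub> (- c) \<odot>\<^bsub>E\<^esub> d'"
    have cd': "(- c) \<odot>\<^bsub>E\<^esub> d' \<in> carrier E" by (rule E_smult_closed[OF d'(1)])
    have e: "e \<in> carrier E" unfolding e_def by (rule E_add_closed[OF d(1) cd'])
    have "Q (\<lambda>v. \<phi> v - c * \<phi>' v) e"
      unfolding Q_def
    proof (intro ballI allI impI)
      fix Y y \<psi> assume Y: "Y \<in> Obj C" "y \<in> carrier (FObj F Y)" and \<psi>: "functional (FObj F Y) \<psi>"
      note \<psi>' = functional_component[OF Y \<psi>]
      have "\<psi> (vmap (e Y) y) = \<psi> (vmap (d Y) y) + (- c) * \<psi> (vmap (d' Y) y)"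
        unfolding e_def functional_add[OF \<psi>' d(1) cd'] functional_smult[OF \<psi>' d'(1)] ..
      then show "\<psi> (vmap (e Y) y) = \<phi> (l Y y \<psi>) - c * \<phi>' (l Y y \<psi>)"
        using d(2)[unfolded Q_def, rule_format, OF Y \<psi>] d'(2)[unfolded Q_def, rule_format, OF Y \<psi>]
        by simp
    qed
    moreover have "functional E (\<lambda>v. \<phi> v - c * \<phi>' v)"
      using P by (intro functional_combine) (simp_all add: P_def)
    ultimately show ?thesis unfolding P_def using e by blast
  qed
  \<comment> \<open>Applying the elimination with this \<open>P\<close> yields coordinates on
    \<open>E\<close> each of which has a partner \<open>d\<close>.\<close>
  have "\<exists>(n::nat) u \<phi>. (\<forall>k<n. u k \<in> carrier E \<and> P (\<phi> k)) \<and>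
      (\<forall>\<chi>. functional E \<chi> \<longrightarrow> (\<forall>b\<in>carrier E. \<chi> b = (\<Sum>k<n. \<phi> k b * \<chi> (u k))))"
  proof (rule dual_basis_exists[where P = P, OF E_vspace \<Phi>(1) P_coeff])
    show "functional E \<phi>" if "P \<phi>" for \<phi> using that by (simp add: P_def)
    show "b = \<zero>\<^bsub>E\<^esub>" if "b \<in> carrier E" "\<And>\<phi>. \<phi> \<in> \<Phi> \<Longrightarrow> \<phi> b = 0" for b
      using \<Phi>(3) that by simp
  qed (assumption | rule subspace_of_carrier[OF E_vspace] | erule (1) P_combine)+
  then obtain n :: nat and u \<phi> where u: "\<forall>k<n. u k \<in> carrier E \<and> P (\<phi> k)"
      "\<forall>\<chi>. functional E \<chi> \<longrightarrow> (\<forall>b\<in>carrier E. \<chi> b = (\<Sum>k<n. \<phi> k b * \<chi> (u k)))"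
    by (elim exE conjE) (rule that)
  have "\<forall>k\<in>{..<n}. \<exists>d. d \<in> carrier E \<and> Q (\<phi> k) d" using u(1) by (auto simp: P_def)
  then obtain d where d: "\<forall>k\<in>{..<n}. d k \<in> carrier E \<and> Q (\<phi> k) (d k)"
    unfolding bchoice_iff by (elim exE)
  define t where "t = (\<lambda>\<beta>. \<Sum>k<n. pure_tensor E E (u k) (d k) \<beta>)"
  have t: "t \<in> carrier (tensor_space E E)"
    unfolding t_def tensor_carrier using u(1) d
    by (intro CollectI exI[of _ n] exI[of _ u] exI[of _ d]) simp
  have "tensor_action C F X Y t = transport a X Y" if X: "X \<in> Obj C" and Y: "Y \<in> Obj C" for X Y
  proof (rule lin_maps_tensor_eqI[OF F_vec(1)[OF X] F_vec(1)[OF Y] T_vec(1)[OF X Y]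
        tensor_action(1)[OF X Y t] transport(1)[OF a X Y]])
    fix x y assume x: "x \<in> carrier (FObj F X)" and y: "y \<in> carrier (FObj F Y)"
    note p = pure_closed[OF x y]
    show "tensor_action C F X Y t (pure_tensor (FObj F X) (FObj F Y) x y) =
        transport a X Y (pure_tensor (FObj F X) (FObj F Y) x y)"
    proof (rule tensor_eqI[OF F_vec(2)[OF X] F_vec(1)[OF Y] lin_mapsD(1)[OF tensor_action(1)[OF X Y t] p]
          lin_mapsD(1)[OF transport(1)[OF a X Y] p]])
      fix \<xi> \<psi> assume \<xi>: "functional (FObj F X) \<xi>" and \<psi>: "functional (FObj F Y) \<psi>"
      note f = functional_component[OF X x \<xi>] and g = functional_component[OF Y y \<psi>]
      have "tensor_action C F X Y t (pure_tensor (FObj F X) (FObj F Y) x y) (\<lambda>v w. \<xi> v * \<psi> w) =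
          (\<Sum>k<n. \<xi> (vmap (u k X) x) * \<psi> (vmap (d k Y) y))"
        unfolding tensor_action_pure[OF X Y t x y \<xi> \<psi>]
        by (simp add: t_def pure_tensor_apply[OF product_bilinear[OF E_vspace E_vspace f g]])
      also have "\<dots> = (\<Sum>k<n. \<phi> k (l Y y \<psi>) * \<xi> (vmap (u k X) x))"
      proof (rule sum.cong[OF refl])
        fix k assume "k \<in> {..<n}"
        then have "Q (\<phi> k) (d k)" using d by simp
        then show "\<xi> (vmap (u k X) x) * \<psi> (vmap (d k Y) y) = \<phi> k (l Y y \<psi>) * \<xi> (vmap (u k X) x)"
          unfolding Q_def using Y y \<psi> by simp
      qed
      \<comment> \<open>This is the expansion of \<open>l Y y \<psi>\<close> in the basis
        \<open>u\<close>, tested by the matrix coefficient of \<open>x\<close> and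
        \<open>\<xi>\<close> at \<open>X\<close>.\<close>
      also have "\<dots> = \<xi> (vmap (l Y y \<psi> X) x)"
        by (rule u(2)[rule_format, OF f l1[OF Y y \<psi>], symmetric])
      also have "\<dots> = transport a X Y (pure_tensor (FObj F X) (FObj F Y) x y) (\<lambda>v w. \<xi> v * \<psi> w)"
        unfolding l2[OF Y y \<psi> X x \<xi>] coefficient_def ..
      finally show "tensor_action C F X Y t (pure_tensor (FObj F X) (FObj F Y) x y) (\<lambda>v w. \<xi> v * \<psi> w) =
          transport a X Y (pure_tensor (FObj F X) (FObj F Y) x y) (\<lambda>v w. \<xi> v * \<psi> w)" .
    qed
  qed
  with t show ?thesis by blast
qed

text \<open>This isolates the condition under the definite description in \<open>coproduct\<close>,
  so that existence and uniqueness become separate statements.\<close>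

definition is_coproduct where
  "is_coproduct a t \<longleftrightarrow> t \<in> carrier (tensor_space E E) \<and>
     (\<forall>X\<in>Obj C. \<forall>Y\<in>Obj C. \<forall>z\<in>carrier (T X Y).
        FibTens F X Y (tensor_action C F X Y t z) = vmap (a (X \<boxdot>\<^bsub>C\<^esub> Y)) (FibTens F X Y z))"

text \<open>Injectivity of \<open>FibTens\<close> leaves two tensors with the same action
  everywhere, and the action is faithful by \<open>tensor_action_inj\<close>.\<close>

lemma is_coproduct_unique:
  assumes s: "is_coproduct a s" and t: "is_coproduct a t"
  shows "s = t"
proof (rule tensor_action_inj)
  show s': "s \<in> carrier (tensor_space E E)" and t': "t \<in> carrier (tensor_space E E)"
    using s t by (simp_all add: is_coproduct_def)
  fix X Y z assume X: "X \<in> Obj C" and Y: "Y \<in> Obj C" and z: "z \<in> carrier (T X Y)"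
  show "tensor_action C F X Y s z = tensor_action C F X Y t z"
    using s t X Y z
    by (intro FibTens_inj[OF X Y lin_mapsD(1)[OF tensor_action(1)[OF X Y s'] z]
          lin_mapsD(1)[OF tensor_action(1)[OF X Y t'] z]]) (simp add: is_coproduct_def)
qed

lemma coproduct_eqI: "is_coproduct a t \<Longrightarrow> coproduct C F a = t"
  unfolding coproduct_def EndF_eq is_coproduct_def[symmetric]
  by (rule the_equality) (simp_all add: is_coproduct_unique)

lemma is_coproduct_coproduct:
  assumes a: "a \<in> carrier E"
  shows "is_coproduct a (coproduct C F a)"
proof -
  obtain t where t: "t \<in> carrier (tensor_space E E)"
      "\<forall>X\<in>Obj C. \<forall>Y\<in>Obj C. tensor_action C F X Y t = transport a X Y"
    using transport_in_tensor[OF a] by (elim bexE)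
  have "is_coproduct a t" unfolding is_coproduct_def using t transport(2)[OF a] by simp
  then show ?thesis using coproduct_eqI by simp
qed

end

section \<open>Restriction along a quasi-tensor functor\<close>

lemma fiber_comp_simps [simp]:
  "FObj (fiber_comp F G) X = FObj F (FObj G X)"
  "FArr (fiber_comp F G) f = FArr F (FArr G f)"
  "FibUnit (fiber_comp F G) = FibUnit F"
  "FibTens (fiber_comp F G) X Y =
     compose (carrier (tensor_space (FObj F (FObj G X)) (FObj F (FObj G Y))))
       (vmap (FArr F (QTens G X Y))) (FibTens F (FObj G X) (FObj G Y))"
  by (simp_all add: fiber_comp_def)

locale fiber_restriction =
  source: finite_tensor_category C + target: fiber_functor D F + G: quasi_tensor_functor C D G
  for C :: "('o1, 'm1, 'x) tcat_scheme" and D :: "('o2, 'm2, 'y) tcat_scheme"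
    and F :: "('o2, 'm2, 'v) fiber" and G :: "('o1, 'm1, 'o2, 'm2) qtensor"
begin

section \<open>The composite as a quasi-fiber functor\<close>

lemma G_arr: "f \<in> Arr C \<Longrightarrow> FArr G f \<in> Arr D"
  using G.F_hom[of f "Dom C f" "Cod C f"] by (simp add: Hom_def)

lemma FibTens_comp_iso:
  assumes X: "X \<in> Obj C" and Y: "Y \<in> Obj C"
  shows "FibTens (fiber_comp F G) X Y \<in>
    lin_isos (tensor_space (FObj F (FObj G X)) (FObj F (FObj G Y))) (FObj F (FObj G (X \<boxdot>\<^bsub>C\<^esub> Y)))"
proof -
  note GX = G.F_obj[OF X] and GY = G.F_obj[OF Y]
  note J = target.FibTens_iso[OF GX GY]
  have "compose (carrier (target.T (FObj G X) (FObj G Y))) (vmap (FArr F (QTens G X Y)))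
      (FibTens F (FObj G X) (FObj G Y)) \<in>
      lin_maps (target.T (FObj G X) (FObj G Y)) (FObj F (FObj G (X \<boxdot>\<^bsub>C\<^esub> Y)))"
    by (rule lin_maps_comp[OF target.T_vec(1)[OF GX GY] J(1) target.F_lin[OF G.G_tens_hom[OF X Y]]])
  moreover have "bij_betw (compose (carrier (target.T (FObj G X) (FObj G Y)))
      (vmap (FArr F (QTens G X Y))) (FibTens F (FObj G X) (FObj G Y)))
      (carrier (target.T (FObj G X) (FObj G Y))) (carrier (FObj F (FObj G (X \<boxdot>\<^bsub>C\<^esub> Y))))"
    by (rule bij_betw_compose[OF J(2) target.F_iso_bij[OF G.G_tens_hom[OF X Y] G.G_tens_iso[OF X Y]]])
  ultimately show ?thesis by (simp add: lin_isos_def)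
qed

lemma FibTens_comp_natural:
  assumes f: "f \<in> Hom C X X'" and g: "g \<in> Hom C Y Y'"
    and z: "z \<in> carrier (target.T (FObj G X) (FObj G Y))"
  shows "FibTens (fiber_comp F G) X' Y'
      (tensor_map (FObj F (FObj G X)) (FObj F (FObj G Y)) (FObj F (FObj G X')) (FObj F (FObj G Y'))
        (vmap (FArr F (FArr G f))) (vmap (FArr F (FArr G g))) z) =
    vmap (FArr F (FArr G (f \<boxtimes>\<^bsub>C\<^esub> g))) (FibTens (fiber_comp F G) X Y z)"
proof -
  have objs: "X \<in> Obj C" "X' \<in> Obj C" "Y \<in> Obj C" "Y' \<in> Obj C"
    using source.hom_objs[OF f] source.hom_objs[OF g] by auto
  note Gf = G.F_hom[OF f] and Gg = G.F_hom[OF g]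
  note Gobj = G.F_obj[OF objs(1)] G.F_obj[OF objs(3)] G.F_obj[OF objs(2)] G.F_obj[OF objs(4)]
  let ?fg = "tensor_map (FObj F (FObj G X)) (FObj F (FObj G Y)) (FObj F (FObj G X')) (FObj F (FObj G Y'))
        (vmap (FArr F (FArr G f))) (vmap (FArr F (FArr G g)))"
  have fgz: "?fg z \<in> carrier (target.T (FObj G X') (FObj G Y'))"
    by (rule lin_mapsD(1)[OF tensor_map(1)[OF target.F_vec(1)[OF Gobj(1)] target.F_vec(1)[OF Gobj(2)]
          target.F_vec(1)[OF Gobj(3)] target.F_vec(1)[OF Gobj(4)] target.F_lin[OF Gf] target.F_lin[OF Gg]] z])
  have Jz: "FibTens F (FObj G X) (FObj G Y) z \<in> carrier (FObj F (FObj G X \<boxdot>\<^bsub>D\<^esub> FObj G Y))"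
    by (rule lin_mapsD(1)[OF target.FibTens_iso(1)[OF Gobj(1,2)] z])
  have "FibTens (fiber_comp F G) X' Y' (?fg z) =
      vmap (FArr F (QTens G X' Y')) (vmap (FArr F (FArr G f \<boxtimes>\<^bsub>D\<^esub> FArr G g)) (FibTens F (FObj G X) (FObj G Y) z))"
    using fgz by (simp add: compose_def target.F_tens_natural[OF Gf Gg z])
  also have "\<dots> = vmap (FArr F (QTens G X' Y' \<cdot>\<^bsub>D\<^esub> (FArr G f \<boxtimes>\<^bsub>D\<^esub> FArr G g))) (FibTens F (FObj G X) (FObj G Y) z)"
    by (rule target.F_comp_apply[OF target.tens_hom[OF Gf Gg] G.G_tens_hom[OF objs(2,4)] Jz, symmetric])
  also have "\<dots> = vmap (FArr F (FArr G (f \<boxtimes>\<^bsub>C\<^esub> g) \<cdot>\<^bsub>D\<^esub> QTens G X Y)) (FibTens F (FObj G X) (FObj G Y) z)"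
    unfolding G.G_tens_natural[OF f g] ..
  also have "\<dots> = vmap (FArr F (FArr G (f \<boxtimes>\<^bsub>C\<^esub> g)))
      (vmap (FArr F (QTens G X Y)) (FibTens F (FObj G X) (FObj G Y) z))"
    by (rule target.F_comp_apply[OF G.G_tens_hom[OF objs(1,3)] G.F_hom[OF source.tens_hom[OF f g]] Jz])
  finally show ?thesis using z by (simp add: compose_def)
qed

text \<open>This makes the preceding theory available for the composite, in particular uniqueness of
  coproducts in the larger algebra.\<close>

lemma fiber_comp_fiber_functor: "fiber_functor C (fiber_comp F G)"
proof -
  have "linear_functor C Vec (fiber_comp F G)"
  proof (rule linear_functor.intro; unfold fiber_comp_simps)
    show "FArr F (FArr G (g \<cdot>\<^bsub>C\<^esub> f)) = FArr F (FArr G g) \<cdot>\<^bsub>Vec\<^esub> FArr F (FArr G f)"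
      if "f \<in> Hom C X Y" "g \<in> Hom C Y Z" for f g X Y Z
      by (simp add: G.F_comp[OF that] target.F_comp[OF G.F_hom[OF that(1)] G.F_hom[OF that(2)]])
    show "FArr F (FArr G (AddA C f g)) = AddA Vec (FArr F (FArr G f)) (FArr F (FArr G g))"
      if "f \<in> Hom C X Y" "g \<in> Hom C X Y" for f g X Y
      by (simp add: G.F_add[OF that] target.F_add[OF G.F_hom[OF that(1)] G.F_hom[OF that(2)]])
    show "FArr F (FArr G f) \<in> Hom Vec (FObj F (FObj G X)) (FObj F (FObj G Y))"
      if "f \<in> Hom C X Y" for f X Y
      by (rule target.F_hom[OF G.F_hom[OF that]])
  qed (simp_all add: G.F_obj target.F_obj G.F_id target.F_id G.F_scale target.F_scale G_arr)
  moreover have "exact_faithful_functor_axioms C Vec (fiber_comp F G)"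
  proof (rule exact_faithful_functor_axioms.intro; unfold fiber_comp_simps)
    show "f = g" if "f \<in> Hom C X Y" "g \<in> Hom C X Y" "FArr F (FArr G f) = FArr F (FArr G g)"
      for f g X Y
      by (rule G.F_faithful[OF that(1,2) target.F_faithful[OF G.F_hom[OF that(1)] G.F_hom[OF that(2)] that(3)]])
    show "short_exact Vec (FArr F (FArr G f)) (FArr F (FArr G g))" if "short_exact C f g" for f g
      by (rule target.F_exact[OF G.F_exact[OF that]])
  qed
  moreover have "quasi_fiber_functor_axioms C (fiber_comp F G)"
  proof (rule quasi_fiber_functor_axioms.intro)
    show "FibUnit (fiber_comp F G) \<in> lin_isos complex_line (FObj (fiber_comp F G) (UnitO C))"
      using target.F_unit by (simp add: G.G_unit)
  qed (unfold fiber_comp_simps(1,2), rule FibTens_comp_iso, assumption+, rule FibTens_comp_natural)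
  ultimately show ?thesis
    by (intro fiber_functor.intro source.finite_tensor_category_axioms quasi_fiber_functor.intro
        exact_faithful_functor.intro)
qed

end

sublocale fiber_restriction \<subseteq> restricted: fiber_functor C "fiber_comp F G"
  by (rule fiber_comp_fiber_functor)

context fiber_restriction
begin

section \<open>The restriction map and its compatibility with the structure\<close>

definition restriction where
  "restriction = (\<lambda>a\<in>carrier target.E. \<lambda>X\<in>Obj C. a (FObj G X))"

lemma restriction_apply:
  "\<lbrakk>a \<in> carrier target.E; X \<in> Obj C\<rbrakk> \<Longrightarrow> restriction a X = a (FObj G X)"
  by (simp add: restriction_def)

lemma restriction_closed:
  assumes a: "a \<in> carrier target.E"
  shows "restriction a \<in> carrier restricted.E"
proof -
  have "restriction a = (\<lambda>X\<in>Obj C. (FObj (fiber_comp F G) X, vmap (a (FObj G X)), FObj (fiber_comp F G) X))"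
    using a target.E_hom[OF a G.F_obj] unfolding Vec_hom_iff
    by (auto simp: restriction_def fun_eq_iff)
  also have "\<dots> \<in> carrier restricted.E"
  proof (rule restricted.E_intro)
    show "vmap (a (FObj G X)) \<in> lin_maps (FObj (fiber_comp F G) X) (FObj (fiber_comp F G) X)"
      if "X \<in> Obj C" for X
      using target.E_lin[OF a G.F_obj[OF that]] by simp
    show "vmap (a (FObj G Y)) (vmap (FArr (fiber_comp F G) f) x) =
        vmap (FArr (fiber_comp F G) f) (vmap (a (FObj G X)) x)"
      if "f \<in> Hom C X Y" "x \<in> carrier (FObj (fiber_comp F G) X)" for X Y f x
      using target.E_natural[OF a G.F_hom[OF that(1)]] that(2) by simp
  qed
  finally show ?thesis .
qed

lemma restriction_eqI:
  assumes a: "a \<in> carrier target.E" and c: "c \<in> extensional (Obj C)"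
    and eq: "\<And>X. X \<in> Obj C \<Longrightarrow> a (FObj G X) = c X"
  shows "restriction a = c"
  using c eq a by (auto simp: restriction_def fun_eq_iff extensional_def)

lemma restriction_algebra_hom: "restriction \<in> algebra_homs target.E restricted.E"
proof -
  have add: "restriction (a \<oplus>\<^bsub>target.E\<^esub> b) = restriction a \<oplus>\<^bsub>restricted.E\<^esub> restriction b"
    if "a \<in> carrier target.E" "b \<in> carrier target.E" for a b
    by (rule restriction_eqI[OF target.E_add_closed[OF that]])
      (simp_all add: restricted.E_simps target.E_simps restriction_apply that G.F_obj)
  have mult: "restriction (a \<otimes>\<^bsub>target.E\<^esub> b) = restriction a \<otimes>\<^bsub>restricted.E\<^esub> restriction b"
    if "a \<in> carrier target.E" "b \<in> carrier target.E" for a b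
    by (rule restriction_eqI[OF target.E_mult_closed[OF that]])
      (simp_all add: restricted.E_simps target.E_simps restriction_apply that G.F_obj)
  have one: "restriction \<one>\<^bsub>target.E\<^esub> = \<one>\<^bsub>restricted.E\<^esub>"
    by (rule restriction_eqI[OF target.E_one_closed])
      (simp_all add: restricted.E_simps target.E_simps G.F_obj)
  have smult: "restriction (c \<odot>\<^bsub>target.E\<^esub> a) = c \<odot>\<^bsub>restricted.E\<^esub> restriction a"
    if "a \<in> carrier target.E" for a c
    by (rule restriction_eqI[OF target.E_smult_closed[OF that]])
      (simp_all add: restricted.E_simps target.E_simps restriction_apply that G.F_obj)
  have "restriction \<in> lin_maps target.E restricted.E"
    by (rule lin_mapsI) (simp_all add: add smult restriction_closed, simp add: restriction_def)
  moreover have "restriction \<in> ring_hom target.E restricted.E"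
    by (rule ring_hom_memI) (simp_all add: restriction_closed add mult one)
  ultimately show ?thesis by (simp add: algebra_homs_def)
qed

lemma restriction_inj:
  assumes ess: "essentially_surjective C D G"
  shows "inj_on restriction (carrier target.E)"
proof (rule inj_onI)
  fix a b assume a: "a \<in> carrier target.E" and b: "b \<in> carrier target.E"
    and eq: "restriction a = restriction b"
  show "a = b"
  proof (rule target.E_eqI[OF a b])
    fix Y y assume Y: "Y \<in> Obj D" and y: "y \<in> carrier (FObj F Y)"
    obtain X where X: "X \<in> Obj C" "isomorphic D (FObj G X) Y"
      using ess Y unfolding essentially_surjective_def by blast
    then obtain h where h: "h \<in> Hom D (FObj G X) Y" "is_iso_arr D h" unfolding isomorphic_def by blast
    \<comment> \<open>Every vector over \<open>Y\<close> is the image of one over some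
      \<open>G X\<close>, where \<open>a\<close> and \<open>b\<close> agree; naturality at the
      isomorphism \<open>h\<close> carries the agreement to \<open>Y\<close>.\<close>
    obtain x where x: "x \<in> carrier (FObj F (FObj G X))" "y = vmap (FArr F h) x"
      using bij_betw_imp_surj_on[OF target.F_iso_bij[OF h]] y by blast
    have "a (FObj G X) = b (FObj G X)"
      using eq restriction_apply[OF a X(1)] restriction_apply[OF b X(1)] by simp
    then show "vmap (a Y) y = vmap (b Y) y"
      unfolding x(2) target.E_natural[OF a h(1) x(1)] target.E_natural[OF b h(1) x(1)] by simp
  qed
qed

lemma restriction_lin_maps: "restriction \<in> lin_maps target.E restricted.E"
  using restriction_algebra_hom by (simp add: algebra_homs_def)

text \<open>The component of a restricted endomorphism at \<open>X\<close> is the original component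
  at \<open>G X\<close>; pulling the defining bilinear form back along restriction in both slots
  therefore gives the form for \<open>G X\<close> and \<open>G Y\<close>.\<close>

lemma restriction_tensor_action:
  assumes t: "t \<in> carrier (tensor_space target.E target.E)" and X: "X \<in> Obj C" and Y: "Y \<in> Obj C"
    and z: "z \<in> carrier (target.T (FObj G X) (FObj G Y))"
  shows "tensor_action C (fiber_comp F G) X Y
      (tensor_map target.E target.E restricted.E restricted.E restriction restriction t) z =
    tensor_action D F (FObj G X) (FObj G Y) t z"
proof (rule ext)
  fix \<beta>
  let ?s = "tensor_map target.E target.E restricted.E restricted.E restriction restriction t"
  note V = target.E_vspace target.E_vspace restricted.E_vspace restricted.E_vspace
  note tm = tensor_map[OF V restriction_lin_maps restriction_lin_maps]
  note s = lin_mapsD(1)[OF tm(1) t]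
  have z': "z \<in> carrier (restricted.T X Y)" using z by simp
  note GX = G.F_obj[OF X] and GY = G.F_obj[OF Y]
  let ?B = "\<lambda>b c. tensor_map (FObj F (FObj G X)) (FObj F (FObj G Y)) (FObj F (FObj G X)) (FObj F (FObj G Y))
      (vmap (b X)) (vmap (c Y)) z \<beta>"
  let ?B' = "\<lambda>b c. tensor_map (FObj F (FObj G X)) (FObj F (FObj G Y)) (FObj F (FObj G X)) (FObj F (FObj G Y))
      (vmap (b (FObj G X))) (vmap (c (FObj G Y))) z \<beta>"
  have B: "?B \<in> bilinear_forms restricted.E restricted.E"
    using restricted.tensor_action(3)[OF X Y s z'] by simp
  have "tensor_action C (fiber_comp F G) X Y ?s z \<beta> = ?s ?B"
    using restricted.tensor_action(2)[OF X Y s z'] by simp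
  also have "\<dots> = t (\<lambda>b c. ?B (restriction b) (restriction c))"
    by (rule tm(3)[OF t B])
  also have "\<dots> = t ?B'"
    by (rule tensor_cong[OF t lin_maps_bilinear[OF V restriction_lin_maps restriction_lin_maps B]
          target.tensor_action(3)[OF GX GY t z]])
      (simp add: restriction_apply X Y)
  also have "\<dots> = tensor_action D F (FObj G X) (FObj G Y) t z \<beta>"
    by (rule target.tensor_action(2)[OF GX GY t z, symmetric])
  finally show "tensor_action C (fiber_comp F G) X Y ?s z \<beta> =
      tensor_action D F (FObj G X) (FObj G Y) t z \<beta>" .
qed

text \<open>By uniqueness for the composite it is enough that the image of the coproduct of
  \<open>a\<close> satisfies the defining equation there.\<close>

lemma restriction_coproduct:
  assumes a: "a \<in> carrier target.E"
  shows "coproduct C (fiber_comp F G) (restriction a) =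
    tensor_map target.E target.E restricted.E restricted.E restriction restriction (coproduct D F a)"
proof (rule restricted.coproduct_eqI)
  let ?t = "coproduct D F a"
  let ?s = "tensor_map target.E target.E restricted.E restricted.E restriction restriction ?t"
  note t = target.is_coproduct_coproduct[OF a, unfolded target.is_coproduct_def]
  note t1 = conjunct1[OF t] and t2 = conjunct2[OF t, rule_format]
  note V = target.E_vspace target.E_vspace restricted.E_vspace restricted.E_vspace
  note s = lin_mapsD(1)[OF tensor_map(1)[OF V restriction_lin_maps restriction_lin_maps] t1]
  show "restricted.is_coproduct (restriction a) ?s"
    unfolding restricted.is_coproduct_def
  proof (intro conjI ballI s)
    fix X Y z assume X: "X \<in> Obj C" and Y: "Y \<in> Obj C" and "z \<in> carrier (restricted.T X Y)"
    then have z: "z \<in> carrier (target.T (FObj G X) (FObj G Y))" by simp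
    note GX = G.F_obj[OF X] and GY = G.F_obj[OF Y]
    note az = lin_mapsD(1)[OF target.tensor_action(1)[OF GX GY t1] z]
    have "FibTens (fiber_comp F G) X Y (tensor_action C (fiber_comp F G) X Y ?s z) =
        vmap (FArr F (QTens G X Y)) (vmap (a (FObj G X \<boxdot>\<^bsub>D\<^esub> FObj G Y)) (FibTens F (FObj G X) (FObj G Y) z))"
      using az by (simp add: restriction_tensor_action[OF t1 X Y z] compose_def t2[OF GX GY z])
    \<comment> \<open>The tensor isomorphism of the composite has the extra factor
      \<open>QTens G X Y\<close>, an arrow of the target category, so naturality of \<open>a\<close>
      moves it past.\<close>
    also have "\<dots> = vmap (a (FObj G (X \<boxdot>\<^bsub>C\<^esub> Y))) (vmap (FArr F (QTens G X Y)) (FibTens F (FObj G X) (FObj G Y) z))"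
      by (rule target.E_natural[OF a G.G_tens_hom[OF X Y]
            lin_mapsD(1)[OF target.FibTens_iso(1)[OF GX GY] z], symmetric])
    finally show "FibTens (fiber_comp F G) X Y (tensor_action C (fiber_comp F G) X Y ?s z) =
        vmap (restriction a (X \<boxdot>\<^bsub>C\<^esub> Y)) (FibTens (fiber_comp F G) X Y z)"
      using z by (simp add: restriction_apply[OF a source.tens_obj[OF X Y]] compose_def)
  qed
qed

text \<open>\<open>G\<close> preserves the unit object on the nose and the composite keeps
  \<open>FibUnit F\<close>, so the two definite descriptions coincide.\<close>

lemma restriction_counit:
  assumes "a \<in> carrier target.E"
  shows "counit C (fiber_comp F G) (restriction a) = counit D F a"
  by (simp add: counit_def restriction_apply[OF assms source.unit_obj] G.G_unit)

end

theorem proposition3p5: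
  fixes \<C> :: "('o1, 'm1) tcat"
    and \<D> :: "('o2, 'm2) tcat"
    and F :: "('o2, 'm2, 'v) fiber"
    and G :: "('o1, 'm1, 'o2, 'm2) qtensor"
  defines "C \<equiv> EndF \<D> F"
    and "U \<equiv> EndF \<C> (fiber_comp F G)"
  assumes "finite_tensor_category \<C>"
    and "finite_tensor_category \<D>"
    and "quasi_fiber_functor \<D> F"
    and "quasi_tensor_functor \<C> \<D> G"
    and "essentially_surjective \<C> \<D> G"
  shows "\<exists>\<iota>. \<iota> \<in> algebra_homs C U \<and> inj_on \<iota> (carrier C) \<and>
           (\<forall>a\<in>carrier C.
              coproduct \<C> (fiber_comp F G) (\<iota> a) = tensor_map C C U U \<iota> \<iota> (coproduct \<D> F a) \<and>
              counit \<C> (fiber_comp F G) (\<iota> a) = counit \<D> F a)"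
proof -
  interpret fiber_restriction \<C> \<D> F G
    using assms(3-6) by (intro fiber_restriction.intro fiber_functor.intro)
  show ?thesis
    unfolding C_def U_def target.EndF_eq restricted.EndF_eq
    using restriction_algebra_hom restriction_inj[OF assms(7)] restriction_coproduct restriction_counit
    by (intro exI[of _ restriction]) blast
qed

end
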